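(* Let $(X,d)$ be a compact metric space whose topological (covering) dimension is bigger than one, and let $\phi$ be a regular expansive continuous flow on $X$. Then $X$ contains infinitely many minimal subsets for $\phi$.
   Context: A continuous flow on $X$ is a continuous map $\phi\colon\mathbb{R}\times X\to X$, $\phi_t=\phi(t,\cdot)$, with $\phi_0=\mathrm{id}$ and $\phi_{t+s}=\phi_s\circ\phi_t$. It is regular if it has no fixed points (no $x$ with $\phi_t(x)=x$ for all $t$). A minimal subset is a nonempty compact set $K$ with $\phi_t(K)=K$ for all $t$ containing no nonempty proper compact invariant subset. Let $Rep$ be the set of increasing homeomorphisms $h\colon\mathbb{R}\to\mathbb{R}$ with $h(0)=0$. The flow $\phi$ is expansive if for every $\varepsilon>0$ there is $\delta>0$ such that whenever $x,y\in X$ and $h\in Rep$ satisfy $d(\phi_t(x),\phi_{h(t)}(y))\le\delta$ for all $t\in\mathbb{R}$, then $y\in\phi_{[-\varepsilon,\varepsilon]}(x)$. *)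

theory Defs
  imports "HOL-Analysis.Analysis"
begin

definition continuous_flow :: "(real \<Rightarrow> 'a::metric_space \<Rightarrow> 'a) \<Rightarrow> 'a set \<Rightarrow> bool" where
  "continuous_flow \<phi> X \<longleftrightarrow>
     continuous_on (UNIV \<times> X) (\<lambda>(t,x). \<phi> t x) \<and>
     (\<forall>t. \<forall>x\<in>X. \<phi> t x \<in> X) \<and>
     (\<forall>x\<in>X. \<phi> 0 x = x) \<and>
     (\<forall>t s. \<forall>x\<in>X. \<phi> (t + s) x = \<phi> s (\<phi> t x))"

definition regular_flow :: "(real \<Rightarrow> 'a \<Rightarrow> 'a) \<Rightarrow> 'a set \<Rightarrow> bool" where
  "regular_flow \<phi> X \<longleftrightarrow> \<not> (\<exists>x\<in>X. \<forall>t. \<phi> t x = x)"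

definition invariant_set :: "(real \<Rightarrow> 'a \<Rightarrow> 'a) \<Rightarrow> 'a set \<Rightarrow> bool" where
  "invariant_set \<phi> K \<longleftrightarrow> (\<forall>t. \<phi> t ` K = K)"

definition minimal_set :: "(real \<Rightarrow> 'a::topological_space \<Rightarrow> 'a) \<Rightarrow> 'a set \<Rightarrow> 'a set \<Rightarrow> bool" where
  "minimal_set \<phi> X K \<longleftrightarrow> K \<subseteq> X \<and> K \<noteq> {} \<and> compact K \<and> invariant_set \<phi> K \<and>
     \<not> (\<exists>L. L \<noteq> {} \<and> L \<subset> K \<and> compact L \<and> invariant_set \<phi> L)"

definition Rep :: "(real \<Rightarrow> real) set" where
  "Rep = {h. (\<exists>g. homeomorphism UNIV UNIV h g) \<and> strict_mono h \<and> h 0 = 0}"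

definition expansive_flow :: "(real \<Rightarrow> 'a::metric_space \<Rightarrow> 'a) \<Rightarrow> 'a set \<Rightarrow> bool" where
  "expansive_flow \<phi> X \<longleftrightarrow>
     (\<forall>\<epsilon>>0. \<exists>\<delta>>0. \<forall>x\<in>X. \<forall>y\<in>X. \<forall>h\<in>Rep.
        (\<forall>t. dist (\<phi> t x) (\<phi> (h t) y) \<le> \<delta>) \<longrightarrow> y \<in> (\<lambda>s. \<phi> s x) ` {-\<epsilon>..\<epsilon>})"

definition covering_dim_le :: "'a::topological_space set \<Rightarrow> nat \<Rightarrow> bool" where
  "covering_dim_le X n \<longleftrightarrow>
     (\<forall>\<U>. finite \<U> \<and> (\<forall>U\<in>\<U>. openin (top_of_set X) U) \<and> X \<subseteq> \<Union>\<U> \<longrightarrow>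
        (\<exists>\<V>. finite \<V> \<and> (\<forall>V\<in>\<V>. openin (top_of_set X) V) \<and> X \<subseteq> \<Union>\<V> \<and>
             (\<forall>V\<in>\<V>. \<exists>U\<in>\<U>. V \<subseteq> U) \<and>
             (\<forall>x\<in>X. card {V\<in>\<V>. x \<in> V} \<le> n + 1)))"

end

theory Submission
  imports Defs
begin

text \<open>Suppose there are only finitely many minimal sets and pick a point in each of them. We construct
  an orbit staying away from all these points; its closure contains a further minimal set.

  Local sections come from Bebutov's trick. If they contained no small nondegenerate continua, then
  \<open>X\<close> would be a finite union of boxes (zero-dimensional compact set times interval), hence of
  covering dimension at most one. So there are arbitrarily small continua in local sections, and by
  expansivity they grow to a definite size under the flow or under its inverse; say in the former case, and
  then their backward images stay small. Such a continuum contains only boundedly many points that have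
  recently visited a given point \<open>p\<close> of a minimal set, the bound being independent of the time window.
  Hence one can cut out a piece of definite size avoiding these points, let it grow again (which
  takes a bounded time), cut again, and so on (Mane's method).

  The bound is clear if \<open>p\<close> is periodic. Otherwise at most one visit is possible: two points of one
  orbit whose backward orbits stay close would force the minimal set to contain a periodic orbit. As flows allow
  reparametrisation, the delay between the two points might drift to infinity, and
  excluding this is the delicate point (lemma \<open>no_self_tracking\<close>).\<close>

section \<open>Preliminaries\<close>

text \<open>Expansivity allows arbitrary time changes, and \<open>Rep\<close> is not closed under
  limits. Reparametrised orbits are therefore replaced by sequences of points in which each step
  takes a time in [1 - \<kappa>, 1 + \<kappa>]. Being such a sequence is a closed condition in a
  product of compact spaces, so uniform statements can be proved by contradiction and a pointwise
  limit. Linear interpolation of the times gives back an element of \<open>Rep\<close> at the single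
  place where expansivity is invoked. The price is that time differences are known only up to an
  error, and errors add up under iteration. The lack of periods below \<open>\<tau>\<close> repairs
  this each time: a discrepancy known to be at most \<open>\<tau>\<close> is tiny as soon as the end
  points are close. All sections are kept in one closed relation:
  \<open>(w, y) \<in> \<Sigma>\<close> says that \<open>y\<close> is on the section through
  \<open>w\<close>. Limits of points on sections through \<open>w n\<close> then lie on the section
  through the limit of \<open>w n\<close>. The constants and \<open>\<Sigma>\<close> serve the
  inverse flow as well, which lets one continuum be followed in both time directions.\<close>

lemma pointwise_convergent_subsequence:
  fixes F :: "nat \<Rightarrow> 'i::countable \<Rightarrow> 'a::metric_space"
  assumes F: "\<And>n i. F n i \<in> K i" and K: "\<And>i. compact (K i)"
  obtains l r where "strict_mono (r :: nat \<Rightarrow> nat)" "\<And>i. l i \<in> K i" "\<And>i. (\<lambda>n. F (r n) i) \<longlonglongrightarrow> l i"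
proof -
  have "compactin (product_topology (\<lambda>i. euclidean) UNIV) (Pi\<^sub>E UNIV K)"
    unfolding compactin_PiE using K by simp
  then have "compact (Pi\<^sub>E UNIV K)"
    using euclidean_product_topology by (metis compactin_euclidean_iff)
  \<comment> \<open>Countability of the index type makes the function type a metric space, so
    Tychonoff compactness becomes sequential compactness and no diagonal argument occurs.\<close>
  then have seq: "seq_compact (Pi\<^sub>E UNIV K)"
    by (simp only: compact_eq_seq_compact_metric)
  have "\<forall>n. F n \<in> Pi\<^sub>E UNIV K"
    using F by auto
  with seq obtain l r where l: "l \<in> Pi\<^sub>E UNIV K" "strict_mono (r :: nat \<Rightarrow> nat)" "(F \<circ> r) \<longlonglongrightarrow> l"
    by (rule seq_compactE)
  have "(\<lambda>n. F (r n) i) \<longlonglongrightarrow> l i" for i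
  proof -
    have "continuous_on UNIV (\<lambda>f :: 'i \<Rightarrow> 'a. f i)"
      by simp
    from continuous_on_tendsto_compose[OF this l(3)] show ?thesis
      by (simp add: comp_def)
  qed
  moreover have "l i \<in> K i" for i
    using l(1) by auto
  ultimately show ?thesis
    by (intro that[OF l(2)])
qed

section \<open>Time changes that interpolate two sequences of times\<close>

lemma strict_mono_surj_continuous:
  fixes h :: "real \<Rightarrow> real"
  assumes "strict_mono h" "surj h"
  shows "continuous_on UNIV h"
proof (clarsimp simp: continuous_on_iff dist_real_def)
  fix x e :: real assume "0 < e"
  obtain a b where ab: "h a = h x - e" "h b = h x + e"
    using surjD[OF \<open>surj h\<close>, of "h x - e"] surjD[OF \<open>surj h\<close>, of "h x + e"] by auto
  then have "a < x" "x < b"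
    using \<open>0 < e\<close> strict_mono_less[OF \<open>strict_mono h\<close>, of a x] strict_mono_less[OF \<open>strict_mono h\<close>, of x b] by simp_all
  have "\<bar>h y - h x\<bar> < e" if "\<bar>y - x\<bar> < min (x - a) (b - x)" for y
  proof -
    have "a < y" "y < b"
      using that by linarith+
    then have "h a < h y" "h y < h b"
      using strict_monoD[OF \<open>strict_mono h\<close>] by blast+
    with ab show ?thesis
      by linarith
  qed
  then show "\<exists>d>0. \<forall>y. \<bar>y - x\<bar> < d \<longrightarrow> \<bar>h y - h x\<bar> < e"
    using \<open>a < x\<close> \<open>x < b\<close> by (intro exI[of _ "min (x - a) (b - x)"]) auto
qed

lemma int_growth:
  fixes s :: "int \<Rightarrow> real"
  assumes "\<And>i. s (i + 1) - s i \<ge> c"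
  shows "s (i + int n) \<ge> s i + c * n"
proof (induction n)
  case (Suc n)
  then show ?case
    using assms[of "i + int n"] by (simp add: algebra_simps)
qed auto

text \<open>The uniform gap \<open>c\<close> makes the piecewise linear interpolant strictly
  increasing and unbounded in both directions. Surjectivity comes from locating the cell of a given
  value; continuity is then a consequence of \<open>strict_mono_surj_continuous\<close>.\<close>

lemma interpolation_bij:
  fixes s :: "int \<Rightarrow> real"
  assumes c: "c > 0" "\<And>i. s (i + 1) - s i \<ge> c"
  defines "A \<equiv> \<lambda>t. s \<lfloor>t\<rfloor> + frac t * (s (\<lfloor>t\<rfloor> + 1) - s \<lfloor>t\<rfloor>)"
  shows "strict_mono A" "surj A"
proof -
  have mono: "s i \<le> s j" if "i \<le> j" for i j
    using int_growth[of c s i "nat (j - i)"] c that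
      mult_nonneg_nonneg[of c "real_of_int j - real_of_int i"] by (smt (verit) of_int_le_iff of_nat_nat of_int_diff of_int_of_nat_eq)
  show "strict_mono A"
  proof (rule strict_monoI)
    fix x y :: real assume "x < y"
    have inc: "s (\<lfloor>x\<rfloor> + 1) - s \<lfloor>x\<rfloor> > 0" "s (\<lfloor>y\<rfloor> + 1) - s \<lfloor>y\<rfloor> > 0"
      using c(1) c(2)[of "\<lfloor>x\<rfloor>"] c(2)[of "\<lfloor>y\<rfloor>"] by linarith+
    show "A x < A y"
    proof (cases "\<lfloor>x\<rfloor> = \<lfloor>y\<rfloor>")
      case True
      then have "frac x < frac y"
        using \<open>x < y\<close> by (simp add: frac_def)
      with True inc show ?thesis
        by (simp add: A_def)
    next
      case False
      then have "\<lfloor>x\<rfloor> + 1 \<le> \<lfloor>y\<rfloor>"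
        using \<open>x < y\<close> floor_mono[of x y] by linarith
      then have "s (\<lfloor>x\<rfloor> + 1) \<le> s \<lfloor>y\<rfloor>"
        by (rule mono)
      moreover have "frac x * (s (\<lfloor>x\<rfloor> + 1) - s \<lfloor>x\<rfloor>) < 1 * (s (\<lfloor>x\<rfloor> + 1) - s \<lfloor>x\<rfloor>)"
        using inc by (intro mult_strict_right_mono) (auto simp: frac_lt_1)
      moreover have "frac y * (s (\<lfloor>y\<rfloor> + 1) - s \<lfloor>y\<rfloor>) \<ge> 0"
        using inc by (intro mult_nonneg_nonneg) auto
      ultimately show ?thesis
        by (simp add: A_def)
    qed
  qed
  have Aint: "A (real_of_int k) = s k" for k
    by (simp add: A_def)
  show "surj A"
    unfolding surj_def
  proof
    fix v
    define n where "n = nat \<lceil>\<bar>v - s 0\<bar> / c\<rceil>"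
    have n: "c * n \<ge> \<bar>v - s 0\<bar>"
    proof -
      have "\<bar>v - s 0\<bar> / c \<le> n"
        unfolding n_def by linarith
      then show ?thesis
        using c(1) by (simp add: divide_simps mult.commute)
    qed
    have up: "v \<le> s (int n)"
      using int_growth[of c s 0 n] c(2) n by (simp add: abs_le_iff)
    have lo: "s (- int n) \<le> v"
      using int_growth[of c s "- int n" n] c(2) n by (simp add: abs_le_iff)
    \<comment> \<open>Natural indices are shifted so that 0 stands for \<open>- int n\<close>, where
      \<open>s\<close> is at most \<open>v\<close>. The cell that ends at the least admissible index
      contains \<open>v\<close>.\<close>
    define m where "m = (LEAST m. v \<le> s (int m - int n))"
    have ex: "v \<le> s (int (2 * n) - int n)"
      using up by simp
    then have m: "v \<le> s (int m - int n)"
      unfolding m_def by (rule LeastI)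
    show "\<exists>x. v = A x"
    proof (cases "m = 0")
      case True
      then have "v = s (- int n)"
        using m lo by simp
      then show ?thesis
        by (metis Aint)
    next
      case False
      have "\<not> v \<le> s (int (m - 1) - int n)"
      proof
        assume "v \<le> s (int (m - 1) - int n)"
        then have "m \<le> m - 1"
          unfolding m_def by (rule Least_le)
        with False show False
          by linarith
      qed
      then obtain i where i: "s i < v" "v \<le> s (i + 1)"
      proof -
        have "int (m - 1) - int n + 1 = int m - int n"
          using False by simp
        then have "v \<le> s (int (m - 1) - int n + 1)"
          using m by (simp only:)
        with \<open>\<not> v \<le> s (int (m - 1) - int n)\<close> show thesis
          using that[of "int (m - 1) - int n"] by linarith
      qed
      show ?thesis
      proof (cases "v = s (i + 1)")
        case True
        then have "v = A (real_of_int (i + 1))"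
          by (simp only: Aint)
        then show ?thesis ..
      next
        case False
        define \<theta> where "\<theta> = (v - s i) / (s (i + 1) - s i)"
        have th: "0 < \<theta>" "\<theta> < 1"
          using i False by (simp_all add: \<theta>_def)
        then have "\<lfloor>i + \<theta>\<rfloor> = i"
          by linarith
        moreover from this have "frac (i + \<theta>) = \<theta>"
          by (simp add: frac_def)
        moreover have "\<theta> * (s (i + 1) - s i) = v - s i"
          using i by (simp add: \<theta>_def)
        ultimately have "v = A (i + \<theta>)"
          unfolding A_def by simp
        then show ?thesis ..
      qed
    qed
  qed
qed

text \<open>Produces the time change that expansivity asks for from two sampled orbits. The same
  fraction \<open>\<theta>\<close> occurs for both sequences, which bounds the drift inside a cell
  by the difference of the two cell lengths.\<close>

lemma Rep_interpolation:
  fixes s t :: "int \<Rightarrow> real"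
  assumes "s 0 = 0" "t 0 = 0" "c > 0"
    and s: "\<And>i. s (i + 1) - s i \<ge> c" and t: "\<And>i. t (i + 1) - t i \<ge> c"
  obtains h where "h \<in> Rep"
    "\<And>v. \<exists>i \<theta>. 0 \<le> \<theta> \<and> \<theta> \<le> 1 \<and> v = s i + \<theta> * (s (i + 1) - s i) \<and> h v = t i + \<theta> * (t (i + 1) - t i)"
proof -
  define A where "A = (\<lambda>r. s \<lfloor>r\<rfloor> + frac r * (s (\<lfloor>r\<rfloor> + 1) - s \<lfloor>r\<rfloor>))"
  define B where "B = (\<lambda>r. t \<lfloor>r\<rfloor> + frac r * (t (\<lfloor>r\<rfloor> + 1) - t \<lfloor>r\<rfloor>))"
  have A: "strict_mono A" "surj A" and B: "strict_mono B" "surj B"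
    unfolding A_def B_def
    by (rule interpolation_bij[of c s, OF \<open>c > 0\<close> s], rule interpolation_bij[of c s, OF \<open>c > 0\<close> s],
        rule interpolation_bij[of c t, OF \<open>c > 0\<close> t], rule interpolation_bij[of c t, OF \<open>c > 0\<close> t])
  have iA: "A (inv A v) = v" "inv A (A v) = v" and iB: "B (inv B v) = v" "inv B (B v) = v" for v
    by (simp_all add: A B surj_f_inv_f inv_f_f strict_mono_imp_inj_on)
  have smA: "strict_mono (inv A)"
    by (rule strict_monoI) (use strict_mono_less[OF A(1), of "inv A x" "inv A y" for x y] iA in simp)
  have smB: "strict_mono (inv B)"
    by (rule strict_monoI) (use strict_mono_less[OF B(1), of "inv B x" "inv B y" for x y] iB in simp)
  define h where "h = B \<circ> inv A"
  define g where "g = A \<circ> inv B"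
  have sm: "strict_mono h" "strict_mono g"
    unfolding h_def g_def by (intro strict_mono_o smA smB A B)+
  have gh: "g (h v) = v" "h (g v) = v" for v
    by (auto simp: g_def h_def iA iB)
  have "surj h" "surj g"
    using gh by (metis surjI)+
  then have "homeomorphism UNIV UNIV h g"
    by (intro homeomorphismI strict_mono_surj_continuous sm gh) simp_all
  moreover have "h 0 = 0"
  proof -
    have "A 0 = 0" "B 0 = 0"
      using assms(1,2) by (simp_all add: A_def B_def)
    then have "inv A 0 = 0"
      using iA(2)[of 0] by simp
    with \<open>B 0 = 0\<close> show ?thesis
      by (simp add: h_def)
  qed
  ultimately have "h \<in> Rep"
    using sm unfolding Rep_def by blast
  moreover have "\<exists>i \<theta>. 0 \<le> \<theta> \<and> \<theta> \<le> 1 \<and> v = s i + \<theta> * (s (i + 1) - s i) \<and> h v = t i + \<theta> * (t (i + 1) - t i)" for v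
  proof -
    have "v = A (inv A v)" "h v = B (inv A v)"
      by (auto simp: iA h_def)
    then show ?thesis
      using frac_lt_1[of "inv A v"] frac_ge_0[of "inv A v"]
      by (intro exI[of _ "\<lfloor>inv A v\<rfloor>"] exI[of _ "frac (inv A v)"]) (simp add: A_def B_def less_imp_le)
  qed
  ultimately show ?thesis
    by (rule that)
qed

section \<open>Local sections\<close>

locale cflow =
  fixes \<phi> :: "real \<Rightarrow> 'a::metric_space \<Rightarrow> 'a" and X :: "'a set"
  assumes cpt: "compact X" and flow: "continuous_flow \<phi> X"
begin

lemma flow_in [simp]: "x \<in> X \<Longrightarrow> \<phi> t x \<in> X"
  and flow_0 [simp]: "x \<in> X \<Longrightarrow> \<phi> 0 x = x"
  and flow_flow: "x \<in> X \<Longrightarrow> \<phi> s (\<phi> t x) = \<phi> (t + s) x"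
  using flow unfolding continuous_flow_def by auto

lemma flow_cont: "continuous_on (UNIV \<times> X) (\<lambda>(t,x). \<phi> t x)"
  using flow unfolding continuous_flow_def by auto

lemma flow_inverse [simp]: "x \<in> X \<Longrightarrow> \<phi> (- t) (\<phi> t x) = x" "x \<in> X \<Longrightarrow> \<phi> t (\<phi> (- t) x) = x"
  by (auto simp: flow_flow)

lemma continuous_on_flow [continuous_intros]:
  assumes "continuous_on S f" "continuous_on S g" "g ` S \<subseteq> X"
  shows "continuous_on S (\<lambda>z. \<phi> (f z) (g z))"
proof -
  have "continuous_on S (\<lambda>z. (f z, g z))"
    using assms by (intro continuous_intros)
  from continuous_on_compose2[OF flow_cont this] show ?thesis
    using assms by auto
qed

lemma tendsto_flow:
  assumes "(f \<longlongrightarrow> t) F" "(g \<longlongrightarrow> x) F" "x \<in> X" "\<forall>\<^sub>F n in F. g n \<in> X"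
  shows "((\<lambda>n. \<phi> (f n) (g n)) \<longlongrightarrow> \<phi> t x) F"
proof -
  have "((\<lambda>n. (f n, g n)) \<longlongrightarrow> (t, x)) F"
    using assms by (intro tendsto_intros)
  from continuous_on_tendsto_compose[OF flow_cont this] show ?thesis
    using assms(3,4) by (auto elim: eventually_mono)
qed

lemma flow_uniform:
  assumes "e > 0"
  obtains d where "d > 0" "\<And>x y u v. x \<in> X \<Longrightarrow> y \<in> X \<Longrightarrow> \<bar>u\<bar> \<le> A \<Longrightarrow> \<bar>v\<bar> \<le> A \<Longrightarrow> \<bar>u - v\<bar> \<le> d \<Longrightarrow> dist x y \<le> d
    \<Longrightarrow> dist (\<phi> u x) (\<phi> v y) \<le> e"
proof -
  have "uniformly_continuous_on ({-A..A} \<times> X) (\<lambda>(t,x). \<phi> t x)"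
    by (intro compact_uniformly_continuous continuous_on_subset[OF flow_cont])
      (auto intro: compact_Times cpt)
  then obtain d where "d > 0" and d: "\<And>z z'. z \<in> {-A..A} \<times> X \<Longrightarrow> z' \<in> {-A..A} \<times> X \<Longrightarrow> dist z' z < d
      \<Longrightarrow> dist (case z' of (t,x) \<Rightarrow> \<phi> t x) (case z of (t,x) \<Rightarrow> \<phi> t x) < e"
    unfolding uniformly_continuous_on_def using assms by blast
  show thesis
  proof (rule that[of "d / 3"])
    fix x y u v assume *: "x \<in> X" "y \<in> X" "\<bar>u\<bar> \<le> A" "\<bar>v\<bar> \<le> A" "\<bar>u - v\<bar> \<le> d / 3" "dist x y \<le> d / 3"
    have "dist (u, x) (v, y) \<le> dist u v + dist x y"
      by (simp add: dist_Pair_Pair sqrt_sum_squares_le_sum)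
    also have "\<dots> < d"
      using * \<open>d > 0\<close> by (simp add: dist_real_def)
    finally show "dist (\<phi> u x) (\<phi> v y) \<le> e"
      using d[of "(v,y)" "(u,x)"] * by (auto simp: abs_le_iff)
  qed (use \<open>d > 0\<close> in auto)
qed

text \<open>Periods tending to 0 have multiples that approximate every time, so a limit of points
  with such periods would be fixed by the whole flow.\<close>

lemma no_short_periods:
  assumes "regular_flow \<phi> X"
  obtains \<tau> where "\<tau> > 0" "\<And>x u. x \<in> X \<Longrightarrow> \<bar>u\<bar> \<le> \<tau> \<Longrightarrow> \<phi> u x = x \<Longrightarrow> u = 0"
proof (rule ccontr)
  assume "\<not> thesis"
  then have "\<exists>x u. x \<in> X \<and> \<bar>u\<bar> \<le> 1 / Suc n \<and> \<phi> u x = x \<and> u \<noteq> 0" for n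
    using that[of "1 / Suc n"] by fastforce
  then obtain x u where xu: "\<And>n. x n \<in> X" "\<And>n. \<bar>u n\<bar> \<le> 1 / Suc n" "\<And>n. \<phi> (u n) (x n) = x n" "\<And>n. u n \<noteq> 0"
    by metis
  obtain l r where l: "l \<in> X" "strict_mono (r :: nat \<Rightarrow> nat)" "(\<lambda>n. x (r n)) \<longlonglongrightarrow> l"
    using cpt xu(1) unfolding compact_eq_seq_compact_metric seq_compact_def comp_def by metis
  have nat_mult: "\<phi> (real k * u n) (x n) = x n" for k n
  proof (induction k)
    case (Suc k)
    have "\<phi> (real (Suc k) * u n) (x n) = \<phi> (u n) (\<phi> (real k * u n) (x n))"
      using xu(1) by (simp add: flow_flow algebra_simps)
    then show ?case
      using Suc xu by simp
  qed (use xu in auto)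
  have int_mult: "\<phi> (of_int k * u n) (x n) = x n" for k n
  proof (cases "k \<ge> 0")
    case True
    then show ?thesis
      using nat_mult[of "nat k" n] by simp
  next
    case False
    then have "\<phi> (- (of_int k * u n)) (x n) = x n"
      using nat_mult[of "nat (- k)" n] by simp
    then show ?thesis
      using xu(1)[of n] by (metis flow_inverse(2))
  qed
  have "\<phi> t l = l" for t
  proof -
    \<comment> \<open>A multiple of the period \<open>u n\<close>, so it still fixes
      \<open>x n\<close>; its distance from \<open>t\<close> is at most
      \<open>\<bar>u n\<bar>\<close>.\<close>
    define a where "a = (\<lambda>n. of_int \<lfloor>t / u n\<rfloor> * u n)"
    have "\<bar>a n - t\<bar> \<le> 1 / Suc n" for n
    proof -
      have "\<bar>a n - t\<bar> = \<bar>(of_int \<lfloor>t / u n\<rfloor> - t / u n) * u n\<bar>"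
        using xu(4)[of n] by (simp add: a_def left_diff_distrib)
      also have "\<dots> = \<bar>of_int \<lfloor>t / u n\<rfloor> - t / u n\<bar> * \<bar>u n\<bar>"
        by (simp add: abs_mult)
      also have "\<dots> \<le> 1 * \<bar>u n\<bar>"
        by (intro mult_right_mono) linarith+
      finally show ?thesis
        using xu(2)[of n] by simp
    qed
    then have "(\<lambda>n. a n - t) \<longlonglongrightarrow> 0"
      by (intro Lim_null_comparison[OF _ LIMSEQ_inverse_real_of_nat]) (auto simp: inverse_eq_divide)
    then have "a \<longlonglongrightarrow> t"
      by (simp add: LIM_zero_iff)
    then have "(\<lambda>n. a (r n)) \<longlonglongrightarrow> t"
      using LIMSEQ_subseq_LIMSEQ[OF _ l(2)] by (auto simp: comp_def)
    then have "(\<lambda>n. \<phi> (a (r n)) (x (r n))) \<longlonglongrightarrow> \<phi> t l"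
      using l xu(1) by (intro tendsto_flow) (auto simp: comp_def)
    moreover have "(\<lambda>n. \<phi> (a (r n)) (x (r n))) = (\<lambda>n. x (r n))"
      by (auto simp: a_def int_mult)
    ultimately show ?thesis
      using l(3) LIMSEQ_unique by metis
  qed
  then show False
    using assms l(1) unfolding regular_flow_def by blast
qed

end

locale regflow = cflow +
  fixes \<tau> :: real
  assumes \<tau>_pos: "\<tau> > 0"
    and no_period: "\<And>x u. x \<in> X \<Longrightarrow> \<bar>u\<bar> \<le> \<tau> \<Longrightarrow> \<phi> u x = x \<Longrightarrow> u = 0"
begin

text \<open>For times between \<open>\<kappa>\<close> and \<open>\<tau>\<close> in absolute value no
  point returns to itself, so on this compact set the displacement has a positive minimum.\<close>

lemma short_return_times:
  assumes "\<kappa> > 0"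
  obtains \<gamma> where "\<gamma> > 0" "\<And>x u. x \<in> X \<Longrightarrow> \<bar>u\<bar> \<le> \<tau> \<Longrightarrow> dist (\<phi> u x) x \<le> \<gamma> \<Longrightarrow> \<bar>u\<bar> < \<kappa>"
proof -
  define K where "K = ({-\<tau>..-\<kappa>} \<union> {\<kappa>..\<tau>}) \<times> X"
  have K: "compact K"
    unfolding K_def by (intro compact_Times compact_Un cpt) auto
  have cont: "continuous_on K (\<lambda>z. dist (\<phi> (fst z) (snd z)) (snd z))"
    by (intro continuous_intros) (auto simp: K_def)
  show thesis
  proof (cases "K = {}")
    case True
    then have "\<bar>u\<bar> < \<kappa>" if "x \<in> X" "\<bar>u\<bar> \<le> \<tau>" for x u
      using that unfolding K_def by (auto simp: abs_if split: if_splits)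
    then show ?thesis
      using that[of 1] by simp
  next
    case False
    from continuous_attains_inf[OF K this cont] obtain z where
      z: "z \<in> K" "\<And>z'. z' \<in> K \<Longrightarrow> dist (\<phi> (fst z) (snd z)) (snd z) \<le> dist (\<phi> (fst z') (snd z')) (snd z')"
      by blast
    define g where "g = dist (\<phi> (fst z) (snd z)) (snd z)"
    have "g > 0"
      using z(1) no_period[of "snd z" "fst z"] \<open>\<kappa> > 0\<close> unfolding g_def K_def by force
    show ?thesis
    proof (rule that[of "g / 2"])
      fix x u assume *: "x \<in> X" "\<bar>u\<bar> \<le> \<tau>" "dist (\<phi> u x) x \<le> g / 2"
      show "\<bar>u\<bar> < \<kappa>"
      proof (rule ccontr)
        assume "\<not> \<bar>u\<bar> < \<kappa>"
        then have "(u, x) \<in> K"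
          using * unfolding K_def by auto
        from z(2)[OF this] * \<open>g > 0\<close> show False
          unfolding g_def by simp
      qed
    qed (use \<open>g > 0\<close> in auto)
  qed
qed

text \<open>Bebutov's trick: the time average of the distance from \<open>w\<close> increases along orbits near \<open>w\<close>,
  so its level sets are local cross sections.\<close>

lemma local_sections:
  assumes "\<kappa> > 0"
  obtains \<Sigma> r where "\<Sigma> \<subseteq> X \<times> X" "closed \<Sigma>" "\<And>w. w \<in> X \<Longrightarrow> (w, w) \<in> \<Sigma>"
    "\<And>w y u. (w, y) \<in> \<Sigma> \<Longrightarrow> (w, \<phi> u y) \<in> \<Sigma> \<Longrightarrow> \<bar>u\<bar> \<le> \<tau> \<Longrightarrow> u = 0"
    "r > 0" "\<And>w y. w \<in> X \<Longrightarrow> y \<in> X \<Longrightarrow> dist w y \<le> r \<Longrightarrow> \<exists>s. \<bar>s\<bar> \<le> \<kappa> \<and> (w, \<phi> s y) \<in> \<Sigma>"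
proof -
  \<comment> \<open>Integrating over a full time \<open>\<tau>\<close> makes the distance from
    \<open>w\<close> differentiable along orbits: the derivative is the increment of that distance
    over time \<open>\<tau>\<close>.\<close>
  define G where "G = (\<lambda>w y. integral {0..\<tau>} (\<lambda>s. dist w (\<phi> s y)))"
  have "continuous_on (X \<times> X) (\<lambda>z. integral (cbox 0 \<tau>) (\<lambda>s. dist (fst z) (\<phi> s (snd z))))"
    by (rule integral_continuous_on_param) (auto simp: case_prod_beta intro!: continuous_intros)
  then have contG: "continuous_on (X \<times> X) (\<lambda>z. G (fst z) (snd z))"
    by (simp add: G_def)
  obtain c0 where c0: "c0 > 0" "\<And>x u. x \<in> X \<Longrightarrow> \<bar>u\<bar> \<le> \<tau> \<Longrightarrow> dist (\<phi> u x) x \<le> c0 \<Longrightarrow> \<bar>u\<bar> < \<tau>"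
    using short_return_times[OF \<tau>_pos] by metis
  \<comment> \<open>A point near \<open>w\<close> is within \<open>c\<close> of \<open>w\<close>,
    and after time \<open>\<tau>\<close> it is within \<open>c\<close> of
    \<open>\<phi> \<tau> w\<close>, which is at least \<open>3 * c\<close> away from
    \<open>w\<close>. The gain in distance that remains is \<open>c\<close>.\<close>
  define c where "c = c0 / 3"
  have c: "c > 0" "\<And>w. w \<in> X \<Longrightarrow> dist w (\<phi> \<tau> w) \<ge> 3 * c"
    using c0(1) c0(2)[of _ \<tau>] \<tau>_pos by (force simp: c_def dist_commute not_le[symmetric])+
  obtain d1 where d1: "d1 > 0" "\<And>x y u v. x \<in> X \<Longrightarrow> y \<in> X \<Longrightarrow> \<bar>u\<bar> \<le> \<tau> \<Longrightarrow> \<bar>v\<bar> \<le> \<tau> \<Longrightarrow> \<bar>u - v\<bar> \<le> d1 \<Longrightarrow> dist x y \<le> d1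
    \<Longrightarrow> dist (\<phi> u x) (\<phi> v y) \<le> c"
    using flow_uniform[OF c(1)] by metis
  define r0 where "r0 = min c d1"
  have "r0 > 0"
    using c d1 by (simp add: r0_def)
  have inc: "dist w (\<phi> \<tau> z) - dist w z \<ge> c" if "w \<in> X" "z \<in> X" "dist w z \<le> r0" for w z
  proof -
    have "dist (\<phi> \<tau> w) (\<phi> \<tau> z) \<le> c"
      using that d1(1) \<tau>_pos by (intro d1(2)) (auto simp: r0_def)
    moreover have "dist w z \<le> c"
      using that by (simp add: r0_def)
    ultimately show ?thesis
      using c(2)[OF that(1)] dist_triangle[of w "\<phi> \<tau> w" "\<phi> \<tau> z"] by (simp add: dist_commute)
  qed
  obtain d2 where d2: "d2 > 0" "\<And>x y u v. x \<in> X \<Longrightarrow> y \<in> X \<Longrightarrow> \<bar>u\<bar> \<le> \<tau> \<Longrightarrow> \<bar>v\<bar> \<le> \<tau> \<Longrightarrow> \<bar>u - v\<bar> \<le> d2 \<Longrightarrow> dist x y \<le> d2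
    \<Longrightarrow> dist (\<phi> u x) (\<phi> v y) \<le> r0"
    using flow_uniform[OF \<open>r0 > 0\<close>] by metis
  define k0 where "k0 = min (min \<kappa> \<tau>) d2"
  have k0: "k0 > 0" "k0 \<le> \<kappa>" "k0 \<le> \<tau>" "k0 \<le> d2"
    using \<tau>_pos \<open>\<kappa> > 0\<close> d2(1) by (auto simp: k0_def)
  have mvt: "G w (\<phi> v y) - G w (\<phi> u y) \<ge> c * (v - u)"
    if w: "w \<in> X" and y: "y \<in> X" and wy: "dist w y \<le> d2" and uv: "-k0 \<le> u" "u < v" "v \<le> k0" for w y u v
  proof -
    define k where "k = (\<lambda>s. dist w (\<phi> s y))"
    have contk: "continuous_on S k" for S
      unfolding k_def using w y by (intro continuous_intros) auto
    \<comment> \<open>The lower limit lies to the left of all times that occur, so \<open>G\<close>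
      along the orbit is a difference of two values of one primitive.\<close>
    define H where "H = (\<lambda>t. integral {-2*\<tau>..t} k)"
    have H: "(H has_real_derivative k t) (at t)" if "-2*\<tau> < t" for t
    proof -
      have "(H has_real_derivative k t) (at t within {-2*\<tau>..t+1})"
        unfolding H_def by (rule integral_has_real_derivative[OF contk]) (use that in auto)
      moreover have "t \<in> interior {-2*\<tau>..t+1}"
        using that by simp
      ultimately show ?thesis
        by (metis at_within_interior)
    qed
    have GH: "G w (\<phi> t y) = H (t + \<tau>) - H t" if "-\<tau> \<le> t" for t
    proof -
      have "G w (\<phi> t y) = integral {0..\<tau>} (\<lambda>s. k (s + t))"
        unfolding G_def k_def using y by (simp add: flow_flow add.commute)
      also have "\<dots> = integral {t..t+\<tau>} k"
        using integral_shift_Icc_real[of 0 \<tau> k t] by (simp add: add.commute comp_def)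
      also have "\<dots> = H (t + \<tau>) - H t"
        unfolding H_def using that \<tau>_pos
        by (subst Henstock_Kurzweil_Integration.integral_combine[symmetric, of "-2*\<tau>" t "t+\<tau>"])
          (auto intro!: integrable_continuous_interval contk)
      finally show ?thesis .
    qed
    have der: "((\<lambda>t. H (t + \<tau>) - H t) has_real_derivative (k (t + \<tau>) - k t)) (at t)" if "u \<le> t" "t \<le> v" for t
    proof -
      have t: "-2*\<tau> < t" "-2*\<tau> < t + \<tau>"
        using that uv k0 \<tau>_pos by linarith+
      have "((\<lambda>t. H (t + \<tau>)) has_real_derivative k (t + \<tau>)) (at t)"
        using H[OF t(2)] by (simp add: DERIV_shift)
      with H[OF t(1)] show ?thesis
        by (intro DERIV_diff)
    qed
    obtain z where z: "u < z" "z < v"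
      "(H (v + \<tau>) - H v) - (H (u + \<tau>) - H u) = (v - u) * (k (z + \<tau>) - k z)"
      using MVT2[of u v "\<lambda>t. H (t + \<tau>) - H t", OF uv(2) der] by blast
    have "k (z + \<tau>) - k z \<ge> c"
    proof -
      have "dist (\<phi> 0 w) (\<phi> z y) \<le> r0"
        by (rule d2(2)) (use w y wy z uv k0 \<tau>_pos in auto)
      then have "dist w (\<phi> \<tau> (\<phi> z y)) - dist w (\<phi> z y) \<ge> c"
        using w y by (intro inc) auto
      then show ?thesis
        using y by (simp add: k_def flow_flow)
    qed
    then have "(v - u) * (k (z + \<tau>) - k z) \<ge> (v - u) * c"
      using uv by (intro mult_left_mono) auto
    moreover have "G w (\<phi> v y) - G w (\<phi> u y) = (H (v + \<tau>) - H v) - (H (u + \<tau>) - H u)"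
      using GH[of u] GH[of v] uv k0 by simp
    ultimately show ?thesis
      using z(3) by (simp add: mult.commute)
  qed
  obtain g1 where g1: "g1 > 0" "\<And>x u. x \<in> X \<Longrightarrow> \<bar>u\<bar> \<le> \<tau> \<Longrightarrow> dist (\<phi> u x) x \<le> g1 \<Longrightarrow> \<bar>u\<bar> < k0"
    using short_return_times[OF k0(1)] by metis
  \<comment> \<open>Two points of a section are then within \<open>g1\<close> of each other. If they
    lie on one orbit at most \<open>\<tau>\<close> apart, their time difference is below
    \<open>k0\<close>, where \<open>G\<close> is strictly monotone.\<close>
  define r2 where "r2 = min d2 (g1 / 2)"
  have "r2 > 0"
    using d2(1) g1(1) by (simp add: r2_def)
  define \<Sigma> where "\<Sigma> = {z \<in> X \<times> X. G (fst z) (snd z) - G (fst z) (fst z) = 0} \<inter> {z \<in> X \<times> X. dist (fst z) (snd z) \<le> r2}"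
  have XX: "closed (X \<times> X)"
    using cpt by (simp add: compact_Times compact_imp_closed)
  have contG': "continuous_on (X \<times> X) (\<lambda>z. G (fst z) (fst z))"
  proof -
    have "continuous_on (X \<times> X) (\<lambda>z. (fst z, fst z))"
      by (intro continuous_intros)
    from continuous_on_compose2[OF contG this] show ?thesis
      by (simp add: image_subset_iff)
  qed
  have "closed \<Sigma>"
    unfolding \<Sigma>_def
    by (intro closed_Int continuous_closed_preimage_constant continuous_on_closed_Collect_le XX continuous_intros contG contG')
  obtain d3 where d3: "d3 > 0" "\<And>x y u v. x \<in> X \<Longrightarrow> y \<in> X \<Longrightarrow> \<bar>u\<bar> \<le> \<tau> \<Longrightarrow> \<bar>v\<bar> \<le> \<tau> \<Longrightarrow> \<bar>u - v\<bar> \<le> d3 \<Longrightarrow> dist x y \<le> d3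
    \<Longrightarrow> dist (\<phi> u x) (\<phi> v y) \<le> r2"
    using flow_uniform[OF \<open>r2 > 0\<close>] by metis
  define k1 where "k1 = min k0 d3"
  have k1: "k1 > 0" "k1 \<le> k0" "k1 \<le> d3"
    using d3 k0 by (auto simp: k1_def)
  \<comment> \<open>Orbits this close over time \<open>\<tau>\<close> change \<open>G\<close> by at
    most \<open>c * k1\<close>, the amount that moving by time \<open>k1\<close> forwards or
    backwards compensates. The intermediate value theorem then gives the crossing.\<close>
  have "c * k1 / \<tau> > 0"
    using c k1 \<tau>_pos by simp
  then obtain d4 where d4: "d4 > 0" "\<And>x y u v. x \<in> X \<Longrightarrow> y \<in> X \<Longrightarrow> \<bar>u\<bar> \<le> \<tau> \<Longrightarrow> \<bar>v\<bar> \<le> \<tau> \<Longrightarrow> \<bar>u - v\<bar> \<le> d4 \<Longrightarrow> dist x y \<le> d4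
    \<Longrightarrow> dist (\<phi> u x) (\<phi> v y) \<le> c * k1 / \<tau>"
    using flow_uniform by metis
  define r where "r = min (min d4 d3) d2"
  have contk: "continuous_on S (\<lambda>s. dist w (\<phi> s y))" if "y \<in> X" for S w y
    using that by (intro continuous_intros) auto
  have "\<exists>s. \<bar>s\<bar> \<le> \<kappa> \<and> (w, \<phi> s y) \<in> \<Sigma>" if wy: "w \<in> X" "y \<in> X" "dist w y \<le> r" for w y
  proof -
    have "\<bar>G w y - G w w\<bar> \<le> c * k1"
    proof -
      have "G w y - G w w = integral {0..\<tau>} (\<lambda>s. dist w (\<phi> s y) - dist w (\<phi> s w))"
        unfolding G_def using wy
        by (intro Henstock_Kurzweil_Integration.integral_diff[symmetric] integrable_continuous_interval contk)
      also have "norm \<dots> \<le> c * k1 / \<tau> * (\<tau> - 0)"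
      proof (rule integral_bound)
        show "continuous_on {0..\<tau>} (\<lambda>s. dist w (\<phi> s y) - dist w (\<phi> s w))"
          using wy by (intro continuous_intros) auto
        fix s assume "s \<in> {0..\<tau>}"
        then have "dist (\<phi> s y) (\<phi> s w) \<le> c * k1 / \<tau>"
          using wy d4(1) by (intro d4(2)) (auto simp: r_def dist_commute)
        then show "norm (dist w (\<phi> s y) - dist w (\<phi> s w)) \<le> c * k1 / \<tau>"
          by simp metric
      qed (use \<tau>_pos in auto)
      finally show ?thesis
        using \<tau>_pos by simp
    qed
    moreover have "G w (\<phi> k1 y) - G w (\<phi> 0 y) \<ge> c * (k1 - 0)" "G w (\<phi> 0 y) - G w (\<phi> (-k1) y) \<ge> c * (0 - (-k1))"
      using wy k1 mvt[of w y 0 k1] mvt[of w y "-k1" 0] by (simp_all add: r_def del: flow_0)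
    ultimately have "G w (\<phi> (-k1) y) \<le> G w w" "G w w \<le> G w (\<phi> k1 y)"
      using wy by auto
    moreover have "continuous_on {-k1..k1} (\<lambda>t. G w (\<phi> t y))"
    proof -
      have "continuous_on {-k1..k1} (\<lambda>t. (w, \<phi> t y))"
        using wy by (intro continuous_intros) auto
      from continuous_on_compose2[OF contG this] wy show ?thesis
        by (simp add: image_subset_iff)
    qed
    ultimately obtain s where s: "-k1 \<le> s" "s \<le> k1" "G w (\<phi> s y) = G w w"
      using IVT'[of "\<lambda>t. G w (\<phi> t y)" "-k1" "G w w" k1] k1 by auto
    have "dist (\<phi> 0 w) (\<phi> s y) \<le> r2"
      using wy s k1 k0 by (intro d3(2)) (auto simp: r_def)
    then have "(w, \<phi> s y) \<in> \<Sigma>"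
      unfolding \<Sigma>_def using wy s by auto
    moreover have "\<bar>s\<bar> \<le> \<kappa>"
      using s k1 k0 by linarith
    ultimately show ?thesis
      by blast
  qed
  moreover have "u = 0" if "(w, y) \<in> \<Sigma>" "(w, \<phi> u y) \<in> \<Sigma>" "\<bar>u\<bar> \<le> \<tau>" for w y u
  proof -
    have wy: "w \<in> X" "y \<in> X" "dist w y \<le> r2" "dist w (\<phi> u y) \<le> r2" "G w (\<phi> u y) = G w y"
      using that by (auto simp: \<Sigma>_def)
    have "dist (\<phi> u y) y \<le> dist w (\<phi> u y) + dist w y"
      by (rule dist_triangle3)
    then have "dist (\<phi> u y) y \<le> g1"
      using wy by (simp add: r2_def)
    then have u: "\<bar>u\<bar> < k0"
      using g1(2) wy that by blast
    have wd: "dist w y \<le> d2"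
      using wy by (simp add: r2_def)
    show ?thesis
    proof (rule ccontr)
      assume "u \<noteq> 0"
      then consider "u < 0" | "0 < u"
        by linarith
      then show False
      proof cases
        case 1
        have "0 < c * (0 - u)"
          using c(1) 1 by (intro mult_pos_pos) auto
        with mvt[OF wy(1,2) wd, of u 0] u 1 wy show False by simp
      next
        case 2
        have "0 < c * (u - 0)"
          using c(1) 2 by (intro mult_pos_pos) auto
        with mvt[OF wy(1,2) wd, of 0 u] u 2 wy show False by simp
      qed
    qed
  qed
  ultimately show thesis
    using that[of \<Sigma> r] \<open>closed \<Sigma>\<close> \<open>r2 > 0\<close> d2(1) d3(1) d4(1) unfolding \<Sigma>_def r_def by auto
qed

end

section \<open>Covering dimension\<close>

text \<open>Covering dimension at most \<open>n\<close>, phrased by mesh instead of refinement: on a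
  compact set a cover of mesh below a Lebesgue number refines the given cover.\<close>

definition small_covers :: "nat \<Rightarrow> 'a::metric_space set \<Rightarrow> bool" where
  "small_covers n A \<longleftrightarrow> (\<forall>l>0. \<exists>\<W>. finite \<W> \<and> (\<forall>W\<in>\<W>. openin (top_of_set A) W) \<and> A \<subseteq> \<Union>\<W> \<and>
     (\<forall>W\<in>\<W>. \<forall>x\<in>W. \<forall>y\<in>W. dist x y < l) \<and> (\<forall>x\<in>A. card {W\<in>\<W>. x \<in> W} \<le> n + 1))"

text \<open>The finite sum theorem for compact pieces. The cover is shrunk for one piece after
  another, and shrinking never raises the order at a point treated earlier. The members stay indexed
  by the original \<open>\<U>\<close>, so the count can be compared from one stage to the
  next.\<close>

lemma covering_dim_le_UN:
  fixes A :: "'i \<Rightarrow> 'a::metric_space set"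
  assumes "finite I" and A: "\<And>i. i \<in> I \<Longrightarrow> compact (A i)" "\<And>i. i \<in> I \<Longrightarrow> small_covers n (A i)"
  shows "covering_dim_le (\<Union>i\<in>I. A i) n"
proof -
  define X where "X = (\<Union>i\<in>I. A i)"
  have shrink: "\<exists>V. (\<forall>U\<in>\<U>. openin (top_of_set X) (V U) \<and> V U \<subseteq> U) \<and> X \<subseteq> (\<Union>U\<in>\<U>. V U) \<and>
      (\<forall>x\<in>(\<Union>i\<in>J. A i). card {U\<in>\<U>. x \<in> V U} \<le> n + 1)"
    if \<U>: "finite \<U>" "\<forall>U\<in>\<U>. openin (top_of_set X) U" "X \<subseteq> \<Union>\<U>" and J: "finite J" "J \<subseteq> I" for \<U> J
    using J
  proof (induction J rule: finite_induct)
    case empty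
    show ?case
      using \<U> by (intro exI[of _ "\<lambda>U. U"]) auto
  next
    case (insert j J)
    then have "\<exists>V. (\<forall>U\<in>\<U>. openin (top_of_set X) (V U) \<and> V U \<subseteq> U) \<and> X \<subseteq> (\<Union>U\<in>\<U>. V U) \<and>
      (\<forall>x\<in>(\<Union>i\<in>J. A i). card {U\<in>\<U>. x \<in> V U} \<le> n + 1)"
      by simp
    then obtain V where V: "\<And>U. U \<in> \<U> \<Longrightarrow> openin (top_of_set X) (V U)" "\<And>U. U \<in> \<U> \<Longrightarrow> V U \<subseteq> U"
      "X \<subseteq> (\<Union>U\<in>\<U>. V U)" "\<And>x. x \<in> (\<Union>i\<in>J. A i) \<Longrightarrow> card {U\<in>\<U>. x \<in> V U} \<le> n + 1"
      by metis
    have jI: "j \<in> I" "A j \<subseteq> X"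
      using insert.prems by (auto simp: X_def)
    obtain O' where O': "\<And>U. U \<in> \<U> \<Longrightarrow> open (O' U)" "\<And>U. U \<in> \<U> \<Longrightarrow> V U = X \<inter> O' U"
      using V(1) unfolding openin_open by metis
    have "A j \<subseteq> \<Union>(O' ` \<U>)"
    proof
      fix x assume "x \<in> A j"
      then obtain U where "U \<in> \<U>" "x \<in> V U"
        using jI(2) V(3) by blast
      then show "x \<in> \<Union>(O' ` \<U>)"
        using O'(2) by blast
    qed
    then obtain e where e: "e > 0" "\<And>x. x \<in> A j \<Longrightarrow> \<exists>G\<in>O' ` \<U>. ball x e \<subseteq> G"
      using Heine_Borel_lemma[OF A(1)[OF jI(1)], of "O' ` \<U>"] O'(1) by blast
    obtain \<W> where \<W>0: "finite \<W> \<and> (\<forall>W\<in>\<W>. openin (top_of_set (A j)) W) \<and> A j \<subseteq> \<Union>\<W> \<and>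
       (\<forall>W\<in>\<W>. \<forall>x\<in>W. \<forall>y\<in>W. dist x y < e) \<and> (\<forall>x\<in>A j. card {W\<in>\<W>. x \<in> W} \<le> n + 1)"
      using A(2)[OF jI(1), unfolded small_covers_def, rule_format, OF e(1)] by - (erule exE, rule that)
    have \<W>: "finite \<W>" "\<And>W. W \<in> \<W> \<Longrightarrow> openin (top_of_set (A j)) W" "A j \<subseteq> \<Union>\<W>"
      "\<And>W x y. W \<in> \<W> \<Longrightarrow> x \<in> W \<Longrightarrow> y \<in> W \<Longrightarrow> dist x y < e" "\<And>x. x \<in> A j \<Longrightarrow> card {W\<in>\<W>. x \<in> W} \<le> n + 1"
      using \<W>0 by simp_all
    have "\<exists>U\<in>\<U>. W \<subseteq> V U" if W: "W \<in> \<W>" "W \<noteq> {}" for W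
    proof -
      obtain x where x: "x \<in> W"
        using W by blast
      have WA: "W \<subseteq> A j"
        using \<W>(2)[OF W(1)] openin_imp_subset by blast
      then obtain U where U: "U \<in> \<U>" "ball x e \<subseteq> O' U"
        using e(2) x by blast
      have "W \<subseteq> ball x e"
        using \<W>(4)[OF W(1) x] by auto
      then have "W \<subseteq> V U"
        using U O'(2) WA jI(2) by auto
      with U show ?thesis
        by blast
    qed
    then obtain c where c: "\<And>W. W \<in> \<W> \<Longrightarrow> W \<noteq> {} \<Longrightarrow> c W \<in> \<U> \<and> W \<subseteq> V (c W)"
      by metis
    define W' where "W' = (\<lambda>U. \<Union>{W\<in>\<W>. W \<noteq> {} \<and> c W = U})"
    \<comment> \<open>Each small set of the cover of \<open>A j\<close> is handed to one member of
      \<open>\<U>\<close>. Only the points of \<open>A j\<close> not handed to \<open>U\<close> are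
      removed; they form a closed set, and off \<open>A j\<close> nothing changes.\<close>
    define V' where "V' = (\<lambda>U. V U - (A j - W' U))"
    have W'V: "W' U \<subseteq> V U" for U
      using c by (auto simp: W'_def)
    have "openin (top_of_set X) (V' U)" if "U \<in> \<U>" for U
    proof -
      have "openin (top_of_set (A j)) (W' U)"
        unfolding W'_def using \<W>(2) by (intro openin_Union) blast
      then have "closedin (top_of_set (A j)) (A j - W' U)"
        by (auto intro!: closedin_diff)
      moreover have "closed (A j)"
        using A(1)[OF jI(1)] compact_imp_closed by blast
      ultimately have "closed (A j - W' U)"
        by (rule closedin_closed_trans)
      then have "closedin (top_of_set X) (A j - W' U)"
        using jI(2) by (intro closed_subset) auto
      then show ?thesis
        unfolding V'_def using V(1)[OF that] by (rule openin_diff[rotated])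
    qed
    moreover have "V' U \<subseteq> U" if "U \<in> \<U>" for U
      using V(2)[OF that] by (auto simp: V'_def)
    moreover have "X \<subseteq> (\<Union>U\<in>\<U>. V' U)"
    proof
      fix x assume x: "x \<in> X"
      show "x \<in> (\<Union>U\<in>\<U>. V' U)"
      proof (cases "x \<in> A j")
        case True
        then obtain W where W: "W \<in> \<W>" "x \<in> W"
          using \<W>(3) by blast
        then have "x \<in> W' (c W)" "c W \<in> \<U>"
          using c unfolding W'_def by blast+
        then show ?thesis
          using W'V unfolding V'_def by blast
      next
        case False
        then show ?thesis
          using x V(3) unfolding V'_def by blast
      qed
    qed
    moreover have "card {U\<in>\<U>. x \<in> V' U} \<le> n + 1" if "x \<in> (\<Union>i\<in>insert j J. A i)" for x
    proof (cases "x \<in> A j")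
      case True
      then have "{U\<in>\<U>. x \<in> V' U} \<subseteq> c ` {W\<in>\<W>. x \<in> W}"
        by (auto simp: V'_def W'_def)
      then have "card {U\<in>\<U>. x \<in> V' U} \<le> card (c ` {W\<in>\<W>. x \<in> W})"
        using \<W>(1) by (intro card_mono) auto
      also have "\<dots> \<le> card {W\<in>\<W>. x \<in> W}"
        using \<W>(1) by (intro card_image_le) auto
      finally show ?thesis
        using \<W>(5)[OF True] by linarith
    next
      case False
      then have "x \<in> (\<Union>i\<in>J. A i)"
        using that by auto
      then have "card {U\<in>\<U>. x \<in> V U} \<le> n + 1"
        by (rule V(4))
      moreover have "card {U\<in>\<U>. x \<in> V' U} \<le> card {U\<in>\<U>. x \<in> V U}"
        using \<U>(1) by (intro card_mono) (auto simp: V'_def)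
      ultimately show ?thesis
        by linarith
    qed
    ultimately show ?case
      by (intro exI[of _ V'] conjI ballI)
  qed
  show ?thesis
    unfolding covering_dim_le_def X_def[symmetric]
  proof (intro allI impI, elim conjE)
    fix \<U> :: "'a set set"
    assume \<U>: "finite \<U>" "\<forall>U\<in>\<U>. openin (top_of_set X) U" "X \<subseteq> \<Union>\<U>"
    obtain V where V: "\<And>U. U \<in> \<U> \<Longrightarrow> openin (top_of_set X) (V U)" "\<And>U. U \<in> \<U> \<Longrightarrow> V U \<subseteq> U"
      "X \<subseteq> (\<Union>U\<in>\<U>. V U)" "\<And>x. x \<in> X \<Longrightarrow> card {U\<in>\<U>. x \<in> V U} \<le> n + 1"
      using shrink[OF \<U> \<open>finite I\<close> subset_refl] unfolding X_def[symmetric] by metis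
    have "card {W \<in> V ` \<U>. x \<in> W} \<le> n + 1" if "x \<in> X" for x
    proof -
      have "{W \<in> V ` \<U>. x \<in> W} = V ` {U\<in>\<U>. x \<in> V U}"
        by auto
      then have "card {W \<in> V ` \<U>. x \<in> W} \<le> card {U\<in>\<U>. x \<in> V U}"
        using \<U>(1) card_image_le[of "{U\<in>\<U>. x \<in> V U}" V] by simp
      with V(4)[OF that] show ?thesis
        by linarith
    qed
    with V \<U>(1) show "\<exists>\<V>. finite \<V> \<and> (\<forall>V\<in>\<V>. openin (top_of_set X) V) \<and> X \<subseteq> \<Union>\<V> \<and>
             (\<forall>V\<in>\<V>. \<exists>U\<in>\<U>. V \<subseteq> U) \<and> (\<forall>x\<in>X. card {V\<in>\<V>. x \<in> V} \<le> n + 1)"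
      by (intro exI[of _ "V ` \<U>"]) auto
  qed
qed

section \<open>Compact sets without nondegenerate connected subsets, and boxes over them\<close>

lemma disjoint_clopen_refinement:
  assumes "finite \<U>" "\<forall>U\<in>\<U>. openin T U \<and> closedin T U"
  shows "\<exists>\<Q>. finite \<Q> \<and> (\<forall>Q\<in>\<Q>. openin T Q \<and> closedin T Q \<and> (\<exists>U\<in>\<U>. Q \<subseteq> U)) \<and> \<Union>\<Q> = \<Union>\<U> \<and> pairwise disjnt \<Q>"
  using assms
proof (induction \<U> rule: finite_induct)
  case empty
  then show ?case
    by (intro exI[of _ "{}"]) auto
next
  case (insert U \<U>)
  then obtain \<Q> where \<Q>: "finite \<Q>" "\<forall>Q\<in>\<Q>. openin T Q \<and> closedin T Q \<and> (\<exists>U\<in>\<U>. Q \<subseteq> U)" "\<Union>\<Q> = \<Union>\<U>" "pairwise disjnt \<Q>"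
    by (metis insertCI)
  have "pairwise disjnt (insert U ((\<lambda>Q. Q - U) ` \<Q>))"
    using \<Q>(4) unfolding pairwise_insert pairwise_image by (auto simp: disjnt_def pairwise_def)
  moreover have "openin T (Q - U) \<and> closedin T (Q - U) \<and> (\<exists>B\<in>\<U>. Q - U \<subseteq> B)" if "Q \<in> \<Q>" for Q
    using \<Q>(2) that insert.prems by (metis openin_diff closedin_diff Diff_subset insertI1 subset_trans)
  ultimately show ?case
    using \<Q> insert.prems by (intro exI[of _ "insert U ((\<lambda>Q. Q - U) ` \<Q>)"]) auto
qed

text \<open>In a compact Hausdorff space a component can be separated from any closed set disjoint
  from it. Here the components are points, so small clopen neighbourhoods exist.\<close>

lemma clopen_partition:
  fixes S :: "'a::metric_space set"
  assumes "compact S" and td: "\<And>C. C \<subseteq> S \<Longrightarrow> connected C \<Longrightarrow> \<exists>a. C \<subseteq> {a}" and "l > 0"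
  obtains \<Q> where "finite \<Q>" "\<And>Q. Q \<in> \<Q> \<Longrightarrow> openin (top_of_set S) Q" "\<Union>\<Q> = S" "pairwise disjnt \<Q>"
    "\<And>Q x y. Q \<in> \<Q> \<Longrightarrow> x \<in> Q \<Longrightarrow> y \<in> Q \<Longrightarrow> dist x y < l"
proof -
  have "\<exists>U. openin (top_of_set S) U \<and> closedin (top_of_set S) U \<and> x \<in> U \<and> U \<subseteq> ball x (l / 2)" if x: "x \<in> S" for x
  proof -
    have comp: "{x} \<in> connected_components_of (top_of_set S)"
    proof -
      have "connected_component_of_set (top_of_set S) x = {x}"
      proof -
        have "connectedin (top_of_set S) (connected_component_of_set (top_of_set S) x)"
          by (rule connectedin_connected_component_of)
        then have "connected (connected_component_of_set (top_of_set S) x)" "connected_component_of_set (top_of_set S) x \<subseteq> S"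
          by (auto simp: connectedin_subtopology)
        from td[OF this(2,1)] obtain a where "connected_component_of_set (top_of_set S) x \<subseteq> {a}" ..
        moreover have "x \<in> connected_component_of_set (top_of_set S) x"
          using x by (simp add: connected_component_of_refl)
        ultimately show ?thesis
          by auto
      qed
      then show ?thesis
        using x unfolding connected_components_of_def by force
    qed
    have "separated_between (top_of_set S) {x} (S - ball x (l / 2))"
    proof (rule separated_between_compact_connected_component)
      show "closedin (top_of_set S) (S - ball x (l / 2))"
        unfolding Diff_eq by (intro closedin_closed_Int closed_Compl open_ball)
      show "locally_compact_space (top_of_set S)"
        using \<open>compact S\<close> by (intro compact_imp_locally_compact_space) (simp add: compact_space_subtopology)
      show "Hausdorff_space (top_of_set S)"
        by (simp add: Hausdorff_space_subtopology)
      show "compactin (top_of_set S) {x}"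
        using x by simp
      show "disjnt {x} (S - ball x (l / 2))"
        using \<open>l > 0\<close> by (simp add: disjnt_def)
    qed (rule comp)
    then obtain U V where "openin (top_of_set S) U" "openin (top_of_set S) V" "U \<union> V = S" "disjnt U V" "x \<in> U" "S - ball x (l / 2) \<subseteq> V"
      unfolding separated_between_def by auto
    moreover from this have "S - U = V"
      by (auto simp: disjnt_def)
    moreover from calculation have "closedin (top_of_set S) U"
      by (auto simp: closedin_def)
    moreover have "U \<subseteq> ball x (l / 2)"
      using calculation by (auto simp: disjnt_def)
    ultimately show ?thesis
      by blast
  qed
  then obtain U where U: "\<And>x. x \<in> S \<Longrightarrow> openin (top_of_set S) (U x)" "\<And>x. x \<in> S \<Longrightarrow> closedin (top_of_set S) (U x)"
    "\<And>x. x \<in> S \<Longrightarrow> x \<in> U x" "\<And>x. x \<in> S \<Longrightarrow> U x \<subseteq> ball x (l / 2)"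
    by metis
  have "S \<subseteq> \<Union>(U ` S)" "\<forall>B\<in>U ` S. openin (top_of_set S) B"
    using U by auto
  then obtain \<D> where D: "\<D> \<subseteq> U ` S" "finite \<D>" "S \<subseteq> \<Union>\<D>"
    using \<open>compact S\<close> unfolding compact_eq_openin_cover by meson
  then have "\<forall>B\<in>\<D>. openin (top_of_set S) B \<and> closedin (top_of_set S) B"
    using U by blast
  from disjoint_clopen_refinement[OF D(2) this] obtain \<Q> where \<Q>0: "finite \<Q> \<and>
      (\<forall>Q\<in>\<Q>. openin (top_of_set S) Q \<and> closedin (top_of_set S) Q \<and> (\<exists>B\<in>\<D>. Q \<subseteq> B)) \<and> \<Union>\<Q> = \<Union>\<D> \<and> pairwise disjnt \<Q>"
    by - (erule exE, rule that)
  have \<Q>: "finite \<Q>" "\<Union>\<Q> = \<Union>\<D>" "pairwise disjnt \<Q>"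
    "\<And>Q. Q \<in> \<Q> \<Longrightarrow> openin (top_of_set S) Q" "\<And>Q. Q \<in> \<Q> \<Longrightarrow> \<exists>B\<in>\<D>. Q \<subseteq> B"
    using \<Q>0 by simp_all
  show thesis
  proof (rule that[of \<Q>])
    show "\<Union>\<Q> = S"
    proof -
      have "\<Union>\<D> \<subseteq> S"
        using D(1) U(1)[THEN openin_imp_subset] by blast
      then show ?thesis
        unfolding \<Q>(2) using D(3) by (rule subset_antisym)
    qed
    fix Q x y assume Q: "Q \<in> \<Q>" "x \<in> Q" "y \<in> Q"
    then obtain z where "z \<in> S" "Q \<subseteq> U z"
      using \<Q>(5) D(1) by blast
    then have "dist z x < l / 2" "dist z y < l / 2"
      using U(4) Q by (auto simp: subset_iff)
    then show "dist x y < l"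
      by metric
  qed (use \<Q> in auto)
qed

text \<open>Small clopen pieces of \<open>S\<close> can be taken disjoint, and overlapping intervals
  so that each time lies in at most two of them. Their products have order 2, and by compactness
  \<open>\<psi>\<close> carries them homeomorphically to the image.\<close>

lemma small_covers_box:
  fixes S :: "'a::metric_space set" and \<psi> :: "'a \<times> real \<Rightarrow> 'a"
  assumes "compact S" and td: "\<And>C. C \<subseteq> S \<Longrightarrow> connected C \<Longrightarrow> \<exists>a. C \<subseteq> {a}"
    and cont: "continuous_on (S \<times> {-k..k}) \<psi>" and inj: "inj_on \<psi> (S \<times> {-k..k})"
  shows "small_covers 1 (\<psi> ` (S \<times> {-k..k}))"
  unfolding small_covers_def
proof (intro allI impI)
  fix l :: real assume "l > 0"
  let ?B = "S \<times> {-k..k}"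
  have cB: "compact ?B"
    using \<open>compact S\<close> by (intro compact_Times) auto
  obtain g where hom: "homeomorphism ?B (\<psi> ` ?B) \<psi> g"
    using homeomorphism_compact[OF cB cont _ inj] by blast
  obtain \<mu> where \<mu>: "\<mu> > 0" "\<And>z z'. z \<in> ?B \<Longrightarrow> z' \<in> ?B \<Longrightarrow> dist z' z < \<mu> \<Longrightarrow> dist (\<psi> z') (\<psi> z) < l"
    using compact_uniformly_continuous[OF cont cB] \<open>l > 0\<close> unfolding uniformly_continuous_on_def by blast
  obtain \<Q> where \<Q>: "finite \<Q>" "\<And>Q. Q \<in> \<Q> \<Longrightarrow> openin (top_of_set S) Q" "\<Union>\<Q> = S" "pairwise disjnt \<Q>"
    "\<And>Q x y. Q \<in> \<Q> \<Longrightarrow> x \<in> Q \<Longrightarrow> y \<in> Q \<Longrightarrow> dist x y < \<mu> / 2"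
    using clopen_partition[OF \<open>compact S\<close> td half_gt_zero[OF \<mu>(1)]] by metis
  \<comment> \<open>Intervals of length \<open>2 * \<beta> = \<mu> / 2\<close> and pieces of
    \<open>S\<close> of diameter below \<open>\<mu> / 2\<close> give products whose points are less
    than \<open>\<mu>\<close> apart.\<close>
  define \<beta> where "\<beta> = \<mu> / 4"
  have \<beta>: "\<beta> > 0"
    using \<mu> by (simp add: \<beta>_def)
  define I where "I = (\<lambda>j::int. {-k..k} \<inter> {j * \<beta> <..< (j + 2) * \<beta>})"
  \<comment> \<open>The margin 2 absorbs the rounding when an interval around a time in
    \<open>{-k..k}\<close> is selected.\<close>
  define N where "N = \<lceil>k / \<beta>\<rceil> + 2"
  define \<W> where "\<W> = (\<lambda>(Q, j). \<psi> ` (Q \<times> I j)) ` (\<Q> \<times> {-N..N})"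
  have j_iff: "j * \<beta> < t \<and> t < (j + 2) * \<beta> \<longleftrightarrow> j < t / \<beta> \<and> t / \<beta> < j + 2" for j :: int and t
    using \<beta> by (simp add: field_simps)
  have QI: "Q \<times> I j \<subseteq> ?B" if "Q \<in> \<Q>" for Q j
    using \<Q>(3) that by (auto simp: I_def)
  have "finite \<W>"
    unfolding \<W>_def using \<Q>(1) by auto
  moreover have "openin (top_of_set (\<psi> ` ?B)) W" if W: "W \<in> \<W>" for W
  proof -
    obtain Q j where Qj: "Q \<in> \<Q>" "W = \<psi> ` (Q \<times> I j)"
      using W by (auto simp: \<W>_def)
    have "openin (top_of_set {-k..k}) (I j)"
      unfolding I_def by (intro openin_open_Int) auto
    then have "openin (top_of_set ?B) (Q \<times> I j)"
      using \<Q>(2)[OF Qj(1)] by (rule openin_Times[rotated])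
    from homeomorphism_imp_open_map[OF hom this] Qj(2) show ?thesis
      by simp
  qed
  moreover have "\<psi> ` ?B \<subseteq> \<Union>\<W>"
  proof
    fix a assume "a \<in> \<psi> ` ?B"
    then obtain q t where qt: "q \<in> S" "t \<in> {-k..k}" "a = \<psi> (q, t)"
      by auto
    obtain Q where Q: "Q \<in> \<Q>" "q \<in> Q"
      using \<Q>(3) qt(1) by blast
    define j where "j = \<lceil>t / \<beta>\<rceil> - 1"
    have "j < t / \<beta>" "t / \<beta> < j + 2"
      unfolding j_def by linarith+
    then have "t \<in> I j"
      using qt(2) j_iff by (auto simp: I_def)
    moreover have "j \<in> {-N..N}"
    proof -
      have "t / \<beta> \<le> k / \<beta>" "- (k / \<beta>) \<le> t / \<beta>"
        using qt(2) \<beta> by (auto simp: divide_simps)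
      then have "j \<le> N" "-N \<le> j"
        unfolding j_def N_def by linarith+
      then show ?thesis
        by simp
    qed
    ultimately show "a \<in> \<Union>\<W>"
      unfolding \<W>_def using Q qt(3) by (intro UnionI[OF imageI[of "(Q, j)"]]) auto
  qed
  moreover have "dist a b < l" if W: "W \<in> \<W>" "a \<in> W" "b \<in> W" for W a b
  proof -
    obtain Q j where Q: "Q \<in> \<Q>" "W = \<psi> ` (Q \<times> I j)"
      using W(1) by (auto simp: \<W>_def)
    then obtain q t q' t' where *: "Q \<in> \<Q>" "q \<in> Q" "q' \<in> Q" "t \<in> I j" "t' \<in> I j" "a = \<psi> (q, t)" "b = \<psi> (q', t')"
      using W(2,3) by blast
    have "dist (q, t) (q', t') \<le> dist q q' + dist t t'"
      by (simp add: dist_Pair_Pair sqrt_sum_squares_le_sum)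
    moreover have "dist q q' < \<mu> / 2"
      using \<Q>(5) * by blast
    moreover have "dist t t' \<le> \<mu> / 2"
    proof -
      have "j * \<beta> < t" "t < (j + 2) * \<beta>" "j * \<beta> < t'" "t' < (j + 2) * \<beta>"
        using *(4,5) by (auto simp: I_def)
      moreover have "(j + 2) * \<beta> = j * \<beta> + \<mu> / 2"
        by (simp add: \<beta>_def algebra_simps)
      ultimately show ?thesis
        unfolding dist_real_def by linarith
    qed
    ultimately have "dist (q, t) (q', t') < \<mu>"
      by linarith
    then show ?thesis
    proof -
      have "(q, t) \<in> ?B" "(q', t') \<in> ?B"
        using QI[OF *(1), of j] *(2-5) by blast+
      then show ?thesis
        using \<mu>(2)[of "(q', t')" "(q, t)"] *(6,7) \<open>dist (q, t) (q', t') < \<mu>\<close> by simp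
    qed
  qed
  moreover have "card {W \<in> \<W>. a \<in> W} \<le> 1 + 1" if a: "a \<in> \<psi> ` ?B" for a
  proof -
    obtain q t where qt: "q \<in> S" "t \<in> {-k..k}" "a = \<psi> (q, t)"
      using a by auto
    obtain Q where Q: "Q \<in> \<Q>" "q \<in> Q"
      using \<Q>(3) qt(1) by blast
    \<comment> \<open>\<open>t \<in> I j\<close> forces j < t / \<beta> < j + 2, which leaves only
      these two integers; the piece \<open>Q\<close> is determined by disjointness.\<close>
    have "{W \<in> \<W>. a \<in> W} \<subseteq> (\<lambda>j. \<psi> ` (Q \<times> I j)) ` {\<lfloor>t / \<beta>\<rfloor> - 1, \<lfloor>t / \<beta>\<rfloor>}"
    proof
      fix W assume "W \<in> {W \<in> \<W>. a \<in> W}"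
      then obtain Q' j q' t' where *: "Q' \<in> \<Q>" "W = \<psi> ` (Q' \<times> I j)" "q' \<in> Q'" "t' \<in> I j" "a = \<psi> (q', t')"
        by (auto simp: \<W>_def)
      have "(q', t') \<in> ?B" "(q, t) \<in> ?B"
        using * QI[of Q' j] qt by auto
      then have "q' = q" "t' = t"
        using inj_onD[OF inj, of "(q', t')" "(q, t)"] *(5) qt(3) by auto
      then have "Q' = Q"
        using \<Q>(4) Q *(1,3) unfolding pairwise_def disjnt_def by blast
      have "j < t / \<beta>" "t / \<beta> < j + 2"
        using *(4) j_iff[of j t] unfolding \<open>t' = t\<close> I_def by auto
      then have "j = \<lfloor>t / \<beta>\<rfloor> - 1 \<or> j = \<lfloor>t / \<beta>\<rfloor>"
        by linarith
      then show "W \<in> (\<lambda>j. \<psi> ` (Q \<times> I j)) ` {\<lfloor>t / \<beta>\<rfloor> - 1, \<lfloor>t / \<beta>\<rfloor>}"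
        using *(2) \<open>Q' = Q\<close> by blast
    qed
    then have "card {W \<in> \<W>. a \<in> W} \<le> card ((\<lambda>j. \<psi> ` (Q \<times> I j)) ` {\<lfloor>t / \<beta>\<rfloor> - 1, \<lfloor>t / \<beta>\<rfloor>})"
      by (intro card_mono) auto
    also have "\<dots> \<le> card {\<lfloor>t / \<beta>\<rfloor> - 1, \<lfloor>t / \<beta>\<rfloor>}"
      by (intro card_image_le) auto
    finally show ?thesis
      by simp
  qed
  ultimately show "\<exists>\<W>. finite \<W> \<and> (\<forall>W\<in>\<W>. openin (top_of_set (\<psi> ` ?B)) W) \<and> \<psi> ` ?B \<subseteq> \<Union>\<W> \<and>
     (\<forall>W\<in>\<W>. \<forall>x\<in>W. \<forall>y\<in>W. dist x y < l) \<and> (\<forall>x\<in>\<psi> ` ?B. card {W\<in>\<W>. x \<in> W} \<le> 1 + 1)"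
    by (intro exI[of _ \<W>] conjI ballI)
qed

section \<open>Uniform expansivity\<close>

lemma int_partial_sums:
  fixes u :: "int \<Rightarrow> real"
  obtains s where "s 0 = 0" "\<And>i. s (i + 1) = s i + u i"
proof -
  define s where "s = (\<lambda>i. if i \<ge> 0 then \<Sum>j\<in>{0..<i}. u j else - (\<Sum>j\<in>{i..<0}. u j))"
  have "s (i + 1) = s i + u i" for i
  proof (cases "i \<ge> 0")
    case True
    then have "{0..<i+1} = insert i {0..<i}"
      by auto
    with True show ?thesis
      by (simp add: s_def)
  next
    case False
    then have *: "{i..<0} = insert i {i+1..<0}"
      by auto
    show ?thesis
    proof (cases "i = -1")
      case True
      then show ?thesis
        using * by (simp add: s_def)
    next
      case False
      with \<open>\<not> i \<ge> 0\<close> * show ?thesis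
        by (simp add: s_def)
    qed
  qed
  moreover have "s 0 = 0"
    by (simp add: s_def)
  ultimately show thesis
    using that by metis
qed

text \<open>The slack around time 1 models the time change in expansivity, and it leaves room to end
  each step exactly on a prescribed section.\<close>

definition kstep :: "(real \<Rightarrow> 'a \<Rightarrow> 'a) \<Rightarrow> real \<Rightarrow> 'a \<Rightarrow> 'a \<Rightarrow> bool" where
  "kstep \<phi> \<kappa> x y \<longleftrightarrow> (\<exists>u. \<bar>u - 1\<bar> \<le> \<kappa> \<and> y = \<phi> u x)"

text \<open>All constants are fixed here once. \<open>\<tau>\<close> is below every period, and
  \<open>20 * \<kappa> \<le> \<tau>\<close> keeps sums of several step errors below
  \<open>\<tau>\<close>. \<open>r\<close> is the reach of the sections, and
  \<open>step_close\<close> brings \<epsilon>-close points within that reach one time unit later or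
  earlier. \<open>expansive\<close> is expansivity for sampled orbits; its time shift is at most
  \<open>\<tau> / 2\<close>, so \<open>sec_unique\<close> can annihilate it.\<close>

locale exp_flow = regflow \<phi> X \<tau> for \<phi> :: "real \<Rightarrow> 'a::metric_space \<Rightarrow> 'a" and X \<tau> +
  fixes \<kappa> \<epsilon> r :: real and \<Sigma> :: "('a \<times> 'a) set"
  assumes kappa: "0 < \<kappa>" "\<kappa> \<le> 1 / 4" "20 * \<kappa> \<le> \<tau>"
    and eps: "0 < \<epsilon>"
    and short: "\<And>x u. x \<in> X \<Longrightarrow> \<bar>u\<bar> \<le> \<tau> \<Longrightarrow> dist (\<phi> u x) x \<le> 3 * \<epsilon> \<Longrightarrow> \<bar>u\<bar> < \<kappa>"
    and sec_subset: "\<Sigma> \<subseteq> X \<times> X"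
    and sec_closed: "closed \<Sigma>"
    and sec_refl: "\<And>w. w \<in> X \<Longrightarrow> (w, w) \<in> \<Sigma>"
    and sec_unique: "\<And>w y u. (w, y) \<in> \<Sigma> \<Longrightarrow> (w, \<phi> u y) \<in> \<Sigma> \<Longrightarrow> \<bar>u\<bar> \<le> \<tau> \<Longrightarrow> u = 0"
    and r_pos: "r > 0"
    and sec_hit: "\<And>w y. w \<in> X \<Longrightarrow> y \<in> X \<Longrightarrow> dist w y \<le> r \<Longrightarrow> \<exists>s. \<bar>s\<bar> \<le> \<kappa> \<and> (w, \<phi> s y) \<in> \<Sigma>"
    and step_close: "\<And>x y. x \<in> X \<Longrightarrow> y \<in> X \<Longrightarrow> dist x y \<le> \<epsilon> \<Longrightarrow> dist (\<phi> 1 x) (\<phi> 1 y) \<le> r \<and> dist (\<phi> (-1) x) (\<phi> (-1) y) \<le> r"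
    and expansive: "\<And>\<eta> \<zeta> :: int \<Rightarrow> 'a. (\<And>i. \<eta> i \<in> X \<and> \<zeta> i \<in> X \<and> kstep \<phi> \<kappa> (\<eta> i) (\<eta> (i + 1)) \<and>
        kstep \<phi> \<kappa> (\<zeta> i) (\<zeta> (i + 1)) \<and> dist (\<eta> i) (\<zeta> i) \<le> \<epsilon>) \<Longrightarrow> \<exists>u. \<bar>u\<bar> \<le> \<tau> / 2 \<and> \<zeta> 0 = \<phi> u (\<eta> 0)"

context cflow
begin

lemma kstep_times:
  fixes \<eta> :: "int \<Rightarrow> 'a"
  assumes "\<And>i. \<eta> i \<in> X" "\<And>i. kstep \<phi> \<kappa> (\<eta> i) (\<eta> (i + 1))"
  obtains s where "s 0 = 0" "\<And>i. \<bar>s (i + 1) - s i - 1\<bar> \<le> \<kappa>" "\<And>i. \<eta> i = \<phi> (s i) (\<eta> 0)"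
proof -
  obtain u where u: "\<And>i. \<bar>u i - 1\<bar> \<le> \<kappa>" "\<And>i. \<eta> (i + 1) = \<phi> (u i) (\<eta> i)"
    using assms(2) unfolding kstep_def by metis
  obtain s where s: "s 0 = 0" "\<And>i. s (i + 1) = s i + u i"
    using int_partial_sums[of u] by metis
  have "\<eta> i = \<phi> (s i) (\<eta> 0)" for i
  proof (induction i rule: int_induct[where k=0])
    case base
    then show ?case
      using s assms(1) by simp
  next
    case (step1 i)
    then show ?case
      using u(2)[of i] s(2)[of i] assms(1)[of 0] by (simp add: flow_flow)
  next
    case (step2 i)
    have "\<eta> i = \<phi> (u (i - 1)) (\<eta> (i - 1))"
      using u(2)[of "i - 1"] by simp
    then have "\<eta> (i - 1) = \<phi> (- u (i - 1)) (\<eta> i)"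
      using assms(1) by simp
    then show ?case
      using step2 s(2)[of "i - 1"] assms(1)[of 0] by (simp add: flow_flow)
  qed
  moreover have "\<bar>s (i + 1) - s i - 1\<bar> \<le> \<kappa>" for i
    using s(2)[of i] u(1)[of i] by simp
  ultimately show thesis
    using that s(1) by metis
qed

text \<open>The constants depend on one another in the order \<open>\<tau>\<close>,
  \<open>\<delta>\<close>, \<open>d\<close>, \<open>\<kappa>\<close>, \<open>\<gamma>\<close>, then
  \<open>\<Sigma>\<close> and \<open>r\<close>, then \<open>d'\<close>, \<open>\<epsilon>\<close>.
  The expansivity assumption is applied with \<open>\<tau> / 2\<close> in place of its first
  constant.\<close>

lemma exp_flow_exists:
  assumes "regular_flow \<phi> X" "expansive_flow \<phi> X"
  obtains \<tau> \<kappa> \<epsilon> r \<Sigma> where "exp_flow \<phi> X \<tau> \<kappa> \<epsilon> r \<Sigma>"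
proof -
  obtain \<tau> where \<tau>: "\<tau> > 0" "\<And>x u. x \<in> X \<Longrightarrow> \<bar>u\<bar> \<le> \<tau> \<Longrightarrow> \<phi> u x = x \<Longrightarrow> u = 0"
    using no_short_periods[OF assms(1)] by metis
  interpret regflow \<phi> X \<tau>
    by unfold_locales (use \<tau> in auto)
  obtain \<delta> where \<delta>: "\<delta> > 0" "\<And>x y h. x \<in> X \<Longrightarrow> y \<in> X \<Longrightarrow> h \<in> Rep \<Longrightarrow> (\<And>t. dist (\<phi> t x) (\<phi> (h t) y) \<le> \<delta>)
      \<Longrightarrow> y \<in> (\<lambda>s. \<phi> s x) ` {-(\<tau>/2)..\<tau>/2}"
    using assms(2) half_gt_zero[OF \<tau>(1)] unfolding expansive_flow_def by metis
  obtain d where d: "d > 0" "\<And>x y u v. x \<in> X \<Longrightarrow> y \<in> X \<Longrightarrow> \<bar>u\<bar> \<le> 2 \<Longrightarrow> \<bar>v\<bar> \<le> 2 \<Longrightarrow> \<bar>u - v\<bar> \<le> d \<Longrightarrow> dist x y \<le> d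
    \<Longrightarrow> dist (\<phi> u x) (\<phi> v y) \<le> \<delta>"
    using flow_uniform[OF \<delta>(1)] by metis
  \<comment> \<open>Two steps differ in duration by at most \<open>2 * \<kappa> \<le> d\<close>, so
    the same fraction of a step from \<epsilon>-close nodes leads to points within
    \<open>\<delta>\<close>.\<close>
  define \<kappa> where "\<kappa> = min (1 / 4) (min (\<tau> / 20) (d / 2))"
  have kappa: "0 < \<kappa>" "\<kappa> \<le> 1 / 4" "20 * \<kappa> \<le> \<tau>" "2 * \<kappa> \<le> d"
    using \<tau>(1) d(1) by (auto simp: \<kappa>_def min_def)
  obtain \<gamma> where \<gamma>: "\<gamma> > 0" "\<And>x u. x \<in> X \<Longrightarrow> \<bar>u\<bar> \<le> \<tau> \<Longrightarrow> dist (\<phi> u x) x \<le> \<gamma> \<Longrightarrow> \<bar>u\<bar> < \<kappa>"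
    using short_return_times[OF kappa(1)] by metis
  obtain \<Sigma> r where \<Sigma>: "\<Sigma> \<subseteq> X \<times> X" "closed \<Sigma>" "\<And>w. w \<in> X \<Longrightarrow> (w, w) \<in> \<Sigma>"
    "\<And>w y u. (w, y) \<in> \<Sigma> \<Longrightarrow> (w, \<phi> u y) \<in> \<Sigma> \<Longrightarrow> \<bar>u\<bar> \<le> \<tau> \<Longrightarrow> u = 0"
    "r > 0" "\<And>w y. w \<in> X \<Longrightarrow> y \<in> X \<Longrightarrow> dist w y \<le> r \<Longrightarrow> \<exists>s. \<bar>s\<bar> \<le> \<kappa> \<and> (w, \<phi> s y) \<in> \<Sigma>"
    by (rule local_sections[OF kappa(1)]) auto
  obtain d' where d': "d' > 0" "\<And>x y u v. x \<in> X \<Longrightarrow> y \<in> X \<Longrightarrow> \<bar>u\<bar> \<le> 2 \<Longrightarrow> \<bar>v\<bar> \<le> 2 \<Longrightarrow> \<bar>u - v\<bar> \<le> d' \<Longrightarrow> dist x y \<le> d'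
    \<Longrightarrow> dist (\<phi> u x) (\<phi> v y) \<le> r"
    using flow_uniform[OF \<Sigma>(5)] by metis
  define \<epsilon> where "\<epsilon> = min d (min d' (\<gamma> / 3))"
  have eps: "\<epsilon> > 0" "\<epsilon> \<le> d" "\<epsilon> \<le> d'" "3 * \<epsilon> \<le> \<gamma>"
    using d d' \<gamma> by (auto simp: \<epsilon>_def)
  have expa: "\<exists>u. \<bar>u\<bar> \<le> \<tau> / 2 \<and> \<zeta> 0 = \<phi> u (\<eta> 0)"
    if *: "\<And>i. \<eta> i \<in> X \<and> \<zeta> i \<in> X \<and> kstep \<phi> \<kappa> (\<eta> i) (\<eta> (i + 1)) \<and> kstep \<phi> \<kappa> (\<zeta> i) (\<zeta> (i + 1)) \<and> dist (\<eta> i) (\<zeta> i) \<le> \<epsilon>"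
    for \<eta> \<zeta> :: "int \<Rightarrow> 'a"
  proof -
    obtain s where s: "s 0 = 0" "\<And>i. \<bar>s (i + 1) - s i - 1\<bar> \<le> \<kappa>" "\<And>i. \<eta> i = \<phi> (s i) (\<eta> 0)"
      using kstep_times[of \<eta> \<kappa>] * by metis
    obtain t where t: "t 0 = 0" "\<And>i. \<bar>t (i + 1) - t i - 1\<bar> \<le> \<kappa>" "\<And>i. \<zeta> i = \<phi> (t i) (\<zeta> 0)"
      using kstep_times[of \<zeta> \<kappa>] * by metis
    have inc: "s (i + 1) - s i \<ge> 1 / 2" "t (i + 1) - t i \<ge> 1 / 2" for i
      using s(2)[of i] t(2)[of i] kappa(2) by linarith+
    obtain h where h: "h \<in> Rep" "\<And>v. \<exists>i \<theta>. 0 \<le> \<theta> \<and> \<theta> \<le> 1 \<and> v = s i + \<theta> * (s (i + 1) - s i) \<and> h v = t i + \<theta> * (t (i + 1) - t i)"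
      using Rep_interpolation[of s t "1 / 2"] s(1) t(1) inc by (metis half_gt_zero_iff zero_less_one)
    have "dist (\<phi> v (\<eta> 0)) (\<phi> (h v) (\<zeta> 0)) \<le> \<delta>" for v
    proof -
      obtain i \<theta> where i: "0 \<le> \<theta>" "\<theta> \<le> 1" "v = s i + \<theta> * (s (i + 1) - s i)" "h v = t i + \<theta> * (t (i + 1) - t i)"
        using h(2) by blast
      have "\<phi> v (\<eta> 0) = \<phi> (\<theta> * (s (i + 1) - s i)) (\<eta> i)" "\<phi> (h v) (\<zeta> 0) = \<phi> (\<theta> * (t (i + 1) - t i)) (\<zeta> i)"
        using * i(3,4) s(3)[of i] t(3)[of i] by (simp_all add: flow_flow)
      moreover have "dist (\<phi> (\<theta> * (s (i + 1) - s i)) (\<eta> i)) (\<phi> (\<theta> * (t (i + 1) - t i)) (\<zeta> i)) \<le> \<delta>"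
      proof (rule d(2))
        have le: "\<bar>\<theta> * a\<bar> \<le> \<bar>a\<bar>" for a
          using i(1,2) by (simp add: abs_mult mult_left_le_one_le)
        show "\<bar>\<theta> * (s (i + 1) - s i)\<bar> \<le> 2" "\<bar>\<theta> * (t (i + 1) - t i)\<bar> \<le> 2"
          using le[of "s (i + 1) - s i"] le[of "t (i + 1) - t i"] s(2)[of i] t(2)[of i] kappa(2) by linarith+
        have "\<theta> * (s (i + 1) - s i) - \<theta> * (t (i + 1) - t i) = \<theta> * ((s (i + 1) - s i) - (t (i + 1) - t i))"
          by (simp add: algebra_simps)
        then show "\<bar>\<theta> * (s (i + 1) - s i) - \<theta> * (t (i + 1) - t i)\<bar> \<le> d"
          using le[of "(s (i + 1) - s i) - (t (i + 1) - t i)"] s(2)[of i] t(2)[of i] kappa(4) by linarith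
        show "dist (\<eta> i) (\<zeta> i) \<le> d"
          using *[of i] eps(2) by linarith
      qed (use * in auto)
      ultimately show ?thesis
        by simp
    qed
    then have "\<zeta> 0 \<in> (\<lambda>s. \<phi> s (\<eta> 0)) ` {-(\<tau>/2)..\<tau>/2}"
      using * h(1) by (intro \<delta>(2)) auto
    then obtain u where "u \<in> {-(\<tau>/2)..\<tau>/2}" "\<zeta> 0 = \<phi> u (\<eta> 0)"
      by blast
    then show ?thesis
      by (intro exI[of _ u]) (auto simp: abs_le_iff)
  qed
  have close: "dist (\<phi> 1 x) (\<phi> 1 y) \<le> r \<and> dist (\<phi> (-1) x) (\<phi> (-1) y) \<le> r"
    if "x \<in> X" "y \<in> X" "dist x y \<le> \<epsilon>" for x y
    using that d'(1) eps(3) by (auto intro!: d'(2))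
  have "exp_flow \<phi> X \<tau> \<kappa> \<epsilon> r \<Sigma>"
  proof
    show "\<bar>u\<bar> < \<kappa>" if "x \<in> X" "\<bar>u\<bar> \<le> \<tau>" "dist (\<phi> u x) x \<le> 3 * \<epsilon>" for x u
      using that eps(4) by (intro \<gamma>(2)) auto
    show "\<exists>u. \<bar>u\<bar> \<le> \<tau> / 2 \<and> \<zeta> 0 = \<phi> u (\<eta> 0)"
      if *: "\<And>i. \<eta> i \<in> X \<and> \<zeta> i \<in> X \<and> kstep \<phi> \<kappa> (\<eta> i) (\<eta> (i + 1)) \<and> kstep \<phi> \<kappa> (\<zeta> i) (\<zeta> (i + 1)) \<and> dist (\<eta> i) (\<zeta> i) \<le> \<epsilon>"
      for \<eta> \<zeta> :: "int \<Rightarrow> 'a"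
      using expa * by blast
  qed (use kappa eps \<Sigma> close in \<open>simp_all\<close>)
  then show thesis
    by (rule that)
qed

end

lemma (in cflow) cflow_reverse: "cflow (\<lambda>t. \<phi> (- t)) X"
proof
  show "continuous_flow (\<lambda>t. \<phi> (- t)) X"
    unfolding continuous_flow_def
    by (auto simp: flow_flow case_prod_beta intro!: continuous_intros)
qed (rule cpt)

lemma (in cflow) kstep_reverse:
  assumes "x \<in> X" "y \<in> X"
  shows "kstep (\<lambda>t. \<phi> (- t)) \<kappa> x y \<longleftrightarrow> kstep \<phi> \<kappa> y x"
  unfolding kstep_def using assms flow_inverse by metis

lemma (in exp_flow) exp_flow_reverse: "exp_flow (\<lambda>t. \<phi> (- t)) X \<tau> \<kappa> \<epsilon> r \<Sigma>"
proof -
  interpret R: cflow "\<lambda>t. \<phi> (- t)" X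
    by (rule cflow_reverse)
  show ?thesis
  proof
    show "\<bar>u\<bar> \<le> \<tau> \<Longrightarrow> \<phi> (- u) x = x \<Longrightarrow> u = 0" if "x \<in> X" for x u
      using no_period[of x "- u"] that by simp
    show "\<bar>u\<bar> < \<kappa>" if "x \<in> X" "\<bar>u\<bar> \<le> \<tau>" "dist (\<phi> (- u) x) x \<le> 3 * \<epsilon>" for x u
      using short[of x "- u"] that by simp
    show "u = 0" if "(w, y) \<in> \<Sigma>" "(w, \<phi> (- u) y) \<in> \<Sigma>" "\<bar>u\<bar> \<le> \<tau>" for w y u
      using sec_unique[of w y "- u"] that by simp
    show "\<exists>s. \<bar>s\<bar> \<le> \<kappa> \<and> (w, \<phi> (- s) y) \<in> \<Sigma>" if "w \<in> X" "y \<in> X" "dist w y \<le> r" for w y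
      using sec_hit[OF that] by (metis abs_minus_cancel minus_minus)
    show "dist (\<phi> (- 1) x) (\<phi> (- 1) y) \<le> r \<and> dist (\<phi> (- (- 1)) x) (\<phi> (- (- 1)) y) \<le> r"
      if "x \<in> X" "y \<in> X" "dist x y \<le> \<epsilon>" for x y
      using step_close[OF that] by simp
    fix \<eta> \<zeta> :: "int \<Rightarrow> 'a"
    assume *: "\<And>i. \<eta> i \<in> X \<and> \<zeta> i \<in> X \<and> kstep (\<lambda>t. \<phi> (- t)) \<kappa> (\<eta> i) (\<eta> (i + 1)) \<and>
        kstep (\<lambda>t. \<phi> (- t)) \<kappa> (\<zeta> i) (\<zeta> (i + 1)) \<and> dist (\<eta> i) (\<zeta> i) \<le> \<epsilon>"
    have "\<exists>u. \<bar>u\<bar> \<le> \<tau> / 2 \<and> \<zeta> (- 0) = \<phi> u (\<eta> (- 0))"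
    proof (rule expansive[of "\<lambda>i. \<eta> (- i)" "\<lambda>i. \<zeta> (- i)"])
      fix i :: int
      show "\<eta> (- i) \<in> X \<and> \<zeta> (- i) \<in> X \<and> kstep \<phi> \<kappa> (\<eta> (- i)) (\<eta> (- (i + 1))) \<and>
          kstep \<phi> \<kappa> (\<zeta> (- i)) (\<zeta> (- (i + 1))) \<and> dist (\<eta> (- i)) (\<zeta> (- i)) \<le> \<epsilon>"
        using *[of "- i - 1"] *[of "- i"] by (auto simp: kstep_reverse)
    qed
    then show "\<exists>u. \<bar>u\<bar> \<le> \<tau> / 2 \<and> \<zeta> 0 = \<phi> (- u) (\<eta> 0)"
      by (metis abs_minus_cancel minus_minus minus_zero)
  qed (use \<tau>_pos kappa eps sec_subset sec_closed sec_refl r_pos in auto)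
qed

section \<open>Compactness: tracking on a finite window suffices\<close>

context exp_flow
begin

abbreviation "step \<equiv> kstep \<phi> \<kappa>"

lemma sec_in: "(w, y) \<in> \<Sigma> \<Longrightarrow> w \<in> X \<and> y \<in> X"
  using sec_subset by blast

text \<open>The pairs joined by a step are the continuous image of a compact set, hence closed.
  Steps are assumed only eventually because the approximating paths are orbits on growing windows
  only.\<close>

lemma step_limit:
  assumes "\<And>n. a n \<in> X" "a \<longlonglongrightarrow> x" "b \<longlonglongrightarrow> y" "\<forall>\<^sub>F n in sequentially. step (a n) (b n)"
  shows "step x y"
proof -
  define K where "K = (\<lambda>(u, x). (x, \<phi> u x)) ` ({1-\<kappa>..1+\<kappa>} \<times> X)"
  have "compact K"
    unfolding K_def case_prod_beta
    by (intro compact_continuous_image continuous_intros compact_Times cpt) auto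
  then have "closed K"
    by (rule compact_imp_closed)
  have K_iff: "(a, b) \<in> K \<longleftrightarrow> a \<in> X \<and> step a b" for a b
    unfolding K_def kstep_def by (force simp: abs_le_iff)
  have "\<forall>\<^sub>F n in sequentially. (a n, b n) \<in> K"
    using assms(4) by eventually_elim (simp add: K_iff assms(1))
  then have "(x, y) \<in> K"
    using assms(2,3) by (intro Lim_in_closed_set[OF \<open>closed K\<close>, of "\<lambda>n. (a n, b n)" sequentially]) (auto intro: tendsto_Pair)
  then show ?thesis
    by (simp add: K_iff)
qed

lemma two_path_limit:
  fixes \<eta> \<zeta> :: "nat \<Rightarrow> 'i::countable \<Rightarrow> 'a"
  assumes "\<And>n i. \<eta> n i \<in> X" "\<And>n i. \<zeta> n i \<in> X"
  obtains s l m where "strict_mono (s :: nat \<Rightarrow> nat)" "\<And>i. l i \<in> X" "\<And>i. m i \<in> X"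
    "\<And>i. (\<lambda>n. \<eta> (s n) i) \<longlonglongrightarrow> l i" "\<And>i. (\<lambda>n. \<zeta> (s n) i) \<longlonglongrightarrow> m i"
proof -
  \<comment> \<open>Packing both families into one, with an additional Boolean index, lets a single
    extraction serve both.\<close>
  define F where "F = (\<lambda>n (b, i). if b then \<eta> n i else \<zeta> n i)"
  obtain f s where fs: "strict_mono (s :: nat \<Rightarrow> nat)" "\<And>i. f i \<in> X" "\<And>i. (\<lambda>n. F (s n) i) \<longlonglongrightarrow> f i"
  proof (rule pointwise_convergent_subsequence[of F "\<lambda>_. X"])
    show "F n i \<in> X" for n i
      using assms by (cases i) (simp add: F_def)
  qed (use cpt in auto)
  show thesis
    using fs(2) fs(3)[of "(True, i)" for i] fs(3)[of "(False, i)" for i]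
    by (intro that[OF fs(1), of "\<lambda>i. f (True, i)" "\<lambda>i. f (False, i)"]) (simp_all add: F_def)
qed

text \<open>Outside the window only membership in \<open>X\<close> is demanded, so finite orbit
  pieces are total sequences over the integers and have pointwise limits there.\<close>

definition tracked :: "nat \<Rightarrow> (int \<Rightarrow> 'a) \<Rightarrow> (int \<Rightarrow> 'a) \<Rightarrow> bool" where
  "tracked N \<eta> \<zeta> \<longleftrightarrow> (\<forall>i. \<eta> i \<in> X \<and> \<zeta> i \<in> X) \<and>
     (\<forall>i. - int N \<le> i \<and> i < int N \<longrightarrow> step (\<eta> i) (\<eta> (i + 1)) \<and> step (\<zeta> i) (\<zeta> (i + 1))) \<and>
     (\<forall>i. \<bar>i\<bar> \<le> int N \<longrightarrow> dist (\<eta> i) (\<zeta> i) \<le> \<epsilon>)"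

text \<open>The windows exhaust the integers, so the limit paths satisfy the hypotheses of
  \<open>expansive\<close> without restriction.\<close>

lemma tracked_limit:
  assumes "\<And>n. tracked n (\<eta> n) (\<zeta> n)"
  obtains s l m u where "strict_mono (s :: nat \<Rightarrow> nat)" "l \<in> X" "m \<in> X"
    "(\<lambda>n. \<eta> (s n) 0) \<longlonglongrightarrow> l" "(\<lambda>n. \<zeta> (s n) 0) \<longlonglongrightarrow> m" "\<bar>u\<bar> \<le> \<tau> / 2" "m = \<phi> u l"
proof -
  have X: "\<eta> n i \<in> X" "\<zeta> n i \<in> X" for n i
    using assms[of n] unfolding tracked_def by auto
  obtain s l m where s: "strict_mono (s :: nat \<Rightarrow> nat)" "\<And>i. l i \<in> X" "\<And>i. m i \<in> X"
    "\<And>i. (\<lambda>n. \<eta> (s n) i) \<longlonglongrightarrow> l i" "\<And>i. (\<lambda>n. \<zeta> (s n) i) \<longlonglongrightarrow> m i"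
    using two_path_limit[of \<eta> \<zeta>] X by metis
  have large: "\<forall>\<^sub>F n in sequentially. \<bar>i\<bar> < int (s n)" for i
  proof -
    have "filterlim s at_top sequentially"
      using s(1) by (rule filterlim_subseq)
    then have "\<forall>\<^sub>F n in sequentially. nat \<bar>i\<bar> + 1 \<le> s n"
      by (simp add: filterlim_at_top)
    then show ?thesis
      by eventually_elim linarith
  qed
  have trk: "step (\<eta> n i) (\<eta> n (i + 1))" "step (\<zeta> n i) (\<zeta> n (i + 1))" "dist (\<eta> n i) (\<zeta> n i) \<le> \<epsilon>"
    if "\<bar>i\<bar> < int n" for n i
  proof -
    have "- int n \<le> i \<and> i < int n" "\<bar>i\<bar> \<le> int n"
      using that by linarith+
    then show "step (\<eta> n i) (\<eta> n (i + 1))" "step (\<zeta> n i) (\<zeta> n (i + 1))" "dist (\<eta> n i) (\<zeta> n i) \<le> \<epsilon>"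
      using assms[of n] unfolding tracked_def by blast+
  qed
  have "\<exists>u. \<bar>u\<bar> \<le> \<tau> / 2 \<and> m 0 = \<phi> u (l 0)"
  proof (rule expansive)
    fix i
    have "step (l i) (l (i + 1))"
      by (rule step_limit[OF _ s(4) s(4)], rule X, rule eventually_mono[OF large[of i]], rule trk)
    moreover have "step (m i) (m (i + 1))"
      by (rule step_limit[OF _ s(5) s(5)], rule X, rule eventually_mono[OF large[of i]], rule trk)
    moreover have "dist (l i) (m i) \<le> \<epsilon>"
      by (rule tendsto_upperbound[OF tendsto_dist[OF s(4) s(5)]], rule eventually_mono[OF large[of i]], rule trk) auto
    ultimately show "l i \<in> X \<and> m i \<in> X \<and> step (l i) (l (i + 1)) \<and> step (m i) (m (i + 1)) \<and> dist (l i) (m i) \<le> \<epsilon>"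
      using s(2,3) by blast
  qed
  then obtain u where "\<bar>u\<bar> \<le> \<tau> / 2" "m 0 = \<phi> u (l 0)"
    by blast
  then show thesis
    by (rule that[OF s(1) s(2) s(3) s(4) s(5)])
qed

lemma uniform_expansivity:
  assumes "\<gamma> > 0"
  obtains N where "\<And>\<eta> \<zeta>. tracked N \<eta> \<zeta> \<Longrightarrow> \<exists>u. \<bar>u\<bar> \<le> \<tau> / 2 \<and> dist (\<zeta> 0) (\<phi> u (\<eta> 0)) \<le> \<gamma>"
proof (rule ccontr)
  assume "\<not> thesis"
  then have "\<exists>\<eta> \<zeta>. tracked N \<eta> \<zeta> \<and> (\<forall>u. \<bar>u\<bar> \<le> \<tau> / 2 \<longrightarrow> \<not> dist (\<zeta> 0) (\<phi> u (\<eta> 0)) \<le> \<gamma>)" for N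
    using that[of N] by blast
  then obtain \<eta> \<zeta> where *: "\<And>N. tracked N (\<eta> N) (\<zeta> N)" "\<And>N u. \<bar>u\<bar> \<le> \<tau> / 2 \<Longrightarrow> \<not> dist (\<zeta> N 0) (\<phi> u (\<eta> N 0)) \<le> \<gamma>"
    by metis
  obtain s l m u where s: "strict_mono (s :: nat \<Rightarrow> nat)" "l \<in> X" "m \<in> X"
    "(\<lambda>n. \<eta> (s n) 0) \<longlonglongrightarrow> l" "(\<lambda>n. \<zeta> (s n) 0) \<longlonglongrightarrow> m" "\<bar>u\<bar> \<le> \<tau> / 2" "m = \<phi> u l"
    using tracked_limit[OF *(1)] by metis
  have "(\<lambda>n. \<phi> u (\<eta> (s n) 0)) \<longlonglongrightarrow> m"
    unfolding s(7) using *(1) s(2,4) by (intro tendsto_flow) (auto simp: tracked_def)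
  from tendsto_dist[OF s(5) this] have "(\<lambda>n. dist (\<zeta> (s n) 0) (\<phi> u (\<eta> (s n) 0))) \<longlonglongrightarrow> 0"
    by simp
  then have "\<forall>\<^sub>F n in sequentially. dist (\<zeta> (s n) 0) (\<phi> u (\<eta> (s n) 0)) < \<gamma>"
    using assms by (rule order_tendstoD)
  then obtain n where "dist (\<zeta> (s n) 0) (\<phi> u (\<eta> (s n) 0)) < \<gamma>"
    by (auto simp: eventually_sequentially)
  with *(2)[OF s(6), of "s n"] show False
    by simp
qed

lemma sec_limit:
  assumes "\<And>n. (w n, y n) \<in> \<Sigma>" "w \<longlonglongrightarrow> w'" "y \<longlonglongrightarrow> y'"
  shows "(w', y') \<in> \<Sigma>"
  using assms by (intro Lim_in_closed_set[OF sec_closed, of "\<lambda>n. (w n, y n)" sequentially]) (auto intro: tendsto_Pair)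

lemma X_subseq:
  assumes "\<And>n. x n \<in> X"
  obtains s l where "strict_mono (s :: nat \<Rightarrow> nat)" "l \<in> X" "(\<lambda>n. x (s n)) \<longlonglongrightarrow> l"
  using cpt assms unfolding compact_eq_seq_compact_metric seq_compact_def comp_def by metis

text \<open>The limit points from \<open>tracked_limit\<close> lie on one section and differ by a
  time at most \<open>\<tau> / 2\<close>; \<open>sec_unique\<close> makes this time 0, so the
  distances tend to 0.\<close>

lemma section_expansivity:
  assumes "\<gamma> > 0"
  obtains N where "\<And>\<eta> \<zeta> w. tracked N \<eta> \<zeta> \<Longrightarrow> (w, \<eta> 0) \<in> \<Sigma> \<Longrightarrow> (w, \<zeta> 0) \<in> \<Sigma> \<Longrightarrow> dist (\<eta> 0) (\<zeta> 0) < \<gamma>"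
proof (rule ccontr)
  assume "\<not> thesis"
  then have "\<exists>\<eta> \<zeta> w. tracked N \<eta> \<zeta> \<and> (w, \<eta> 0) \<in> \<Sigma> \<and> (w, \<zeta> 0) \<in> \<Sigma> \<and> \<not> dist (\<eta> 0) (\<zeta> 0) < \<gamma>" for N
    using that[of N] by blast
  then obtain \<eta> \<zeta> w where *: "\<And>N. tracked N (\<eta> N) (\<zeta> N)" "\<And>N. (w N, \<eta> N 0) \<in> \<Sigma>" "\<And>N. (w N, \<zeta> N 0) \<in> \<Sigma>"
      "\<And>N. \<not> dist (\<eta> N 0) (\<zeta> N 0) < \<gamma>"
    by metis
  obtain s l m u where s: "strict_mono (s :: nat \<Rightarrow> nat)" "l \<in> X" "m \<in> X"
    "(\<lambda>n. \<eta> (s n) 0) \<longlonglongrightarrow> l" "(\<lambda>n. \<zeta> (s n) 0) \<longlonglongrightarrow> m" "\<bar>u\<bar> \<le> \<tau> / 2" "m = \<phi> u l"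
    using tracked_limit[OF *(1)] by metis
  obtain s' w' where s': "strict_mono (s' :: nat \<Rightarrow> nat)" "(\<lambda>n. w (s (s' n))) \<longlonglongrightarrow> w'"
    using X_subseq[of "\<lambda>n. w (s n)"] *(2) sec_in by metis
  have l': "(\<lambda>n. \<eta> (s (s' n)) 0) \<longlonglongrightarrow> l" "(\<lambda>n. \<zeta> (s (s' n)) 0) \<longlonglongrightarrow> m"
    using LIMSEQ_subseq_LIMSEQ[OF s(4) s'(1)] LIMSEQ_subseq_LIMSEQ[OF s(5) s'(1)] by (simp_all add: comp_def)
  have "(w', l) \<in> \<Sigma>" "(w', m) \<in> \<Sigma>"
    using sec_limit[OF _ s'(2) l'(1)] sec_limit[OF _ s'(2) l'(2)] *(2,3) by blast+
  then have "u = 0"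
    using s(6,7) \<tau>_pos by (intro sec_unique[of w' l u]) auto
  then have "m = l"
    using s(2,7) by simp
  then have "(\<lambda>n. dist (\<eta> (s n) 0) (\<zeta> (s n) 0)) \<longlonglongrightarrow> 0"
    using tendsto_dist[OF s(4,5)] by simp
  then have "\<forall>\<^sub>F n in sequentially. dist (\<eta> (s n) 0) (\<zeta> (s n) 0) < \<gamma>"
    using assms by (rule order_tendstoD)
  then obtain n where "dist (\<eta> (s n) 0) (\<zeta> (s n) 0) < \<gamma>"
    by (auto simp: eventually_sequentially)
  with *(4)[of "s n"] show False
    by simp
qed

end

section \<open>Backward asymptotic points on one orbit\<close>

context exp_flow
begin

text \<open>Flowing \<open>p\<close> and \<open>q\<close> by the same time \<open>v\<close> keeps
  them close, so \<open>\<phi> v' q\<close> is a near return of \<open>\<phi> v q\<close> after a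
  time at most \<open>\<tau>\<close>, and such a time is small. This sharpens a crude bound on a
  time discrepancy to a fine one and thereby stops errors from accumulating.\<close>

lemma rigidity:
  assumes "\<kappa>' > 0"
  obtains \<gamma> where "\<gamma> > 0" "\<And>p q v v'. p \<in> X \<Longrightarrow> q \<in> X \<Longrightarrow> \<bar>v\<bar> \<le> 2 \<Longrightarrow> \<bar>v - v'\<bar> \<le> \<tau> \<Longrightarrow> dist p q \<le> \<gamma> \<Longrightarrow>
    dist (\<phi> v p) (\<phi> v' q) \<le> \<gamma> \<Longrightarrow> \<bar>v - v'\<bar> < \<kappa>'"
proof -
  obtain \<gamma> where \<gamma>: "\<gamma> > 0" "\<And>x u. x \<in> X \<Longrightarrow> \<bar>u\<bar> \<le> \<tau> \<Longrightarrow> dist (\<phi> u x) x \<le> \<gamma> \<Longrightarrow> \<bar>u\<bar> < \<kappa>'"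
    using short_return_times[OF assms] by metis
  obtain d where d: "d > 0" "\<And>x y u v. x \<in> X \<Longrightarrow> y \<in> X \<Longrightarrow> \<bar>u\<bar> \<le> 2 \<Longrightarrow> \<bar>v\<bar> \<le> 2 \<Longrightarrow> \<bar>u - v\<bar> \<le> d \<Longrightarrow> dist x y \<le> d
    \<Longrightarrow> dist (\<phi> u x) (\<phi> v y) \<le> \<gamma> / 2"
    using flow_uniform[OF half_gt_zero[OF \<gamma>(1)]] by metis
  show thesis
  proof (rule that[of "min d (\<gamma> / 2)"])
    fix p q v v'
    assume *: "p \<in> X" "q \<in> X" "\<bar>v\<bar> \<le> 2" "\<bar>v - v'\<bar> \<le> \<tau>" "dist p q \<le> min d (\<gamma> / 2)"
      "dist (\<phi> v p) (\<phi> v' q) \<le> min d (\<gamma> / 2)"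
    have "dist (\<phi> v p) (\<phi> v q) \<le> \<gamma> / 2"
      using * d(1) by (intro d(2)) auto
    then have "dist (\<phi> v' q) (\<phi> v q) \<le> \<gamma>"
      using *(6) dist_triangle3[of "\<phi> v' q" "\<phi> v q" "\<phi> v p"] by simp
    then have "\<bar>v' - v\<bar> < \<kappa>'"
      using * by (intro \<gamma>(2)[of "\<phi> v q"]) (auto simp: flow_flow abs_minus_commute)
    then show "\<bar>v - v'\<bar> < \<kappa>'"
      by (simp add: abs_minus_commute)
  qed (use d \<gamma> in auto)
qed

text \<open>Before time \<open>- N\<close> a whole window of length \<open>N\<close> on either side
  fits into the backward orbit, so tracking at scale \<epsilon> improves to scale
  \<open>\<gamma>\<close> after a small time correction. \<open>N\<close> is independent of
  \<open>x\<close> and \<open>F\<close>.\<close>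

lemma contraction:
  assumes "\<gamma> > 0"
  obtains N :: nat where "\<And>x F s. x \<in> X \<Longrightarrow> (\<And>t. t \<le> 0 \<Longrightarrow> dist (\<phi> t x) (\<phi> (F t) x) \<le> \<epsilon>) \<Longrightarrow>
    (\<And>t. t \<le> 0 \<Longrightarrow> \<bar>F t - F (t - 1) - 1\<bar> \<le> \<kappa>) \<Longrightarrow> s \<le> - real N \<Longrightarrow>
    \<exists>u. \<bar>u\<bar> \<le> \<kappa> \<and> dist (\<phi> s x) (\<phi> (F s + u) x) \<le> \<gamma>"
proof -
  obtain d where d: "d > 0" "\<And>x y u v. x \<in> X \<Longrightarrow> y \<in> X \<Longrightarrow> \<bar>u\<bar> \<le> \<tau> \<Longrightarrow> \<bar>v\<bar> \<le> \<tau> \<Longrightarrow> \<bar>u - v\<bar> \<le> d \<Longrightarrow> dist x y \<le> d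
    \<Longrightarrow> dist (\<phi> u x) (\<phi> v y) \<le> \<gamma>"
    using flow_uniform[OF assms] by metis
  have "min d \<epsilon> > 0"
    using d eps by simp
  then obtain N where N: "\<And>\<eta> \<zeta>. tracked N \<eta> \<zeta> \<Longrightarrow> \<exists>u. \<bar>u\<bar> \<le> \<tau> / 2 \<and> dist (\<zeta> 0) (\<phi> u (\<eta> 0)) \<le> min d \<epsilon>"
    using uniform_expansivity by metis
  show thesis
  proof (rule that[of N])
    fix x F s
    assume x: "x \<in> X" and F: "\<And>t. t \<le> 0 \<Longrightarrow> dist (\<phi> t x) (\<phi> (F t) x) \<le> \<epsilon>"
      "\<And>t. t \<le> 0 \<Longrightarrow> \<bar>F t - F (t - 1) - 1\<bar> \<le> \<kappa>" and s: "s \<le> - real N"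
    have "tracked N (\<lambda>i. \<phi> (s + i) x) (\<lambda>i. \<phi> (F (s + i)) x)"
      unfolding tracked_def
    proof (intro conjI allI impI)
      fix i :: int
      show "dist (\<phi> (s + i) x) (\<phi> (F (s + i)) x) \<le> \<epsilon>" if "\<bar>i\<bar> \<le> int N"
        using that s by (intro F(1)) linarith
      assume i: "- int N \<le> i \<and> i < int N"
      then have "\<bar>F (s + i + 1) - F (s + i + 1 - 1) - 1\<bar> \<le> \<kappa>"
        using s by (intro F(2)) linarith
      then show "step (\<phi> (F (s + i)) x) (\<phi> (F (s + of_int (i + 1))) x)"
        unfolding kstep_def using x
        by (intro exI[of _ "F (s + i + 1) - F (s + i)"]) (simp add: flow_flow add.assoc)
      show "step (\<phi> (s + i) x) (\<phi> (s + of_int (i + 1)) x)"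
        unfolding kstep_def using x kappa by (intro exI[of _ 1]) (simp add: flow_flow add.assoc)
    qed (use x in auto)
    from N[OF this] obtain u where u: "\<bar>u\<bar> \<le> \<tau> / 2" "dist (\<phi> (F s) x) (\<phi> u (\<phi> s x)) \<le> min d \<epsilon>"
      by auto
    have "dist (\<phi> s x) (\<phi> (F s) x) \<le> \<epsilon>"
      using s by (intro F(1)) linarith
    then have "dist (\<phi> u (\<phi> s x)) (\<phi> s x) \<le> 3 * \<epsilon>"
      using u(2) dist_triangle[of "\<phi> u (\<phi> s x)" "\<phi> s x" "\<phi> (F s) x"] eps by (simp add: dist_commute)
    \<comment> \<open>Uniform expansivity alone bounds \<open>u\<close> by
      \<open>\<tau> / 2\<close>; since the shifted point is within \<open>3 * \<epsilon>\<close> of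
      the original one, \<open>short\<close> improves this.\<close>
    then have "\<bar>u\<bar> \<le> \<kappa>"
      using short[of "\<phi> s x" u] x u(1) \<tau>_pos by simp
    moreover have "dist (\<phi> (- u) (\<phi> (F s) x)) (\<phi> (- u) (\<phi> u (\<phi> s x))) \<le> \<gamma>"
      using u x d(1) \<tau>_pos by (intro d(2)) auto
    then have "dist (\<phi> s x) (\<phi> (F s + (- u)) x) \<le> \<gamma>"
      using x by (simp add: flow_flow dist_commute)
    ultimately show "\<exists>u. \<bar>u\<bar> \<le> \<kappa> \<and> dist (\<phi> s x) (\<phi> (F s + u) x) \<le> \<gamma>"
      by (intro exI[of _ "- u"]) simp
  qed
qed

end

locale aperiodic_set = exp_flow \<phi> X \<tau> \<kappa> \<epsilon> r \<Sigma>
  for \<phi> :: "real \<Rightarrow> 'a::metric_space \<Rightarrow> 'a" and X \<tau> \<kappa> \<epsilon> r \<Sigma> +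
  fixes M :: "'a set"
  assumes M_sub: "M \<subseteq> X" and M_compact: "compact M"
    and M_inv: "\<And>q t. q \<in> M \<Longrightarrow> \<phi> t q \<in> M"
    and aperiodic: "\<And>q t. q \<in> M \<Longrightarrow> \<phi> t q = q \<Longrightarrow> t = 0"
begin

text \<open>As in \<open>short_return_times\<close>, but up to an arbitrary time \<open>R\<close>,
  since points of \<open>M\<close> have no period at all. The bound \<open>\<gamma>\<close> depends
  on \<open>R\<close>, which is why unbounded delays need the separate argument of
  \<open>no_self_tracking\<close>.\<close>

lemma no_bounded_returns:
  obtains \<gamma> where "\<gamma> > 0" "\<And>q v. q \<in> M \<Longrightarrow> \<tau> / 2 \<le> v \<Longrightarrow> v \<le> R \<Longrightarrow> dist (\<phi> v q) q > \<gamma>"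
proof (cases "M = {} \<or> R < \<tau> / 2")
  case True
  then show ?thesis
    using that[of 1] by force
next
  case False
  define K where "K = {\<tau>/2..R} \<times> M"
  have K: "compact K" "K \<noteq> {}"
    using False by (auto simp: K_def intro: compact_Times M_compact)
  have "continuous_on K (\<lambda>z. dist (\<phi> (fst z) (snd z)) (snd z))"
    using M_sub by (intro continuous_intros) (auto simp: K_def)
  from continuous_attains_inf[OF K this] obtain z where
    z: "z \<in> K" "\<And>z'. z' \<in> K \<Longrightarrow> dist (\<phi> (fst z) (snd z)) (snd z) \<le> dist (\<phi> (fst z') (snd z')) (snd z')"
    by blast
  define g where "g = dist (\<phi> (fst z) (snd z)) (snd z)"
  have "g > 0"
    using z(1) aperiodic[of "snd z" "fst z"] \<tau>_pos unfolding g_def K_def by force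
  show ?thesis
  proof (rule that[of "g / 2"])
    fix q v assume "q \<in> M" "\<tau> / 2 \<le> v" "v \<le> R"
    then have "(v, q) \<in> K"
      by (auto simp: K_def)
    from z(2)[OF this] have "g \<le> dist (\<phi> v q) q"
      by (simp add: g_def)
    then show "dist (\<phi> v q) q > g / 2"
      using \<open>g > 0\<close> by linarith
  qed (use \<open>g > 0\<close> in simp)
qed

text \<open>Composing the self-tracking \<open>f\<close> with itself, and contracting at each stage, shadows the orbit
  segment from \<open>f 0\<close> to \<open>0\<close> over and over again. Hence the backward orbit of \<open>x\<close> is close to its
  own shift by a fixed number of steps, and uniform expansivity makes it return too well.\<close>

lemma no_self_tracking:
  obtains \<gamma> R where "\<gamma> > 0" "\<And>x f. x \<in> M \<Longrightarrow> (\<And>t. t \<le> 0 \<Longrightarrow> dist (\<phi> t x) (\<phi> (f t) x) \<le> \<gamma>) \<Longrightarrow>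
    (\<And>s t. s \<le> 0 \<Longrightarrow> t \<le> 0 \<Longrightarrow> \<bar>s - t\<bar> \<le> 1 \<Longrightarrow> \<bar>f t - f s - (t - s)\<bar> \<le> \<kappa> / 4) \<Longrightarrow>
    (\<And>t. t \<le> 0 \<Longrightarrow> f t \<le> t - R) \<Longrightarrow> False"
proof -
  have "\<kappa> / 8 > 0"
    using kappa by simp
  then obtain \<gamma>1 where \<gamma>1: "\<gamma>1 > 0" "\<And>p q v v'. p \<in> X \<Longrightarrow> q \<in> X \<Longrightarrow> \<bar>v\<bar> \<le> 2 \<Longrightarrow> \<bar>v - v'\<bar> \<le> \<tau> \<Longrightarrow> dist p q \<le> \<gamma>1 \<Longrightarrow>
    dist (\<phi> v p) (\<phi> v' q) \<le> \<gamma>1 \<Longrightarrow> \<bar>v - v'\<bar> < \<kappa> / 8"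
    using rigidity by metis
  \<comment> \<open>Two points within \<open>\<gamma>\<close> of a third one are within \<epsilon>
    of each other, as used in \<open>Pclose\<close>.\<close>
  define \<gamma> where "\<gamma> = min \<gamma>1 (\<epsilon> / 2)"
  have \<gamma>: "\<gamma> > 0" "\<gamma> \<le> \<gamma>1" "2 * \<gamma> \<le> \<epsilon>" "\<gamma> \<le> \<epsilon>" "\<gamma> / 2 > 0"
    using \<gamma>1(1) eps by (auto simp: \<gamma>_def)
  obtain N :: nat where N: "\<And>x F s. x \<in> X \<Longrightarrow> (\<And>t. t \<le> 0 \<Longrightarrow> dist (\<phi> t x) (\<phi> (F t) x) \<le> \<epsilon>) \<Longrightarrow>
    (\<And>t. t \<le> 0 \<Longrightarrow> \<bar>F t - F (t - 1) - 1\<bar> \<le> \<kappa>) \<Longrightarrow> s \<le> - real N \<Longrightarrow>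
    \<exists>u. \<bar>u\<bar> \<le> \<kappa> \<and> dist (\<phi> s x) (\<phi> (F s + u) x) \<le> \<gamma> / 2"
    using contraction[OF \<gamma>(5)] by blast
  \<comment> \<open>\<open>N\<close> puts every \<open>f t\<close> into the range of
    \<open>contraction\<close>; \<open>4 / \<kappa>\<close> makes rounding the delay to whole steps
    cost at most \<open>\<kappa> / 4\<close> per step; \<open>2 * \<tau>\<close> makes the final
    return time at least \<open>\<tau> / 2\<close>.\<close>
  define R where "R = real N + 4 / \<kappa> + 2 * \<tau> + 1"
  have R: "R \<ge> N" "R \<ge> 4 / \<kappa>" "R \<ge> 2 * \<tau>" "R > 1"
    using kappa \<tau>_pos by (auto simp: R_def add_increasing add_nonneg_pos divide_nonneg_pos)
  show thesis
  proof (rule that[OF \<gamma>(5), of R])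
    fix x f
    assume xM: "x \<in> M" and f1: "\<And>t. t \<le> 0 \<Longrightarrow> dist (\<phi> t x) (\<phi> (f t) x) \<le> \<gamma> / 2"
      and f2: "\<And>s t. s \<le> 0 \<Longrightarrow> t \<le> 0 \<Longrightarrow> \<bar>s - t\<bar> \<le> 1 \<Longrightarrow> \<bar>f t - f s - (t - s)\<bar> \<le> \<kappa> / 4"
      and f3: "\<And>t. t \<le> 0 \<Longrightarrow> f t \<le> t - R"
    have x: "x \<in> X"
      using xM M_sub by blast
    \<comment> \<open>This class is made to survive composition with \<open>f\<close>: the map
      \<open>f\<close> tracks within \<open>\<gamma> / 2\<close>, contraction brings the tracking by
      \<open>F\<close> at \<open>f t\<close> down to \<open>\<gamma> / 2\<close>, and the sum is
      \<open>\<gamma>\<close> again.\<close>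
    define good where "good = (\<lambda>F. (\<forall>t\<le>0. dist (\<phi> t x) (\<phi> (F t) x) \<le> \<gamma>) \<and>
      (\<forall>s\<le>0. \<forall>t\<le>0. \<bar>s - t\<bar> \<le> 1 \<longrightarrow> \<bar>F t - F s - (t - s)\<bar> \<le> \<kappa> / 8))"
    have next_good: "\<exists>F'. good F' \<and> \<bar>F' 0 - F (f 0)\<bar> \<le> \<kappa> / 8" if F: "good F" for F
    proof -
      have F1: "\<And>t. t \<le> 0 \<Longrightarrow> dist (\<phi> t x) (\<phi> (F t) x) \<le> \<gamma>"
        and F2: "\<And>s t. s \<le> 0 \<Longrightarrow> t \<le> 0 \<Longrightarrow> \<bar>s - t\<bar> \<le> 1 \<Longrightarrow> \<bar>F t - F s - (t - s)\<bar> \<le> \<kappa> / 8"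
        using F unfolding good_def by auto
      have ex: "\<exists>u. \<bar>u\<bar> < \<kappa> / 8 \<and> dist (\<phi> s x) (\<phi> (F s + u) x) \<le> \<gamma> / 2" if s: "s \<le> - real N" for s
      proof -
        have "\<exists>u. \<bar>u\<bar> \<le> \<kappa> \<and> dist (\<phi> s x) (\<phi> (F s + u) x) \<le> \<gamma> / 2"
        proof (rule N[OF x _ _ s])
          fix t :: real assume "t \<le> 0"
          then show "dist (\<phi> t x) (\<phi> (F t) x) \<le> \<epsilon>"
            using F1[of t] \<gamma>(4) by linarith
          show "\<bar>F t - F (t - 1) - 1\<bar> \<le> \<kappa>"
            using F2[of "t - 1" t] \<open>t \<le> 0\<close> kappa by simp
        qed
        then obtain u where u: "\<bar>u\<bar> \<le> \<kappa>" "dist (\<phi> s x) (\<phi> (F s + u) x) \<le> \<gamma> / 2"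
          by blast
        have "\<bar>0 - u\<bar> < \<kappa> / 8"
        proof (rule \<gamma>1(2)[of "\<phi> s x" "\<phi> (F s) x"])
          show "dist (\<phi> s x) (\<phi> (F s) x) \<le> \<gamma>1"
            using F1[of s] s \<gamma>(2) by linarith
          show "dist (\<phi> 0 (\<phi> s x)) (\<phi> u (\<phi> (F s) x)) \<le> \<gamma>1"
            using u(2) x \<gamma> by (simp add: flow_flow)
        qed (use x u(1) kappa in auto)
        with u(2) show ?thesis
          by auto
      qed
      then obtain u where u: "\<And>s. s \<le> - real N \<Longrightarrow> \<bar>u s\<bar> < \<kappa> / 8" "\<And>s. s \<le> - real N \<Longrightarrow> dist (\<phi> s x) (\<phi> (F s + u s) x) \<le> \<gamma> / 2"
        by metis
      have fN: "f t \<le> - real N" "f t \<le> 0" if "t \<le> 0" for t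
        using f3[OF that] R that by linarith+
      define F' where "F' = (\<lambda>t. F (f t) + u (f t))"
      have F'1: "dist (\<phi> t x) (\<phi> (F' t) x) \<le> \<gamma>" if "t \<le> 0" for t
        using f1[OF that] u(2)[OF fN(1)[OF that]] dist_triangle[of "\<phi> t x" "\<phi> (F' t) x" "\<phi> (f t) x"]
        unfolding F'_def by linarith
      have "\<bar>F' t - F' s - (t - s)\<bar> \<le> \<kappa> / 8" if st: "s \<le> 0" "t \<le> 0" "\<bar>s - t\<bar> \<le> 1" for s t
      proof -
        \<comment> \<open>\<open>f s\<close> and \<open>f t\<close> may be 2 apart, while the
          estimate for \<open>F\<close> covers distance 1; hence it is used twice, through the
          midpoint. The crude bound \<open>\<tau>\<close> obtained this way is brought back to
          \<open>\<kappa> / 8\<close> by rigidity, without which the errors would grow with every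
          composition.\<close>
        define m where "m = (f s + f t) / 2"
        have f_st: "\<bar>f t - f s - (t - s)\<bar> \<le> \<kappa> / 4"
          using f2 st by blast
        then have "\<bar>f s - f t\<bar> \<le> 2"
          using st kappa by linarith
        moreover have "f s - m = (f s - f t) / 2" "m - f t = (f s - f t) / 2"
          by (simp_all add: m_def field_simps)
        ultimately have "\<bar>f s - m\<bar> \<le> 1" "\<bar>m - f t\<bar> \<le> 1"
          by simp_all
        moreover have m0: "m \<le> 0"
          using fN(2)[OF st(1)] fN(2)[OF st(2)] by (simp add: m_def)
        ultimately have "\<bar>F m - F (f s) - (m - f s)\<bar> \<le> \<kappa> / 8" "\<bar>F (f t) - F m - (f t - m)\<bar> \<le> \<kappa> / 8"
          using F2[of "f s" m] F2[of m "f t"] m0 fN(2) st by auto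
        with f_st have "\<bar>(t - s) - (F' t - F' s)\<bar> \<le> \<tau>"
          using u(1)[OF fN(1)[OF st(1)]] u(1)[OF fN(1)[OF st(2)]] kappa unfolding F'_def by linarith
        then have "\<bar>(t - s) - (F' t - F' s)\<bar> < \<kappa> / 8"
          using x st F'1[OF st(1)] F'1[OF st(2)] \<gamma>(2)
          by (intro \<gamma>1(2)[of "\<phi> s x" "\<phi> (F' s) x"]) (auto simp: flow_flow)
        then show ?thesis
          by linarith
      qed
      then have "good F'"
        using F'1 unfolding good_def by blast
      moreover have "\<bar>F' 0 - F (f 0)\<bar> \<le> \<kappa> / 8"
        using u(1)[OF fN(1)[of 0]] by (simp add: F'_def)
      ultimately show ?thesis
        by blast
    qed
    have "good (\<lambda>t. t)"
      unfolding good_def using \<gamma>(1) kappa by auto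
    then obtain Fs where Fs: "\<And>k. good (Fs k)" "\<And>k. \<bar>Fs (Suc k) 0 - Fs k (f 0)\<bar> \<le> \<kappa> / 8"
      using dependent_nat_choice[of "\<lambda>_. good" "\<lambda>_ F F'. \<bar>F' 0 - F (f 0)\<bar> \<le> \<kappa> / 8"] next_good by metis
    \<comment> \<open>The time interval from \<open>f 0\<close> to 0 is cut into \<open>n\<close>
      equal pieces of length \<open>\<sigma>\<close>, at most 1 and close to it.\<close>
    define n where "n = nat \<lceil>- f 0\<rceil>"
    define \<sigma> where "\<sigma> = - f 0 / n"
    have f0: "f 0 \<le> - R"
      using f3[of 0] by simp
    have n: "real n \<ge> - f 0" "real n < - f 0 + 1" "real n \<ge> R" "n > 0"
      using f0 R(4) unfolding n_def by linarith+
    have n\<sigma>: "n * \<sigma> = - f 0"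
      using n(4) by (simp add: \<sigma>_def)
    have \<sigma>: "\<sigma> \<le> 1" "1 - \<sigma> \<le> \<kappa> / 4" "\<sigma> > 0"
    proof -
      show "\<sigma> \<le> 1" "\<sigma> > 0"
        using n f0 R(4) by (auto simp: \<sigma>_def divide_simps)
      have "4 / \<kappa> \<le> n"
        using n R by linarith
      then have "1 / n \<le> \<kappa> / 4"
        using kappa n(4) by (simp add: field_simps)
      moreover have "1 - \<sigma> = (n + f 0) / n"
        using n(4) by (simp add: \<sigma>_def field_simps)
      then have "1 - \<sigma> \<le> 1 / n"
        using n(2) by (simp add: divide_right_mono)
      ultimately show "1 - \<sigma> \<le> \<kappa> / 4"
        by linarith
    qed
    \<comment> \<open>Times running backwards along the orbit. \<open>Fs k\<close> copies the
      \<open>n\<close> nodes of the segment, and copy \<open>k + 1\<close> starts where copy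
      \<open>k\<close> ends, up to \<open>\<kappa> / 8\<close>. Nodes \<open>m\<close> and
      \<open>m + n\<close> shadow the same point of the segment.\<close>
    define P where "P = (\<lambda>m. Fs (m div n) (- (real (m mod n) * \<sigma>)))"
    have Pstep: "\<bar>P m - P (Suc m) - 1\<bar> \<le> \<kappa> / 2" for m
    proof -
      have *: "\<bar>Fs k (- (real i * \<sigma>)) - Fs k (- (real (Suc i) * \<sigma>)) - \<sigma>\<bar> \<le> \<kappa> / 8" for k i
      proof -
        have "\<bar>Fs k t - Fs k s - (t - s)\<bar> \<le> \<kappa> / 8" if "s \<le> 0" "t \<le> 0" "\<bar>s - t\<bar> \<le> 1" for s t
          using Fs(1)[of k] that unfolding good_def by blast
        moreover have "- (real (Suc i) * \<sigma>) \<le> 0" "- (real i * \<sigma>) \<le> 0"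
          using \<sigma>(3) by simp_all
        moreover have eq: "- (real i * \<sigma>) - (- (real (Suc i) * \<sigma>)) = \<sigma>"
          by (simp add: algebra_simps)
        moreover from eq have "\<bar>- (real (Suc i) * \<sigma>) - (- (real i * \<sigma>))\<bar> \<le> 1"
          using \<sigma> by linarith
        ultimately show ?thesis
          by metis
      qed
      show ?thesis
      proof (cases "Suc (m mod n) = n")
        case True
        then have "Suc m div n = Suc (m div n)" "Suc m mod n = 0"
          by (auto simp: div_Suc mod_Suc)
        then have "P (Suc m) = Fs (Suc (m div n)) 0"
          by (simp add: P_def)
        moreover have e: "- (real (Suc (m mod n)) * \<sigma>) = f 0"
          using n\<sigma> True by simp
        moreover have "\<bar>P m - Fs (m div n) (f 0) - \<sigma>\<bar> \<le> \<kappa> / 8"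
          using *[of "m div n" "m mod n"] unfolding e P_def .
        ultimately show ?thesis
          using Fs(2)[of "m div n"] \<sigma> kappa by linarith
      next
        case False
        then have e: "Suc m div n = m div n" "Suc m mod n = Suc (m mod n)"
          by (auto simp: div_Suc mod_Suc)
        have "\<bar>P m - P (Suc m) - \<sigma>\<bar> \<le> \<kappa> / 8"
          using *[of "m div n" "m mod n"] unfolding e P_def .
        then show ?thesis
          using \<sigma> kappa by linarith
      qed
    qed
    have Pclose: "dist (\<phi> (P m) x) (\<phi> (P (m + n)) x) \<le> \<epsilon>" for m
    proof -
      define t where "t = - (real (m mod n) * \<sigma>)"
      have "t \<le> 0"
        using \<sigma>(3) by (simp add: t_def)
      then have "dist (\<phi> t x) (\<phi> (P m) x) \<le> \<gamma>" "dist (\<phi> t x) (\<phi> (P (m + n)) x) \<le> \<gamma>"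
        using Fs(1) n(4) unfolding P_def t_def good_def by simp_all
      then show ?thesis
        using dist_triangle3[of "\<phi> (P m) x" "\<phi> (P (m + n)) x" "\<phi> t x"] \<gamma>(3) by linarith
    qed
    \<comment> \<open>By now \<open>n\<close> is fixed, so the return times to be excluded are
      bounded; the window \<open>N3\<close> may depend on \<open>n\<close>.\<close>
    obtain \<gamma>3 where \<gamma>3: "\<gamma>3 > 0" "\<And>q v. q \<in> M \<Longrightarrow> \<tau> / 2 \<le> v \<Longrightarrow> v \<le> 2 * n + \<tau> \<Longrightarrow> dist (\<phi> v q) q > \<gamma>3"
      using no_bounded_returns[of "2 * n + \<tau>"] by metis
    obtain N3 where N3: "\<And>\<eta> \<zeta>. tracked N3 \<eta> \<zeta> \<Longrightarrow> \<exists>u. \<bar>u\<bar> \<le> \<tau> / 2 \<and> dist (\<zeta> 0) (\<phi> u (\<eta> 0)) \<le> \<gamma>3"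
      using uniform_expansivity[OF \<gamma>3(1)] by metis
    have Pst: "step (\<phi> (P (Suc m)) x) (\<phi> (P m) x)" for m
      unfolding kstep_def using Pstep[of m] kappa x by (intro exI[of _ "P m - P (Suc m)"]) (simp add: flow_flow)
    \<comment> \<open>The integer \<open>i\<close> stands for node \<open>N3 - i\<close>: this
      reverses the nodes into forward time and puts node \<open>N3\<close> at the centre of the
      window.\<close>
    have "tracked N3 (\<lambda>i. \<phi> (P (nat (int N3 - i))) x) (\<lambda>i. \<phi> (P (nat (int N3 - i) + n)) x)"
      unfolding tracked_def
    proof (intro conjI allI impI)
      fix i assume "- int N3 \<le> i \<and> i < int N3"
      then have *: "nat (int N3 - i) = Suc (nat (int N3 - (i + 1)))"
        by linarith
      show "step (\<phi> (P (nat (int N3 - i))) x) (\<phi> (P (nat (int N3 - (i + 1)))) x)"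
        unfolding * by (rule Pst)
      show "step (\<phi> (P (nat (int N3 - i) + n)) x) (\<phi> (P (nat (int N3 - (i + 1)) + n)) x)"
        unfolding * using Pst by simp
    qed (use x Pclose in auto)
    from N3[OF this] obtain u where u: "\<bar>u\<bar> \<le> \<tau> / 2" "dist (\<phi> (P (N3 + n)) x) (\<phi> u (\<phi> (P N3) x)) \<le> \<gamma>3"
      by auto
    have lam: "\<bar>P m - P (m + j) - j\<bar> \<le> \<kappa> / 2 * j" for m j
    proof (induction j)
      case (Suc j)
      have "\<kappa> / 2 * real (Suc j) = \<kappa> / 2 * j + \<kappa> / 2" "P (m + Suc j) = P (Suc (m + j))"
        by (simp_all add: algebra_simps)
      then show ?case
        using Suc Pstep[of "m + j"] by linarith
    qed simp
    have "\<kappa> / 2 * n \<le> 1 / 2 * n"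
      using kappa by (intro mult_right_mono) auto
    then have "real n / 2 \<le> P N3 - P (N3 + n)" "P N3 - P (N3 + n) \<le> 2 * n"
      using lam[of N3 n] by linarith+
    then have "\<tau> / 2 \<le> P N3 - P (N3 + n) + u" "P N3 - P (N3 + n) + u \<le> 2 * n + \<tau>"
      using u(1) n R \<tau>_pos by linarith+
    from \<gamma>3(2)[OF M_inv[OF xM, of "P (N3 + n)"] this] show False
      using u(2) x by (simp add: flow_flow dist_commute)
  qed
qed

text \<open>Reduces to \<open>no_self_tracking\<close>. The delay between the paths never falls
  below \<open>\<tau>\<close>; far in the past the paths are so close that
  \<open>no_bounded_returns\<close> pushes it beyond \<open>R\<close>; interpolation between the
  samples then yields \<open>f\<close>.\<close>

lemma no_tracking_of_translate_aux:
  fixes \<xi> \<zeta> :: "nat \<Rightarrow> 'a"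
  assumes xM: "\<xi> 0 \<in> M" and rho: "\<rho> > \<tau>" "\<zeta> 0 = \<phi> \<rho> (\<xi> 0)"
    and X: "\<And>i. \<xi> i \<in> X" "\<And>i. \<zeta> i \<in> X"
    and steps: "\<And>i. step (\<xi> (Suc i)) (\<xi> i)" "\<And>i. step (\<zeta> (Suc i)) (\<zeta> i)"
    and close: "\<And>i. dist (\<xi> i) (\<zeta> i) \<le> \<epsilon>"
  shows False
proof -
  define x where "x = \<xi> 0"
  have x: "x \<in> X" "x \<in> M"
    using X xM by (simp_all add: x_def)
  have times: "\<exists>a. a 0 = a0 \<and> (\<forall>i. \<bar>a i - a (Suc i) - 1\<bar> \<le> \<kappa>) \<and> (\<forall>i. \<alpha> i = \<phi> (a i) x)"
    if \<alpha>: "\<And>i. \<alpha> i \<in> X" "\<And>i. step (\<alpha> (Suc i)) (\<alpha> i)" "\<alpha> 0 = \<phi> a0 x" for \<alpha> :: "nat \<Rightarrow> 'a" and a0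
  proof -
    obtain u where u: "\<And>i. \<bar>u i - 1\<bar> \<le> \<kappa>" "\<And>i. \<alpha> i = \<phi> (u i) (\<alpha> (Suc i))"
      using \<alpha>(2) unfolding kstep_def by metis
    define a where "a = (\<lambda>i. a0 - (\<Sum>j<i. u j))"
    have "\<alpha> i = \<phi> (a i) x" for i
    proof (induction i)
      case (Suc i)
      have "\<alpha> (Suc i) = \<phi> (- u i) (\<alpha> i)"
        using u(2)[of i] \<alpha>(1) by simp
      then show ?case
        using Suc x by (simp add: a_def flow_flow diff_diff_eq)
    qed (simp add: a_def \<alpha>(3))
    then show ?thesis
      using u(1) by (intro exI[of _ a]) (simp add: a_def)
  qed
  obtain a where a: "a 0 = 0" "\<And>i. \<bar>a i - a (Suc i) - 1\<bar> \<le> \<kappa>" "\<And>i. \<xi> i = \<phi> (a i) x"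
    using times[of \<xi> 0] X steps x by (auto simp: x_def)
  obtain b where b: "b 0 = \<rho>" "\<And>i. \<bar>b i - b (Suc i) - 1\<bar> \<le> \<kappa>" "\<And>i. \<zeta> i = \<phi> (b i) x"
    using times[of \<zeta> \<rho>] X steps rho(2) by (auto simp: x_def)
  define D where "D = (\<lambda>i. b i - a i)"
  have Dstep: "\<bar>D i - D (Suc i)\<bar> \<le> 2 * \<kappa>" for i
    using a(2)[of i] b(2)[of i] unfolding D_def by linarith
  \<comment> \<open>The delay changes by at most \<open>2 * \<kappa>\<close> per step, so it cannot
    jump over the range from \<open>\<kappa>\<close> to \<open>\<tau>\<close>, which
    \<open>short\<close> forbids.\<close>
  have Dlarge: "D i > \<tau>" for i
  proof (induction i)
    case 0
    then show ?case
      using rho a b by (simp add: D_def)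
  next
    case (Suc i)
    show ?case
    proof (rule ccontr)
      assume "\<not> D (Suc i) > \<tau>"
      then have "\<bar>D (Suc i)\<bar> \<le> \<tau>" "D (Suc i) \<ge> \<kappa>"
        using Dstep[of i] Suc kappa by linarith+
      moreover have "\<zeta> (Suc i) = \<phi> (D (Suc i)) (\<xi> (Suc i))"
        using x a(3)[of "Suc i"] b(3)[of "Suc i"] by (simp add: flow_flow D_def)
      then have "dist (\<phi> (D (Suc i)) (\<xi> (Suc i))) (\<xi> (Suc i)) \<le> 3 * \<epsilon>"
        using close[of "Suc i"] eps by (simp add: dist_commute)
      ultimately show False
        using short[of "\<xi> (Suc i)" "D (Suc i)"] X by force
    qed
  qed
  show False
  proof (rule no_self_tracking)
    fix \<gamma> R assume \<gamma>: "\<gamma> > 0" and core: "\<And>x f. x \<in> M \<Longrightarrow> (\<And>t. t \<le> 0 \<Longrightarrow> dist (\<phi> t x) (\<phi> (f t) x) \<le> \<gamma>) \<Longrightarrow>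
      (\<And>s t. s \<le> 0 \<Longrightarrow> t \<le> 0 \<Longrightarrow> \<bar>s - t\<bar> \<le> 1 \<Longrightarrow> \<bar>f t - f s - (t - s)\<bar> \<le> \<kappa> / 4) \<Longrightarrow>
      (\<And>t. t \<le> 0 \<Longrightarrow> f t \<le> t - R) \<Longrightarrow> False"
    have "\<kappa> / 4 > 0"
      using kappa by simp
    then obtain \<gamma>1 where \<gamma>1: "\<gamma>1 > 0" "\<And>p q v v'. p \<in> X \<Longrightarrow> q \<in> X \<Longrightarrow> \<bar>v\<bar> \<le> 2 \<Longrightarrow> \<bar>v - v'\<bar> \<le> \<tau> \<Longrightarrow> dist p q \<le> \<gamma>1 \<Longrightarrow>
      dist (\<phi> v p) (\<phi> v' q) \<le> \<gamma>1 \<Longrightarrow> \<bar>v - v'\<bar> < \<kappa> / 4"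
      using rigidity by metis
    have "min \<gamma> \<gamma>1 > 0"
      using \<gamma> \<gamma>1 by simp
    then obtain d where d: "d > 0" "\<And>x y u v. x \<in> X \<Longrightarrow> y \<in> X \<Longrightarrow> \<bar>u\<bar> \<le> 2 \<Longrightarrow> \<bar>v\<bar> \<le> 2 \<Longrightarrow> \<bar>u - v\<bar> \<le> d \<Longrightarrow> dist x y \<le> d
      \<Longrightarrow> dist (\<phi> u x) (\<phi> v y) \<le> min \<gamma> \<gamma>1"
      using flow_uniform by metis
    obtain g where g: "g > 0" "\<And>q v. q \<in> M \<Longrightarrow> \<tau> / 2 \<le> v \<Longrightarrow> v \<le> R \<Longrightarrow> dist (\<phi> v q) q > g"
      using no_bounded_returns[of R] by metis
    define \<gamma>2 where "\<gamma>2 = min d (min g \<epsilon>)"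
    have \<gamma>2: "\<gamma>2 > 0" "\<gamma>2 \<le> d" "\<gamma>2 \<le> g" "\<gamma>2 \<le> \<epsilon>"
      using d(1) g(1) eps by (auto simp: \<gamma>2_def)
    obtain N where N: "\<And>\<eta> \<zeta>. tracked N \<eta> \<zeta> \<Longrightarrow> \<exists>u. \<bar>u\<bar> \<le> \<tau> / 2 \<and> dist (\<zeta> 0) (\<phi> u (\<eta> 0)) \<le> \<gamma>2"
      using uniform_expansivity[OF \<gamma>2(1)] by metis
    \<comment> \<open>\<open>c\<close> is the sample time \<open>a i\<close> corrected by uniform
      expansivity. After the correction a delay of at most \<open>R\<close> would be a return closer
      than \<open>g\<close>.\<close>
    have "\<exists>c. dist (\<phi> (b i) x) (\<phi> c x) \<le> \<gamma>2 \<and> \<bar>c - a i\<bar> \<le> \<kappa> \<and> c < b i - R" if i: "i \<ge> N" for i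
    proof -
      have "tracked N (\<lambda>j. \<xi> (nat (int i - j))) (\<lambda>j. \<zeta> (nat (int i - j)))"
        unfolding tracked_def
      proof (intro conjI allI impI)
        fix j assume "- int N \<le> j \<and> j < int N"
        then have *: "nat (int i - j) = Suc (nat (int i - (j + 1)))"
          using i by linarith
        show "step (\<xi> (nat (int i - j))) (\<xi> (nat (int i - (j + 1))))" "step (\<zeta> (nat (int i - j))) (\<zeta> (nat (int i - (j + 1))))"
          unfolding * by (rule steps)+
      qed (use X close in auto)
      from N[OF this] obtain u where u: "\<bar>u\<bar> \<le> \<tau> / 2" "dist (\<zeta> i) (\<phi> u (\<xi> i)) \<le> \<gamma>2"
        by auto
      have "dist (\<phi> u (\<xi> i)) (\<xi> i) \<le> 3 * \<epsilon>"
        using u(2) close[of i] dist_triangle[of "\<phi> u (\<xi> i)" "\<xi> i" "\<zeta> i"] eps \<gamma>2(4) by (simp add: dist_commute)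
      then have uk: "\<bar>u\<bar> < \<kappa>"
        using short[of "\<xi> i" u] X u(1) \<tau>_pos by simp
      define c where "c = a i + u"
      have c: "dist (\<phi> (b i) x) (\<phi> c x) \<le> \<gamma>2"
        using u(2) x a(3)[of i] b(3)[of i] by (simp add: flow_flow c_def)
      have "c < b i - R"
      proof (rule ccontr)
        assume "\<not> c < b i - R"
        then have "\<tau> / 2 \<le> b i - c" "b i - c \<le> R"
          using Dlarge[of i] uk kappa by (auto simp: c_def D_def)
        from g(2)[OF M_inv[OF x(2), of c] this] c \<gamma>2(3) x show False
          by (simp add: flow_flow)
      qed
      with c uk show ?thesis
        by (intro exI[of _ c]) (simp add: c_def)
    qed
    then obtain c where c: "\<And>i. i \<ge> N \<Longrightarrow> dist (\<phi> (b i) x) (\<phi> (c i) x) \<le> \<gamma>2" "\<And>i. i \<ge> N \<Longrightarrow> \<bar>c i - a i\<bar> \<le> \<kappa>"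
      "\<And>i. i \<ge> N \<Longrightarrow> c i < b i - R"
      by metis
    have bdec: "b i - b (i + j) \<ge> 3 / 4 * j" for i j
    proof (induction j)
      case (Suc j)
      then show ?case
        using b(2)[of "i + j"] kappa by simp
    qed simp
    have "\<exists>i\<ge>N. b (Suc i) < T \<and> T \<le> b i" if T: "T \<le> b N" for T
    proof -
      define j where "j = nat \<lceil>2 * (b N - T)\<rceil>"
      have "2 * (b N - T) \<le> j"
        unfolding j_def by linarith
      then have "b (Suc (N + j)) < T"
        using bdec[where i=N and j="Suc j"] T by simp
      then have ex: "\<exists>j. b (Suc (N + j)) < T"
        by blast
      define k where "k = (LEAST j. b (Suc (N + j)) < T)"
      have k: "b (Suc (N + k)) < T"
        unfolding k_def using ex by (rule LeastI_ex)
      moreover have "T \<le> b (N + k)"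
      proof (cases k)
        case (Suc k')
        then have "\<not> b (Suc (N + k')) < T"
          using not_less_Least[of k' "\<lambda>j. b (Suc (N + j)) < T"] by (simp add: k_def)
        then show ?thesis
          by (simp add: Suc)
      qed (simp add: T)
      ultimately show ?thesis
        by (intro exI[of _ "N + k"]) simp
    qed
    then obtain I where I: "\<And>T. T \<le> b N \<Longrightarrow> I T \<ge> N" "\<And>T. T \<le> b N \<Longrightarrow> b (Suc (I T)) < T" "\<And>T. T \<le> b N \<Longrightarrow> T \<le> b (I T)"
      by metis
    \<comment> \<open>Time is counted from \<open>b N\<close>, and between two samples the delay is
      frozen at its value at the later one. The resulting \<open>f\<close> may jump;
      \<open>delay\<close> bounds the jumps by \<open>6 * \<kappa>\<close>, and rigidity reduces
      them to \<open>\<kappa> / 4\<close>.\<close>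
    define f where "f = (\<lambda>t. c (I (b N + t)) - b (I (b N + t)) + t)"
    define y where "y = \<phi> (b N) x"
    have y: "y \<in> M" "y \<in> X"
      using M_inv x by (simp_all add: y_def)
    have fclose: "dist (\<phi> t y) (\<phi> (f t) y) \<le> min \<gamma> \<gamma>1" if "t \<le> 0" for t
    proof -
      define T where "T = b N + t"
      have T: "T \<le> b N"
        using that by (simp add: T_def)
      define i where "i = I T"
      have i: "i \<ge> N" "b (Suc i) < T" "T \<le> b i"
        using I T by (auto simp: i_def)
      have "\<bar>T - b i\<bar> \<le> 2"
        using i b(2)[of i] kappa by linarith
      then have "dist (\<phi> (T - b i) (\<phi> (b i) x)) (\<phi> (T - b i) (\<phi> (c i) x)) \<le> min \<gamma> \<gamma>1"
        using c(1)[OF i(1)] \<gamma>2(2) d(1) x by (intro d(2)) auto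
      then show ?thesis
        using x by (simp add: y_def flow_flow f_def T_def[symmetric] i_def[symmetric]) (simp add: T_def algebra_simps)
    qed
    show False
    proof (rule core[OF y(1)])
      show "dist (\<phi> t y) (\<phi> (f t) y) \<le> \<gamma>" if "t \<le> 0" for t
        using fclose[OF that] by simp
      show "f t \<le> t - R" if "t \<le> 0" for t
        using c(3)[of "I (b N + t)"] I(1)[of "b N + t"] that by (simp add: f_def)
      have delay: "\<bar>(c i - b i) - (c j - b j)\<bar> \<le> 6 * \<kappa>" if ij: "i \<ge> N" "i \<le> j" "S \<le> b j" "b (Suc i) < T" "T - S \<le> 1" for i j S T
      proof -
        \<comment> \<open>A larger gap would leave two full steps between \<open>b (Suc i)\<close>
          and \<open>b j\<close>, a time of at least 3/2, although
          \<open>T - S \<le> 1\<close>.\<close>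
        have "j \<le> i + 2"
        proof (rule ccontr)
          assume "\<not> j \<le> i + 2"
          then obtain l where "j = Suc i + (2 + l)"
            by (metis add.commute add_2_eq_Suc less_iff_Suc_add not_le add_Suc_right add_Suc)
          then show False
            using bdec[where i="Suc i" and j="2 + l"] ij by simp
        qed
        then consider "j = i" | "j = Suc i" | "j = Suc (Suc i)"
          using ij(2) by linarith
        then have "\<bar>D i - D j\<bar> \<le> 4 * \<kappa>"
        proof cases
          case 1
          then show ?thesis
            using kappa(1) by simp
        next
          case 2
          then show ?thesis
            using Dstep[of i] kappa(1) by simp
        next
          case 3
          show ?thesis
            unfolding 3 using Dstep[of i] Dstep[of "Suc i"] by linarith
        qed
        then show ?thesis
          using c(2)[of i] c(2)[of j] ij unfolding D_def by linarith
      qed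
      show "\<bar>f t - f s - (t - s)\<bar> \<le> \<kappa> / 4" if st: "s \<le> 0" "t \<le> 0" "\<bar>s - t\<bar> \<le> 1" for s t
      proof -
        define i where "i = I (b N + t)"
        define j where "j = I (b N + s)"
        have i: "i \<ge> N" "b (Suc i) < b N + t" "b N + t \<le> b i" and j: "j \<ge> N" "b (Suc j) < b N + s" "b N + s \<le> b j"
          using I[of "b N + t"] I[of "b N + s"] st by (auto simp: i_def j_def)
        have "\<bar>(c i - b i) - (c j - b j)\<bar> \<le> 6 * \<kappa>"
        proof (cases "i \<le> j")
          case True
          then show ?thesis
            using delay[OF i(1) True j(3) i(2)] st by linarith
        next
          case False
          then show ?thesis
            using delay[OF j(1) _ i(3) j(2)] st by linarith
        qed
        then have "\<bar>(t - s) - (f t - f s)\<bar> \<le> \<tau>"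
          using kappa by (simp add: f_def i_def j_def abs_le_iff)
        moreover have "dist (\<phi> s y) (\<phi> (f s) y) \<le> \<gamma>1" "dist (\<phi> t y) (\<phi> (f t) y) \<le> \<gamma>1"
          using fclose st by auto
        ultimately have "\<bar>(t - s) - (f t - f s)\<bar> < \<kappa> / 4"
          using y st by (intro \<gamma>1(2)[of "\<phi> s y" "\<phi> (f s) y"]) (auto simp: flow_flow)
        then show ?thesis
          by linarith
      qed
    qed
  qed
qed

lemma no_tracking_of_translate:
  fixes \<xi> \<zeta> :: "nat \<Rightarrow> 'a"
  assumes xM: "\<xi> 0 \<in> M" and rho: "\<bar>\<rho>\<bar> > \<tau>" "\<zeta> 0 = \<phi> \<rho> (\<xi> 0)"
    and X: "\<And>i. \<xi> i \<in> X" "\<And>i. \<zeta> i \<in> X"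
    and steps: "\<And>i. step (\<xi> (Suc i)) (\<xi> i)" "\<And>i. step (\<zeta> (Suc i)) (\<zeta> i)"
    and close: "\<And>i. dist (\<xi> i) (\<zeta> i) \<le> \<epsilon>"
  shows False
proof (cases "\<rho> > \<tau>")
  case True
  then show ?thesis
    using no_tracking_of_translate_aux[of \<xi> \<rho> \<zeta>] assms by blast
next
  case False
  then have "- \<rho> > \<tau>"
    using rho by linarith
  moreover have "\<xi> 0 = \<phi> (- \<rho>) (\<zeta> 0)" "\<zeta> 0 \<in> M"
    using rho X M_inv xM by auto
  ultimately show ?thesis
    using no_tracking_of_translate_aux[of \<zeta> "- \<rho>" \<xi>] X steps close by (metis dist_commute)
qed

end

section \<open>Recent visits to a point of a minimal set\<close>

context exp_flow
begin

text \<open>Index 0 is exempt from closeness: a continuum that has just grown is large at present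
  and small only in the past. \<open>pre_history\<close> keeps this exemption,
  \<open>history\<close> adds smallness at present.\<close>

definition history_map :: "('a \<Rightarrow> nat \<Rightarrow> 'a) \<Rightarrow> nat \<Rightarrow> 'a set \<Rightarrow> bool" where
  "history_map \<xi> T C \<longleftrightarrow> (\<forall>y\<in>C. \<xi> y 0 = y \<and> (\<forall>i. \<xi> y i \<in> X) \<and> (\<forall>i<T. step (\<xi> y (Suc i)) (\<xi> y i)) \<and>
     (\<forall>z\<in>C. \<forall>i. 1 \<le> i \<and> i \<le> T \<longrightarrow> dist (\<xi> y i) (\<xi> z i) \<le> \<epsilon>))"

definition pre_history :: "nat \<Rightarrow> 'a set \<Rightarrow> bool" where
  "pre_history T C \<longleftrightarrow> (\<exists>\<xi>. history_map \<xi> T C)"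

definition history :: "nat \<Rightarrow> 'a set \<Rightarrow> bool" where
  "history T C \<longleftrightarrow> pre_history T C \<and> (\<forall>y\<in>C. \<forall>z\<in>C. dist y z \<le> \<epsilon>)"

lemma history_mapD:
  assumes "history_map \<xi> T C" "y \<in> C"
  shows "\<xi> y 0 = y" "\<xi> y i \<in> X" "i < T \<Longrightarrow> step (\<xi> y (Suc i)) (\<xi> y i)"
    "z \<in> C \<Longrightarrow> 1 \<le> i \<Longrightarrow> i \<le> T \<Longrightarrow> dist (\<xi> y i) (\<xi> z i) \<le> \<epsilon>"
  using assms unfolding history_map_def by blast+

lemma pre_history_mono:
  assumes "pre_history T C" "C' \<subseteq> C" "T' \<le> T"
  shows "pre_history T' C'"
proof -
  obtain \<xi> where "history_map \<xi> T C"
    using assms(1) unfolding pre_history_def by blast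
  then have "history_map \<xi> T' C'"
    using assms(2,3) unfolding history_map_def by (meson le_trans less_le_trans subsetD)
  then show ?thesis
    unfolding pre_history_def by blast
qed

lemma history_mono:
  assumes "history T C" "C' \<subseteq> C" "T' \<le> T"
  shows "history T' C'"
  using assms pre_history_mono[OF _ assms(2,3)] unfolding history_def by blast

lemma historyE:
  assumes "history T C" "y \<in> C" "z \<in> C"
  obtains \<eta> \<zeta> :: "nat \<Rightarrow> 'a" where "\<eta> 0 = y" "\<zeta> 0 = z" "\<And>i. \<eta> i \<in> X" "\<And>i. \<zeta> i \<in> X"
    "\<And>i. i < T \<Longrightarrow> step (\<eta> (Suc i)) (\<eta> i)" "\<And>i. i < T \<Longrightarrow> step (\<zeta> (Suc i)) (\<zeta> i)"
    "\<And>i. i \<le> T \<Longrightarrow> dist (\<eta> i) (\<zeta> i) \<le> \<epsilon>"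
proof -
  obtain \<xi> where \<xi>: "history_map \<xi> T C"
    using assms(1) unfolding history_def pre_history_def by blast
  note y = history_mapD[OF \<xi> assms(2)] and z = history_mapD[OF \<xi> assms(3)]
  have close: "dist (\<xi> y i) (\<xi> z i) \<le> \<epsilon>" if "i \<le> T" for i
  proof (cases "i = 0")
    case True
    then show ?thesis
      using y(1) z(1) assms unfolding history_def by simp
  next
    case False
    then show ?thesis
      using y(4)[OF assms(3)] that by simp
  qed
  show thesis
    by (rule that[OF y(1) z(1) y(2) z(2) y(3) z(3) close])
qed

text \<open>The recent visitors: \<open>q\<close> is the place of the visit and \<open>t\<close> the
  time elapsed since, at most \<open>W\<close>.\<close>

definition near :: "'a set \<Rightarrow> real \<Rightarrow> real \<Rightarrow> 'a set" where
  "near F \<rho> W = {\<phi> t q | t q. 0 \<le> t \<and> t \<le> W \<and> q \<in> X \<and> (\<exists>p\<in>F. dist p q \<le> \<rho>)}"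

lemma near_mono: "\<rho> \<le> \<rho>' \<Longrightarrow> near F \<rho> W \<subseteq> near F \<rho>' W"
  unfolding near_def by (blast intro: order_trans)

text \<open>The number of colours must be chosen before the time window \<open>W\<close> and the precision.\<close>

definition colourable :: "'a set \<Rightarrow> bool" where
  "colourable F \<longleftrightarrow> (\<exists>Q::nat. \<forall>W. \<forall>\<eta>>0. \<exists>\<rho>>0. \<exists>T. \<forall>w C. (\<forall>y\<in>C. (w, y) \<in> \<Sigma>) \<and> history T C \<longrightarrow>
     (\<exists>c::'a \<Rightarrow> nat. \<forall>y\<in>C \<inter> near F \<rho> W. c y < Q \<and> (\<forall>z\<in>C \<inter> near F \<rho> W. c y = c z \<longrightarrow> dist y z \<le> \<eta>)))"

lemma colourable_empty: "colourable {}"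
  unfolding colourable_def near_def by (intro exI[of _ 0] allI impI exI[of _ 1]) simp

lemma colourable_insert:
  assumes "colourable {p}" "colourable F"
  shows "colourable (insert p F)"
proof -
  obtain Q1 where Q1: "\<And>W \<eta>. \<eta> > 0 \<Longrightarrow> \<exists>\<rho>>0. \<exists>T. \<forall>w C. (\<forall>y\<in>C. (w, y) \<in> \<Sigma>) \<and> history T C \<longrightarrow>
     (\<exists>c::'a \<Rightarrow> nat. \<forall>y\<in>C \<inter> near {p} \<rho> W. c y < Q1 \<and> (\<forall>z\<in>C \<inter> near {p} \<rho> W. c y = c z \<longrightarrow> dist y z \<le> \<eta>))"
    using assms(1) unfolding colourable_def by blast
  obtain Q2 where Q2: "\<And>W \<eta>. \<eta> > 0 \<Longrightarrow> \<exists>\<rho>>0. \<exists>T. \<forall>w C. (\<forall>y\<in>C. (w, y) \<in> \<Sigma>) \<and> history T C \<longrightarrow>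
     (\<exists>c::'a \<Rightarrow> nat. \<forall>y\<in>C \<inter> near F \<rho> W. c y < Q2 \<and> (\<forall>z\<in>C \<inter> near F \<rho> W. c y = c z \<longrightarrow> dist y z \<le> \<eta>))"
    using assms(2) unfolding colourable_def by blast
  show ?thesis
    unfolding colourable_def
  proof (intro exI[of _ "Q1 + Q2"] allI impI)
    fix W \<eta> :: real assume "\<eta> > 0"
    obtain \<rho>1 T1 where 1: "\<rho>1 > 0" "\<And>w C. (\<forall>y\<in>C. (w, y) \<in> \<Sigma>) \<and> history T1 C \<Longrightarrow>
     \<exists>c::'a \<Rightarrow> nat. \<forall>y\<in>C \<inter> near {p} \<rho>1 W. c y < Q1 \<and> (\<forall>z\<in>C \<inter> near {p} \<rho>1 W. c y = c z \<longrightarrow> dist y z \<le> \<eta>)"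
      using Q1[OF \<open>\<eta> > 0\<close>, of W] by blast
    obtain \<rho>2 T2 where 2: "\<rho>2 > 0" "\<And>w C. (\<forall>y\<in>C. (w, y) \<in> \<Sigma>) \<and> history T2 C \<Longrightarrow>
     \<exists>c::'a \<Rightarrow> nat. \<forall>y\<in>C \<inter> near F \<rho>2 W. c y < Q2 \<and> (\<forall>z\<in>C \<inter> near F \<rho>2 W. c y = c z \<longrightarrow> dist y z \<le> \<eta>)"
      using Q2[OF \<open>\<eta> > 0\<close>, of W] by blast
    define \<rho> where "\<rho> = min \<rho>1 \<rho>2"
    have near: "near {p} \<rho> W \<subseteq> near {p} \<rho>1 W" "near F \<rho> W \<subseteq> near F \<rho>2 W"
      by (simp_all add: near_mono \<rho>_def)
    have un: "near (insert p F) \<rho> W = near {p} \<rho> W \<union> near F \<rho> W"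
      unfolding near_def by blast
    have "\<exists>c::'a \<Rightarrow> nat. \<forall>y\<in>C \<inter> near (insert p F) \<rho> W. c y < Q1 + Q2 \<and>
        (\<forall>z\<in>C \<inter> near (insert p F) \<rho> W. c y = c z \<longrightarrow> dist y z \<le> \<eta>)"
      if C: "\<forall>y\<in>C. (w, y) \<in> \<Sigma>" "history (max T1 T2) C" for w C
    proof -
      have "history T1 C" "history T2 C"
        using history_mono[OF C(2) subset_refl] by auto
      then obtain c1 c2 :: "'a \<Rightarrow> nat" where
        c1: "\<forall>y\<in>C \<inter> near {p} \<rho>1 W. c1 y < Q1 \<and> (\<forall>z\<in>C \<inter> near {p} \<rho>1 W. c1 y = c1 z \<longrightarrow> dist y z \<le> \<eta>)" and
        c2: "\<forall>y\<in>C \<inter> near F \<rho>2 W. c2 y < Q2 \<and> (\<forall>z\<in>C \<inter> near F \<rho>2 W. c2 y = c2 z \<longrightarrow> dist y z \<le> \<eta>)"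
        using 1(2)[of C w] 2(2)[of C w] C(1) by metis
      \<comment> \<open>The palettes are made disjoint by shifting the second one by
        \<open>Q1\<close>, so equal colours always come from the same palette.\<close>
      define c where "c = (\<lambda>y. if y \<in> near {p} \<rho> W then c1 y else Q1 + c2 y)"
      show ?thesis
      proof (intro exI[of _ c] ballI conjI impI)
        fix y assume y: "y \<in> C \<inter> near (insert p F) \<rho> W"
        show "c y < Q1 + Q2"
        proof (cases "y \<in> near {p} \<rho> W")
          case True
          then have "c1 y < Q1"
            using c1 y near by blast
          with True show ?thesis
            by (simp add: c_def)
        next
          case False
          then have "c2 y < Q2"
            using c2 y near un by blast
          with False show ?thesis
            by (simp add: c_def)
        qed
        fix z assume z: "z \<in> C \<inter> near (insert p F) \<rho> W" and eq: "c y = c z"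
        have lt: "c1 v < Q1" if "v \<in> C \<inter> near {p} \<rho> W" for v
          using c1 near that by blast
        consider "y \<in> near {p} \<rho> W" "z \<in> near {p} \<rho> W" | "y \<notin> near {p} \<rho> W" "z \<notin> near {p} \<rho> W"
          using eq y z lt[of y] lt[of z] unfolding c_def by (force split: if_splits)
        then show "dist y z \<le> \<eta>"
        proof cases
          case 1
          then have "c1 y = c1 z"
            using eq by (simp add: c_def)
          then show ?thesis
            using c1 1 y z near by blast
        next
          case 2
          then have "c2 y = c2 z"
            using eq by (simp add: c_def)
          then show ?thesis
            using c2 2 y z near un by blast
        qed
      qed
    qed
    then show "\<exists>\<rho>>0. \<exists>T. \<forall>w C. (\<forall>y\<in>C. (w, y) \<in> \<Sigma>) \<and> history T C \<longrightarrow>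
       (\<exists>c::'a \<Rightarrow> nat. \<forall>y\<in>C \<inter> near (insert p F) \<rho> W. c y < Q1 + Q2 \<and>
          (\<forall>z\<in>C \<inter> near (insert p F) \<rho> W. c y = c z \<longrightarrow> dist y z \<le> \<eta>))"
      using 1(1) 2(1) by (intro exI[of _ \<rho>] conjI exI[of _ "max T1 T2"] allI impI) (auto simp: \<rho>_def)
  qed
qed

lemma seq_compact_real: 
  fixes t :: "nat \<Rightarrow> real"
  assumes "\<And>n. t n \<in> {a..b}"
  obtains s l where "strict_mono (s :: nat \<Rightarrow> nat)" "l \<in> {a..b}" "(\<lambda>n. t (s n)) \<longlonglongrightarrow> l"
  using compact_Icc[of a b] assms unfolding compact_eq_seq_compact_metric seq_compact_def comp_def by metis

section \<open>Colouring the visitors of a periodic point and of an aperiodic minimal set\<close>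

lemma flow_mod_period:
  assumes p: "p \<in> X" and P: "\<phi> P p = p"
  shows "\<phi> (t - P * \<lfloor>t / P\<rfloor>) p = \<phi> t p"
proof -
    have nat_mult: "\<phi> (real k * P) p = p" for k :: nat
    proof (induction k)
      case (Suc k)
      have "\<phi> (real (Suc k) * P) p = \<phi> P (\<phi> (real k * P) p)"
        using p by (simp add: flow_flow algebra_simps)
      then show ?case
        using Suc P by simp
    qed (use p in simp)
    have int_mult: "\<phi> (- (of_int k * P)) p = p" for k :: int
    proof (cases "k \<ge> 0")
      case True
      then have "\<phi> (of_int k * P) p = p"
        using nat_mult[of "nat k"] by simp
      then show ?thesis
        using p by (metis flow_inverse(1))
    next
      case False
      then show ?thesis
        using nat_mult[of "nat (- k)"] by simp
    qed
    have "\<phi> (t - P * \<lfloor>t / P\<rfloor>) p = \<phi> t (\<phi> (- (of_int \<lfloor>t / P\<rfloor> * P)) p)"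
      using p by (simp add: flow_flow algebra_simps)
    then show ?thesis
      by (simp only: int_mult)
  qed

text \<open>The colour is the time since the visit, taken modulo \<open>P\<close> and rounded to
  slots of length \<open>\<tau>\<close>. As \<open>\<rho>\<close> tends to 0, two visitors of equal
  colour on one section converge to points of the orbit of \<open>p\<close> on one section that
  differ by a time at most \<open>\<tau>\<close>, hence to the same point. The number of slots
  depends only on \<open>P\<close> and \<open>\<tau>\<close>, not on \<open>W\<close>.\<close>

lemma colourable_periodic:
  assumes p: "p \<in> X" and P: "P > 0" "\<phi> P p = p"
  shows "colourable {p}"
proof -
  note per = flow_mod_period[OF p P(2)]
  define \<theta> where "\<theta> = (\<lambda>t. t - P * \<lfloor>t / P\<rfloor>)"
  have \<theta>: "\<theta> t \<in> {0..P}" for t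
  proof -
    have "P * \<lfloor>t / P\<rfloor> \<le> P * (t / P)" "P * (t / P) \<le> P * (\<lfloor>t / P\<rfloor> + 1)"
      using P(1) by (intro mult_left_mono; linarith)+
    then show ?thesis
      using P(1) by (simp add: \<theta>_def algebra_simps)
  qed
  have main: "\<exists>\<rho>>0. \<forall>w y z t t' q q'. (w, y) \<in> \<Sigma> \<and> (w, z) \<in> \<Sigma> \<and> t \<in> {0..W} \<and> t' \<in> {0..W} \<and> q \<in> X \<and> q' \<in> X \<and>
      dist p q \<le> \<rho> \<and> dist p q' \<le> \<rho> \<and> y = \<phi> t q \<and> z = \<phi> t' q' \<and> \<bar>\<theta> t - \<theta> t'\<bar> \<le> \<tau> \<longrightarrow> dist y z \<le> \<eta>"
    if "\<eta> > 0" for W \<eta>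
  proof (rule ccontr)
    assume neg: "\<not> ?thesis"
    have "\<exists>w y z t t' q q'. (w, y) \<in> \<Sigma> \<and> (w, z) \<in> \<Sigma> \<and> t \<in> {0..W} \<and> t' \<in> {0..W} \<and> q \<in> X \<and> q' \<in> X \<and>
      dist p q \<le> 1 / Suc n \<and> dist p q' \<le> 1 / Suc n \<and> y = \<phi> t q \<and> z = \<phi> t' q' \<and> \<bar>\<theta> t - \<theta> t'\<bar> \<le> \<tau> \<and> \<not> dist y z \<le> \<eta>" for n
      using neg by (metis zero_less_divide_1_iff of_nat_0_less_iff zero_less_Suc)
    then obtain w y z t t' q q' where *: "\<And>n. (w n, y n) \<in> \<Sigma>" "\<And>n. (w n, z n) \<in> \<Sigma>" "\<And>n. t n \<in> {0..W}" "\<And>n. t' n \<in> {0..W}"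
      "\<And>n. q n \<in> X" "\<And>n. q' n \<in> X" "\<And>n. dist p (q n) \<le> 1 / Suc n" "\<And>n. dist p (q' n) \<le> 1 / Suc n"
      "\<And>n. y n = \<phi> (t n) (q n)" "\<And>n. z n = \<phi> (t' n) (q' n)" "\<And>n. \<bar>\<theta> (t n) - \<theta> (t' n)\<bar> \<le> \<tau>" "\<And>n. \<not> dist (y n) (z n) \<le> \<eta>"
      by metis
    have conv: "q \<longlonglongrightarrow> p" "q' \<longlonglongrightarrow> p"
      using *(7,8) by (auto intro!: metric_tendsto_imp_tendsto[OF LIMSEQ_inverse_real_of_nat] always_eventually
        simp: dist_commute inverse_eq_divide)
    obtain s1 w' where s1: "strict_mono (s1 :: nat \<Rightarrow> nat)" "(\<lambda>n. w (s1 n)) \<longlonglongrightarrow> w'"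
      using X_subseq[of w] *(1) sec_in by metis
    obtain s2 a where s2: "strict_mono (s2 :: nat \<Rightarrow> nat)" "(\<lambda>n. t (s1 (s2 n))) \<longlonglongrightarrow> a"
      using seq_compact_real[of "\<lambda>n. t (s1 n)" 0 W] *(3) by metis
    obtain s3 a' where s3: "strict_mono (s3 :: nat \<Rightarrow> nat)" "(\<lambda>n. t' (s1 (s2 (s3 n)))) \<longlonglongrightarrow> a'"
      using seq_compact_real[of "\<lambda>n. t' (s1 (s2 n))" 0 W] *(4) by metis
    \<comment> \<open>\<open>\<theta>\<close> is discontinuous, so the phases get limits of their
      own. These represent the same limit points, since \<open>t\<close> and
      \<open>\<theta> t\<close> move \<open>p\<close> to the same place.\<close>
    obtain s4 b where s4: "strict_mono (s4 :: nat \<Rightarrow> nat)" "(\<lambda>n. \<theta> (t (s1 (s2 (s3 (s4 n)))))) \<longlonglongrightarrow> b"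
      using seq_compact_real[of "\<lambda>n. \<theta> (t (s1 (s2 (s3 n))))" 0 P] \<theta> by metis
    obtain s5 b' where s5: "strict_mono (s5 :: nat \<Rightarrow> nat)" "(\<lambda>n. \<theta> (t' (s1 (s2 (s3 (s4 (s5 n))))))) \<longlonglongrightarrow> b'"
      using seq_compact_real[of "\<lambda>n. \<theta> (t' (s1 (s2 (s3 (s4 n)))))" 0 P] \<theta> by metis
    define s where "s = (\<lambda>n. s1 (s2 (s3 (s4 (s5 n)))))"
    have sm: "strict_mono s" "strict_mono (\<lambda>n. s2 (s3 (s4 (s5 n))))" "strict_mono (\<lambda>n. s3 (s4 (s5 n)))" "strict_mono (\<lambda>n. s4 (s5 n))"
      using s1(1) s2(1) s3(1) s4(1) s5(1) unfolding s_def strict_mono_def by auto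
    have lim: "(\<lambda>n. w (s n)) \<longlonglongrightarrow> w'" "(\<lambda>n. t (s n)) \<longlonglongrightarrow> a" "(\<lambda>n. t' (s n)) \<longlonglongrightarrow> a'"
      "(\<lambda>n. \<theta> (t (s n))) \<longlonglongrightarrow> b" "(\<lambda>n. \<theta> (t' (s n))) \<longlonglongrightarrow> b'" "(\<lambda>n. q (s n)) \<longlonglongrightarrow> p" "(\<lambda>n. q' (s n)) \<longlonglongrightarrow> p"
      using LIMSEQ_subseq_LIMSEQ[OF s1(2) sm(2)] LIMSEQ_subseq_LIMSEQ[OF s2(2) sm(3)] LIMSEQ_subseq_LIMSEQ[OF s3(2) sm(4)]
        LIMSEQ_subseq_LIMSEQ[OF s4(2) s5(1)] s5(2) LIMSEQ_subseq_LIMSEQ[OF conv(1) sm(1)] LIMSEQ_subseq_LIMSEQ[OF conv(2) sm(1)]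
      unfolding s_def comp_def by simp_all
    have "(\<lambda>n. y (s n)) \<longlonglongrightarrow> \<phi> a p" "(\<lambda>n. z (s n)) \<longlonglongrightarrow> \<phi> a' p"
      unfolding *(9,10) using *(5,6) p lim by (auto intro!: tendsto_flow)
    moreover have "\<phi> a p = \<phi> b p"
    proof (rule LIMSEQ_unique)
      show "(\<lambda>n. \<phi> (t (s n)) p) \<longlonglongrightarrow> \<phi> a p"
        using p lim by (intro tendsto_flow) auto
      have "(\<lambda>n. \<phi> (\<theta> (t (s n))) p) \<longlonglongrightarrow> \<phi> b p"
        using p lim by (intro tendsto_flow) auto
      then show "(\<lambda>n. \<phi> (t (s n)) p) \<longlonglongrightarrow> \<phi> b p"
        by (simp add: \<theta>_def per)
    qed
    moreover have "\<phi> a' p = \<phi> b' p"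
    proof (rule LIMSEQ_unique)
      show "(\<lambda>n. \<phi> (t' (s n)) p) \<longlonglongrightarrow> \<phi> a' p"
        using p lim by (intro tendsto_flow) auto
      have "(\<lambda>n. \<phi> (\<theta> (t' (s n))) p) \<longlonglongrightarrow> \<phi> b' p"
        using p lim by (intro tendsto_flow) auto
      then show "(\<lambda>n. \<phi> (t' (s n)) p) \<longlonglongrightarrow> \<phi> b' p"
        by (simp add: \<theta>_def per)
    qed
    ultimately have yz: "(\<lambda>n. y (s n)) \<longlonglongrightarrow> \<phi> b p" "(\<lambda>n. z (s n)) \<longlonglongrightarrow> \<phi> b' p"
      by simp_all
    have "(w', \<phi> b p) \<in> \<Sigma>" "(w', \<phi> b' p) \<in> \<Sigma>"
      using sec_limit[OF _ lim(1) yz(1)] sec_limit[OF _ lim(1) yz(2)] *(1,2) by blast+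
    moreover have "\<bar>b - b'\<bar> \<le> \<tau>"
      by (rule tendsto_upperbound[OF tendsto_rabs[OF tendsto_diff[OF lim(4,5)]]]) (simp_all add: *(11))
    moreover have "\<phi> b p = \<phi> (b - b') (\<phi> b' p)"
      using p by (simp add: flow_flow)
    ultimately have "b - b' = 0"
      using sec_unique[of w' "\<phi> b' p" "b - b'"] by simp
    then have "(\<lambda>n. dist (y (s n)) (z (s n))) \<longlonglongrightarrow> 0"
      using tendsto_dist[OF yz] by simp
    then have "\<forall>\<^sub>F n in sequentially. dist (y (s n)) (z (s n)) < \<eta>"
      using \<open>\<eta> > 0\<close> by (rule order_tendstoD)
    then obtain n where "dist (y (s n)) (z (s n)) < \<eta>"
      by (auto simp: eventually_sequentially)
    with *(12)[of "s n"] show False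
      by simp
  qed
  show ?thesis
    unfolding colourable_def
  proof (intro exI[of _ "nat \<lfloor>P / \<tau>\<rfloor> + 1"] allI impI)
    fix W \<eta> :: real assume "\<eta> > 0"
    obtain \<rho> where \<rho>: "\<rho> > 0" "\<And>w y z t t' q q'. (w, y) \<in> \<Sigma> \<and> (w, z) \<in> \<Sigma> \<and> t \<in> {0..W} \<and> t' \<in> {0..W} \<and> q \<in> X \<and> q' \<in> X \<and>
      dist p q \<le> \<rho> \<and> dist p q' \<le> \<rho> \<and> y = \<phi> t q \<and> z = \<phi> t' q' \<and> \<bar>\<theta> t - \<theta> t'\<bar> \<le> \<tau> \<Longrightarrow> dist y z \<le> \<eta>"
      using main[OF \<open>\<eta> > 0\<close>, of W] by metis
    have "\<forall>y\<in>near {p} \<rho> W. \<exists>t q. t \<in> {0..W} \<and> q \<in> X \<and> dist p q \<le> \<rho> \<and> y = \<phi> t q"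
      unfolding near_def by auto
    then obtain t q where tq: "\<And>y. y \<in> near {p} \<rho> W \<Longrightarrow> t y \<in> {0..W} \<and> q y \<in> X \<and> dist p (q y) \<le> \<rho> \<and> y = \<phi> (t y) (q y)"
      by metis
    define c where "c = (\<lambda>y. nat \<lfloor>\<theta> (t y) / \<tau>\<rfloor>)"
    have c_bound: "c y < nat \<lfloor>P / \<tau>\<rfloor> + 1" for y
    proof -
      have "\<theta> (t y) / \<tau> \<le> P / \<tau>"
        using \<theta>[of "t y"] \<tau>_pos by (simp add: divide_right_mono)
      then show ?thesis
        unfolding c_def by (simp add: floor_mono nat_mono le_imp_less_Suc)
    qed
    have c_eq: "dist y z \<le> \<eta>" if "(w, y) \<in> \<Sigma>" "(w, z) \<in> \<Sigma>" "y \<in> near {p} \<rho> W" "z \<in> near {p} \<rho> W" "c y = c z" for w y z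
    proof -
      have "0 \<le> \<theta> (t y) / \<tau>" "0 \<le> \<theta> (t z) / \<tau>"
        using \<theta> \<tau>_pos by auto
      then have "\<lfloor>\<theta> (t y) / \<tau>\<rfloor> = \<lfloor>\<theta> (t z) / \<tau>\<rfloor>"
        using that(5) unfolding c_def by (simp add: eq_nat_nat_iff)
      then have "\<bar>\<theta> (t y) / \<tau> - \<theta> (t z) / \<tau>\<bar> \<le> 1"
        by linarith
      then have "\<bar>(\<theta> (t y) - \<theta> (t z)) / \<tau>\<bar> \<le> 1"
        by (simp add: diff_divide_distrib)
      then have "\<bar>\<theta> (t y) - \<theta> (t z)\<bar> \<le> \<tau>"
        using \<tau>_pos by (simp add: abs_divide)
      then show ?thesis
        using tq[OF that(3)] tq[OF that(4)] that(1,2) by (intro \<rho>(2)[of w y z "t y" "t z" "q y" "q z"]) auto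
    qed
    show "\<exists>\<rho>>0. \<exists>T. \<forall>w C. (\<forall>y\<in>C. (w, y) \<in> \<Sigma>) \<and> history T C \<longrightarrow>
       (\<exists>c::'a \<Rightarrow> nat. \<forall>y\<in>C \<inter> near {p} \<rho> W. c y < nat \<lfloor>P / \<tau>\<rfloor> + 1 \<and> (\<forall>z\<in>C \<inter> near {p} \<rho> W. c y = c z \<longrightarrow> dist y z \<le> \<eta>))"
    proof (intro exI[of _ \<rho>] conjI exI[of _ 0] allI impI exI[of _ c] ballI)
      fix w C y z
      assume "(\<forall>y\<in>C. (w, y) \<in> \<Sigma>) \<and> history 0 C" "y \<in> C \<inter> near {p} \<rho> W" "z \<in> C \<inter> near {p} \<rho> W" "c y = c z"
      then show "dist y z \<le> \<eta>"
        by (intro c_eq[of w]) auto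
    qed (rule \<rho>(1) c_bound)+
  qed
qed

end

text \<open>One colour suffices. Visitors that stay apart on a common section while their histories
  lengthen would converge to two points of the orbit of \<open>p\<close>, more than
  \<open>\<tau>\<close> apart in time by \<open>sec_unique\<close>, with \<epsilon>-close backward
  paths; \<open>no_tracking_of_translate\<close> forbids this.\<close>

lemma (in aperiodic_set) colourable_aperiodic:
  assumes p: "p \<in> M"
  shows "colourable {p}"
proof -
  have pX: "p \<in> X"
    using p M_sub by blast
  have main: "\<exists>\<rho>>0. \<exists>T. \<forall>w y z C. (w, y) \<in> \<Sigma> \<and> (w, z) \<in> \<Sigma> \<and> history T C \<and> y \<in> C \<inter> near {p} \<rho> W \<and> z \<in> C \<inter> near {p} \<rho> W
     \<longrightarrow> dist y z \<le> \<eta>"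
    if "\<eta> > 0" for W \<eta>
  proof (rule ccontr)
    assume neg: "\<not> ?thesis"
    have "\<exists>w y z C. (w, y) \<in> \<Sigma> \<and> (w, z) \<in> \<Sigma> \<and> history n C \<and> y \<in> C \<inter> near {p} (1 / Suc n) W \<and> z \<in> C \<inter> near {p} (1 / Suc n) W
       \<and> \<not> dist y z \<le> \<eta>" for n
      using neg by (metis zero_less_divide_1_iff of_nat_0_less_iff zero_less_Suc)
    then obtain w y z C where *: "\<And>n. (w n, y n) \<in> \<Sigma>" "\<And>n. (w n, z n) \<in> \<Sigma>" "\<And>n. history n (C n)"
      "\<And>n. y n \<in> C n \<inter> near {p} (1 / Suc n) W" "\<And>n. z n \<in> C n \<inter> near {p} (1 / Suc n) W" "\<And>n. \<not> dist (y n) (z n) \<le> \<eta>"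
      by metis
    have "\<exists>t q. t \<in> {0..W} \<and> q \<in> X \<and> dist p q \<le> 1 / Suc n \<and> y n = \<phi> t q" for n
      using *(4)[of n] unfolding near_def by auto
    then obtain t q where tq: "\<And>n. t n \<in> {0..W}" "\<And>n. q n \<in> X" "\<And>n. dist p (q n) \<le> 1 / Suc n" "\<And>n. y n = \<phi> (t n) (q n)"
      by metis
    have "\<exists>t q. t \<in> {0..W} \<and> q \<in> X \<and> dist p q \<le> 1 / Suc n \<and> z n = \<phi> t q" for n
      using *(5)[of n] unfolding near_def by auto
    then obtain t' q' where tq': "\<And>n. t' n \<in> {0..W}" "\<And>n. q' n \<in> X" "\<And>n. dist p (q' n) \<le> 1 / Suc n" "\<And>n. z n = \<phi> (t' n) (q' n)"
      by metis
    have conv: "q \<longlonglongrightarrow> p" "q' \<longlonglongrightarrow> p"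
      using tq(3) tq'(3) by (auto intro!: metric_tendsto_imp_tendsto[OF LIMSEQ_inverse_real_of_nat] always_eventually
        simp: dist_commute inverse_eq_divide)
    have "\<exists>\<eta> \<zeta> :: nat \<Rightarrow> 'a. \<eta> 0 = y n \<and> \<zeta> 0 = z n \<and> (\<forall>i. \<eta> i \<in> X) \<and> (\<forall>i. \<zeta> i \<in> X) \<and>
      (\<forall>i<n. step (\<eta> (Suc i)) (\<eta> i)) \<and> (\<forall>i<n. step (\<zeta> (Suc i)) (\<zeta> i)) \<and> (\<forall>i\<le>n. dist (\<eta> i) (\<zeta> i) \<le> \<epsilon>)" for n
    proof -
      have "y n \<in> C n" "z n \<in> C n"
        using *(4)[of n] *(5)[of n] by auto
      from historyE[OF *(3) this] show ?thesis
        by metis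
    qed
    then obtain \<xi> \<zeta> :: "nat \<Rightarrow> nat \<Rightarrow> 'a" where paths: "\<And>n. \<xi> n 0 = y n" "\<And>n. \<zeta> n 0 = z n" "\<And>n i. \<xi> n i \<in> X" "\<And>n i. \<zeta> n i \<in> X"
      "\<And>n i. i < n \<Longrightarrow> step (\<xi> n (Suc i)) (\<xi> n i)" "\<And>n i. i < n \<Longrightarrow> step (\<zeta> n (Suc i)) (\<zeta> n i)"
      "\<And>n i. i \<le> n \<Longrightarrow> dist (\<xi> n i) (\<zeta> n i) \<le> \<epsilon>"
      by metis
    obtain s1 l m where s1: "strict_mono (s1 :: nat \<Rightarrow> nat)" "\<And>i. l i \<in> X" "\<And>i. m i \<in> X"
      "\<And>i. (\<lambda>n. \<xi> (s1 n) i) \<longlonglongrightarrow> l i" "\<And>i. (\<lambda>n. \<zeta> (s1 n) i) \<longlonglongrightarrow> m i"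
      using two_path_limit[of \<xi> \<zeta>] paths(3,4) by metis
    obtain s2 a where s2: "strict_mono (s2 :: nat \<Rightarrow> nat)" "(\<lambda>n. t (s1 (s2 n))) \<longlonglongrightarrow> a"
      using seq_compact_real[of "\<lambda>n. t (s1 n)" 0 W] tq(1) by metis
    obtain s3 a' where s3: "strict_mono (s3 :: nat \<Rightarrow> nat)" "(\<lambda>n. t' (s1 (s2 (s3 n)))) \<longlonglongrightarrow> a'"
      using seq_compact_real[of "\<lambda>n. t' (s1 (s2 n))" 0 W] tq'(1) by metis
    obtain s4 w' where s4: "strict_mono (s4 :: nat \<Rightarrow> nat)" "(\<lambda>n. w (s1 (s2 (s3 (s4 n))))) \<longlonglongrightarrow> w'"
      using X_subseq[of "\<lambda>n. w (s1 (s2 (s3 n)))"] *(1) sec_in by metis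
    define s where "s = (\<lambda>n. s1 (s2 (s3 (s4 n))))"
    have sm: "strict_mono s" "strict_mono (\<lambda>n. s2 (s3 (s4 n)))" "strict_mono (\<lambda>n. s3 (s4 n))"
      using s1(1) s2(1) s3(1) s4(1) unfolding s_def strict_mono_def by auto
    have lim: "(\<lambda>n. w (s n)) \<longlonglongrightarrow> w'" "(\<lambda>n. t (s n)) \<longlonglongrightarrow> a" "(\<lambda>n. t' (s n)) \<longlonglongrightarrow> a'"
      "(\<lambda>n. q (s n)) \<longlonglongrightarrow> p" "(\<lambda>n. q' (s n)) \<longlonglongrightarrow> p"
      using s4(2) LIMSEQ_subseq_LIMSEQ[OF s2(2) sm(3)] LIMSEQ_subseq_LIMSEQ[OF s3(2) s4(1)]
        LIMSEQ_subseq_LIMSEQ[OF conv(1) sm(1)] LIMSEQ_subseq_LIMSEQ[OF conv(2) sm(1)]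
      unfolding s_def comp_def by simp_all
    have limp: "(\<lambda>n. \<xi> (s n) i) \<longlonglongrightarrow> l i" "(\<lambda>n. \<zeta> (s n) i) \<longlonglongrightarrow> m i" for i
      using LIMSEQ_subseq_LIMSEQ[OF s1(4) sm(2)] LIMSEQ_subseq_LIMSEQ[OF s1(5) sm(2)] unfolding s_def comp_def by simp_all
    have "(\<lambda>n. \<xi> (s n) 0) \<longlonglongrightarrow> \<phi> a p" "(\<lambda>n. \<zeta> (s n) 0) \<longlonglongrightarrow> \<phi> a' p"
      unfolding paths(1,2) tq(4) tq'(4) using tq(2) tq'(2) pX lim by (auto intro!: tendsto_flow)
    then have l0: "l 0 = \<phi> a p" "m 0 = \<phi> a' p"
      using limp[of 0] LIMSEQ_unique by blast+
    have sec: "(w', l 0) \<in> \<Sigma>" "(w', m 0) \<in> \<Sigma>"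
    proof -
      have "(w (s n), \<xi> (s n) 0) \<in> \<Sigma>" "(w (s n), \<zeta> (s n) 0) \<in> \<Sigma>" for n
        using *(1,2) by (simp_all add: paths)
      then show "(w', l 0) \<in> \<Sigma>" "(w', m 0) \<in> \<Sigma>"
        using sec_limit[OF _ lim(1) limp(1)[of 0]] sec_limit[OF _ lim(1) limp(2)[of 0]] by blast+
    qed
    have m0: "m 0 = \<phi> (a' - a) (l 0)"
      using l0 pX by (simp add: flow_flow)
    have large: "\<forall>\<^sub>F n in sequentially. i < s n" for i
    proof -
      have "\<forall>\<^sub>F n in sequentially. Suc i \<le> s n"
        using filterlim_subseq[OF sm(1)] by (simp add: filterlim_at_top)
      then show ?thesis
        by eventually_elim simp
    qed
    have "\<eta> \<le> dist (l 0) (m 0)"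
      by (rule tendsto_lowerbound[OF tendsto_dist[OF limp(1)[of 0] limp(2)[of 0]]])
        (use *(6) in \<open>auto simp: paths not_le less_imp_le\<close>)
    then have "l 0 \<noteq> m 0"
      using \<open>\<eta> > 0\<close> by auto
    then have "\<bar>a' - a\<bar> > \<tau>"
      using sec_unique[of w' "l 0" "a' - a"] sec m0 s1(2)[of 0] by force
    moreover have "l 0 \<in> M"
      using l0 p M_inv by simp
    moreover have "step (l (Suc i)) (l i)" for i
      by (rule step_limit[OF _ limp(1) limp(1)], rule paths, rule eventually_mono[OF large[of i]], rule paths)
    moreover have "step (m (Suc i)) (m i)" for i
      by (rule step_limit[OF _ limp(2) limp(2)], rule paths, rule eventually_mono[OF large[of i]], rule paths)
    moreover have "dist (l i) (m i) \<le> \<epsilon>" for i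
      by (rule tendsto_upperbound[OF tendsto_dist[OF limp(1)[of i] limp(2)[of i]]], rule eventually_mono[OF large[of i]], rule paths) auto
    ultimately show False
      using no_tracking_of_translate[of l "a' - a" m] m0 s1(2,3) by blast
  qed
  show ?thesis
    unfolding colourable_def
  proof (intro exI[of _ "1::nat"] allI impI)
    fix W \<eta> :: real assume "\<eta> > 0"
    obtain \<rho> T where \<rho>: "\<rho> > 0" "\<And>w y z C. (w, y) \<in> \<Sigma> \<and> (w, z) \<in> \<Sigma> \<and> history T C \<and> y \<in> C \<inter> near {p} \<rho> W \<and> z \<in> C \<inter> near {p} \<rho> W
     \<Longrightarrow> dist y z \<le> \<eta>"
      using main[OF \<open>\<eta> > 0\<close>, of W] by metis
    show "\<exists>\<rho>>0. \<exists>T. \<forall>w C. (\<forall>y\<in>C. (w, y) \<in> \<Sigma>) \<and> history T C \<longrightarrow>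
       (\<exists>c::'a \<Rightarrow> nat. \<forall>y\<in>C \<inter> near {p} \<rho> W. c y < 1 \<and> (\<forall>z\<in>C \<inter> near {p} \<rho> W. c y = c z \<longrightarrow> dist y z \<le> \<eta>))"
    proof (rule exI[of _ \<rho>], intro conjI exI[of _ T] allI impI)
      fix w C
      assume "(\<forall>y\<in>C. (w, y) \<in> \<Sigma>) \<and> history T C"
      then have "dist y z \<le> \<eta>" if "y \<in> C \<inter> near {p} \<rho> W" "z \<in> C \<inter> near {p} \<rho> W" for y z
        using that by (intro \<rho>(2)[of w y z C]) auto
      then show "\<exists>c::'a \<Rightarrow> nat. \<forall>y\<in>C \<inter> near {p} \<rho> W. c y < 1 \<and> (\<forall>z\<in>C \<inter> near {p} \<rho> W. c y = c z \<longrightarrow> dist y z \<le> \<eta>)"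
        by (intro exI[of _ "\<lambda>_. 0"]) simp
    qed (rule \<rho>(1))
  qed
qed

section \<open>Growing and cutting continua\<close>

text \<open>Boundary bumping: since \<open>x1\<close> lies outside the annulus, a component of the
  part of \<open>D\<close> inside it reaches its frontier. The component of a point at the middle
  radius therefore crosses half the width.\<close>

lemma subcontinuum_in_annulus:
  fixes D :: "'a::metric_space set"
  assumes D: "compact D" "connected D" and x: "x0 \<in> D" "x1 \<in> D" and ab: "0 \<le> a" "a < b" "b < dist x0 x1"
  obtains D' y z where "compact D'" "connected D'" "D' \<subseteq> D" "\<And>y. y \<in> D' \<Longrightarrow> a \<le> dist x0 y \<and> dist x0 y \<le> b"
    "y \<in> D'" "z \<in> D'" "dist y z \<ge> (b - a) / 2"
proof -
  define m where "m = (a + b) / 2"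
  have contd: "continuous_on S (dist x0)" for S
    by (intro continuous_intros)
  have "connected (dist x0 ` D)"
    using D(2) contd by (intro connected_continuous_image) auto
  moreover have "0 \<in> dist x0 ` D" "dist x0 x1 \<in> dist x0 ` D"
    using x by (auto intro: image_eqI[of _ _ x0])
  ultimately have "m \<in> dist x0 ` D"
    using ab connectedD_interval[of "dist x0 ` D" 0 "dist x0 x1" m] by (simp add: m_def)
  then obtain y where y: "y \<in> D" "dist x0 y = m"
    by auto
  define A where "A = D \<inter> {z. a \<le> dist x0 z \<and> dist x0 z \<le> b}"
  have "closed {z. a \<le> dist x0 z \<and> dist x0 z \<le> b}"
    by (intro closed_Collect_conj closed_Collect_le continuous_intros)
  then have clA: "closedin (top_of_set D) A"
    unfolding A_def by (rule closedin_closed_Int)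
  have yA: "y \<in> A"
    using y ab by (auto simp: A_def m_def)
  define C where "C = connected_component_of_set (top_of_set A) y"
  have AD: "A \<subseteq> D"
    by (auto simp: A_def)
  have sub: "subtopology (top_of_set D) A = top_of_set A"
    using AD by (simp add: subtopology_subtopology inf.absorb2)
  have "C \<inter> (top_of_set D) frontier_of A \<noteq> {}"
  proof (rule boundary_bumping_theorem_closed)
    show "connected_space (top_of_set D)"
      using D(2) connectedin_def[of euclidean D] by simp
    show "compact_space (top_of_set D)"
      using D(1) by (simp add: compact_space_subtopology)
    show "Hausdorff_space (top_of_set D)"
      by (simp add: Hausdorff_space_subtopology)
    have "x1 \<notin> A"
      using ab(3) by (simp add: A_def)
    then show "A \<noteq> topspace (top_of_set D)"
      using x(2) by auto
    show "C \<in> connected_components_of (subtopology (top_of_set D) A)"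
      unfolding sub C_def connected_components_of_def using yA by auto
  qed (rule clA)
  then obtain z where z: "z \<in> C" "z \<in> (top_of_set D) frontier_of A"
    by blast
  have CA: "C \<subseteq> A" and Cc: "connected C"
    using connectedin_connected_component_of[of "top_of_set A" y] unfolding C_def by (auto simp: connectedin_subtopology)
  have zA: "z \<in> A"
    using z(1) CA by blast
  have "\<not> (a < dist x0 z \<and> dist x0 z < b)"
  proof
    assume *: "a < dist x0 z \<and> dist x0 z < b"
    define B where "B = D \<inter> {z. a < dist x0 z \<and> dist x0 z < b}"
    have "open {z. a < dist x0 z \<and> dist x0 z < b}"
      by (intro open_Collect_conj open_Collect_less continuous_intros)
    then have "openin (top_of_set D) B"
      unfolding B_def by (rule openin_open_Int)
    moreover have "B \<subseteq> A"
      by (auto simp: A_def B_def)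
    ultimately have "B \<subseteq> (top_of_set D) interior_of A"
      by (rule interior_of_maximal[rotated])
    moreover have "z \<in> B"
      using * zA AD by (auto simp: B_def)
    ultimately show False
      using z(2) unfolding frontier_of_def by blast
  qed
  then have "dist x0 z = a \<or> dist x0 z = b"
    using zA by (auto simp: A_def)
  then have "\<bar>dist x0 z - dist x0 y\<bar> = (b - a) / 2"
    unfolding y(2) m_def using ab(2) by (auto simp: abs_if field_simps)
  then have dyz: "dist y z \<ge> (b - a) / 2"
    using dist_triangle[of x0 z y] dist_triangle[of x0 y z] dist_commute[of y z] by linarith
  have "compact A"
    using clA D(1) by (metis closedin_compact_eq)
  moreover have "closedin (top_of_set A) C"
    unfolding C_def by (rule closedin_connected_component_of)
  ultimately have "compact C"
    by (metis closedin_compact_eq)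
  moreover have "y \<in> C"
    unfolding C_def using yA by (simp add: connected_component_of_refl)
  ultimately show thesis
    using Cc CA z(1) dyz by (intro that[of C y z]) (auto simp: A_def)
qed

text \<open>By the pigeonhole principle one of \<open>Q + 1\<close> concentric annuli contains no bad point.\<close>

lemma subcontinuum_avoiding:
  fixes D :: "'a::metric_space set" and c :: "'a \<Rightarrow> nat"
  assumes D: "compact D" "connected D" and x: "x0 \<in> D" "x1 \<in> D" "e < dist x0 x1" and "e > 0"
    and c: "\<And>y. y \<in> B \<Longrightarrow> y \<in> D \<Longrightarrow> dist x0 y \<le> e \<Longrightarrow> c y < Q"
      "\<And>y z. y \<in> B \<Longrightarrow> y \<in> D \<Longrightarrow> dist x0 y \<le> e \<Longrightarrow> z \<in> B \<Longrightarrow> z \<in> D \<Longrightarrow> dist x0 z \<le> e \<Longrightarrow> c y = c z \<Longrightarrow> dist y z \<le> e / (4 * (Q + 1))"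
  obtains D' y z where "compact D'" "connected D'" "D' \<subseteq> D" "D' \<inter> B = {}" "D' \<subseteq> cball x0 e"
    "y \<in> D'" "z \<in> D'" "dist y z \<ge> e / (4 * (Q + 1))"
proof -
  \<comment> \<open>The annuli have width \<open>h\<close> and are separated by gaps of width
    \<open>h\<close>. Points of one colour are at most \<open>h / 2\<close> apart, so a colour meets
    at most one annulus.\<close>
  define h where "h = e / (2 * (Q + 1))"
  have h: "h > 0" "2 * (Q + 1) * h = e" "h / 2 = e / (4 * (Q + 1))"
    using \<open>e > 0\<close> by (simp_all add: h_def field_simps)
  have le_e: "(2 * real l + 1) * h \<le> e" if "l \<le> Q" for l
  proof -
    have "(2 * real l + 1) * h \<le> (2 * (real Q + 1)) * h"
      using that h(1) by (intro mult_right_mono) auto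
    then show ?thesis
      using h(2) by (simp add: algebra_simps)
  qed
  have "\<exists>l\<le>Q. \<forall>y\<in>D \<inter> B. \<not> (2 * real l * h \<le> dist x0 y \<and> dist x0 y \<le> (2 * real l + 1) * h)"
  proof (rule ccontr)
    assume "\<not> ?thesis"
    then have "\<forall>l\<in>{..Q}. \<exists>y. y \<in> D \<inter> B \<and> 2 * real l * h \<le> dist x0 y \<and> dist x0 y \<le> (2 * real l + 1) * h"
      by auto
    then obtain f where f: "\<And>l. l \<le> Q \<Longrightarrow> f l \<in> D \<inter> B" "\<And>l. l \<le> Q \<Longrightarrow> 2 * real l * h \<le> dist x0 (f l)"
      "\<And>l. l \<le> Q \<Longrightarrow> dist x0 (f l) \<le> (2 * real l + 1) * h"
      unfolding bchoice_iff by auto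
    have fe: "dist x0 (f l) \<le> e" if "l \<le> Q" for l
      using f(3)[OF that] le_e[OF that] by linarith
    have "(\<lambda>l. c (f l)) ` {..Q} \<subseteq> {..<Q}"
      using c(1) f(1) fe by auto
    then have "card ((\<lambda>l. c (f l)) ` {..Q}) < card {..Q}"
      using card_mono[of "{..<Q}" "(\<lambda>l. c (f l)) ` {..Q}"] by simp
    then have "\<not> inj_on (\<lambda>l. c (f l)) {..Q}"
      by (rule pigeonhole)
    then obtain l m where lm: "l \<le> Q" "m \<le> Q" "l < m" "c (f l) = c (f m)"
      unfolding inj_on_def by (metis atMost_iff linorder_neqE_nat)
    have "dist (f l) (f m) \<le> h / 2"
      unfolding h(3) using lm f(1) fe by (intro c(2)) auto
    moreover have "dist x0 (f m) \<ge> dist x0 (f l) + h"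
    proof -
      have "(2 * real l + 1) * h + h \<le> (2 * real m) * h"
      proof -
        have "(2 * real l + 2) * h \<le> (2 * real m) * h"
          using lm(3) h(1) by (intro mult_right_mono) auto
        then show ?thesis
          by (simp add: algebra_simps)
      qed
      then show ?thesis
        using f(3)[OF lm(1)] f(2)[OF lm(2)] by simp
    qed
    ultimately show False
      using dist_triangle[of x0 "f m" "f l"] h(1) by simp
  qed
  then obtain l where l: "l \<le> Q" "\<And>y. y \<in> D \<Longrightarrow> y \<in> B \<Longrightarrow> \<not> (2 * real l * h \<le> dist x0 y \<and> dist x0 y \<le> (2 * real l + 1) * h)"
    by auto
  have "(2 * real l + 1) * h < dist x0 x1"
    using le_e[OF l(1)] x(3) by linarith
  moreover have "0 \<le> 2 * real l * h" "2 * real l * h < (2 * real l + 1) * h"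
    using h(1) by simp_all
  ultimately have "0 \<le> 2 * real l * h" "2 * real l * h < (2 * real l + 1) * h" "(2 * real l + 1) * h < dist x0 x1"
    by simp_all
  from subcontinuum_in_annulus[OF D x(1,2) this] obtain D' y z where D': "compact D'" "connected D'" "D' \<subseteq> D"
    "\<And>y. y \<in> D' \<Longrightarrow> 2 * real l * h \<le> dist x0 y \<and> dist x0 y \<le> (2 * real l + 1) * h" "y \<in> D'" "z \<in> D'"
    "dist y z \<ge> ((2 * real l + 1) * h - 2 * real l * h) / 2"
    by metis
  show thesis
  proof (rule that[OF D'(1,2,3) _ _ D'(5,6)])
    show "D' \<inter> B = {}"
    proof (rule equals0I)
      fix v assume "v \<in> D' \<inter> B"
      then show False
        using D'(3) D'(4)[of v] l(2)[of v] by blast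
    qed
    show "D' \<subseteq> cball x0 e"
    proof
      fix v assume "v \<in> D'"
      then have "dist x0 v \<le> (2 * real l + 1) * h"
        using D'(4) by blast
      then show "v \<in> cball x0 e"
        using le_e[OF l(1)] by simp
    qed
    show "dist y z \<ge> e / (4 * (Q + 1))"
      using D'(7) unfolding h(3)[symmetric] by (simp add: algebra_simps)
  qed
qed

section \<open>Moving continua from section to section\<close>

context exp_flow
begin

text \<open>In the limit both steps start at one point and end on one section, with durations
  differing by at most \<open>2 * \<kappa>\<close>; \<open>sec_unique\<close> identifies the ends.
  This is continuity of the passage to the next section, uniform over all sections.\<close>

lemma section_step_uniform:
  assumes "e > 0"
  obtains d where "d > 0" "\<And>w y z y' z'. y \<in> X \<Longrightarrow> z \<in> X \<Longrightarrow> dist y z \<le> d \<Longrightarrow> step y y' \<Longrightarrow> step z z' \<Longrightarrow>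
    (w, y') \<in> \<Sigma> \<Longrightarrow> (w, z') \<in> \<Sigma> \<Longrightarrow> dist y' z' < e"
proof (rule ccontr)
  assume neg: "\<not> thesis"
  have "\<exists>w y z u v. y \<in> X \<and> z \<in> X \<and> dist y z \<le> 1 / Suc n \<and> u \<in> {1-\<kappa>..1+\<kappa>} \<and> v \<in> {1-\<kappa>..1+\<kappa>} \<and> (w, \<phi> u y) \<in> \<Sigma> \<and> (w, \<phi> v z) \<in> \<Sigma> \<and>
      \<not> dist (\<phi> u y) (\<phi> v z) < e" for n
  proof (rule ccontr)
    assume no: "\<not> ?thesis"
    show False
    proof (rule neg[THEN notE], rule that[of "1 / Suc n"])
      fix w y z y' z' assume "y \<in> X" "z \<in> X" "dist y z \<le> 1 / Suc n" "step y y'" "step z z'" "(w, y') \<in> \<Sigma>" "(w, z') \<in> \<Sigma>"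
      moreover from this obtain u v where "\<bar>u - 1\<bar> \<le> \<kappa>" "\<bar>v - 1\<bar> \<le> \<kappa>" "y' = \<phi> u y" "z' = \<phi> v z"
        unfolding kstep_def by blast
      moreover from this have "u \<in> {1-\<kappa>..1+\<kappa>}" "v \<in> {1-\<kappa>..1+\<kappa>}"
        by auto
      ultimately show "dist y' z' < e"
        using no by blast
    qed simp
  qed
  then obtain w y z u v where *: "\<And>n. y n \<in> X" "\<And>n. z n \<in> X" "\<And>n. dist (y n) (z n) \<le> 1 / Suc n" "\<And>n. u n \<in> {1-\<kappa>..1+\<kappa>}"
      "\<And>n. v n \<in> {1-\<kappa>..1+\<kappa>}" "\<And>n. (w n, \<phi> (u n) (y n)) \<in> \<Sigma>" "\<And>n. (w n, \<phi> (v n) (z n)) \<in> \<Sigma>"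
      "\<And>n. \<not> dist (\<phi> (u n) (y n)) (\<phi> (v n) (z n)) < e"
    by metis
  obtain s1 w' where s1: "strict_mono (s1 :: nat \<Rightarrow> nat)" "(\<lambda>n. w (s1 n)) \<longlonglongrightarrow> w'"
    using X_subseq[of w] *(6) sec_in by metis
  obtain s2 y' where s2: "strict_mono (s2 :: nat \<Rightarrow> nat)" "y' \<in> X" "(\<lambda>n. y (s1 (s2 n))) \<longlonglongrightarrow> y'"
    using X_subseq[of "\<lambda>n. y (s1 n)"] *(1) by metis
  obtain s3 a where s3: "strict_mono (s3 :: nat \<Rightarrow> nat)" "a \<in> {1-\<kappa>..1+\<kappa>}" "(\<lambda>n. u (s1 (s2 (s3 n)))) \<longlonglongrightarrow> a"
    using seq_compact_real[of "\<lambda>n. u (s1 (s2 n))" "1-\<kappa>" "1+\<kappa>"] *(4) by metis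
  obtain s4 b where s4: "strict_mono (s4 :: nat \<Rightarrow> nat)" "b \<in> {1-\<kappa>..1+\<kappa>}" "(\<lambda>n. v (s1 (s2 (s3 (s4 n))))) \<longlonglongrightarrow> b"
    using seq_compact_real[of "\<lambda>n. v (s1 (s2 (s3 n)))" "1-\<kappa>" "1+\<kappa>"] *(5) by metis
  define s where "s = (\<lambda>n. s1 (s2 (s3 (s4 n))))"
  have sm: "strict_mono s" "strict_mono (\<lambda>n. s2 (s3 (s4 n)))" "strict_mono (\<lambda>n. s3 (s4 n))"
    using s1(1) s2(1) s3(1) s4(1) unfolding s_def strict_mono_def by auto
  have lim: "(\<lambda>n. w (s n)) \<longlonglongrightarrow> w'" "(\<lambda>n. y (s n)) \<longlonglongrightarrow> y'" "(\<lambda>n. u (s n)) \<longlonglongrightarrow> a" "(\<lambda>n. v (s n)) \<longlonglongrightarrow> b"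
    using LIMSEQ_subseq_LIMSEQ[OF s1(2) sm(2)] LIMSEQ_subseq_LIMSEQ[OF s2(3) sm(3)] LIMSEQ_subseq_LIMSEQ[OF s3(3) s4(1)] s4(3)
    unfolding s_def comp_def by simp_all
  have "(\<lambda>n. dist (y n) (z n)) \<longlonglongrightarrow> 0"
    using *(3) by (intro tendsto_sandwich[OF _ _ tendsto_const LIMSEQ_inverse_real_of_nat] always_eventually) (auto simp: inverse_eq_divide)
  from LIMSEQ_subseq_LIMSEQ[OF this sm(1)] have "(\<lambda>n. dist (y (s n)) (z (s n))) \<longlonglongrightarrow> 0"
    by (simp add: comp_def)
  moreover have "(\<lambda>n. dist (y (s n)) y') \<longlonglongrightarrow> 0"
    using tendsto_dist[OF lim(2) tendsto_const, of y'] by simp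
  ultimately have "(\<lambda>n. dist (y (s n)) (z (s n)) + dist (y (s n)) y') \<longlonglongrightarrow> 0"
    using tendsto_add_zero by blast
  then have "(\<lambda>n. dist (z (s n)) y') \<longlonglongrightarrow> 0"
    by (rule Lim_null_comparison[rotated]) (simp add: dist_triangle3)
  then have limz: "(\<lambda>n. z (s n)) \<longlonglongrightarrow> y'"
    by (rule tendsto_dist_iff[THEN iffD2])
  have limyz: "(\<lambda>n. \<phi> (u (s n)) (y (s n))) \<longlonglongrightarrow> \<phi> a y'" "(\<lambda>n. \<phi> (v (s n)) (z (s n))) \<longlonglongrightarrow> \<phi> b y'"
    using *(1,2) s2(2) lim limz by (auto intro!: tendsto_flow)
  have "(w', \<phi> a y') \<in> \<Sigma>" "(w', \<phi> b y') \<in> \<Sigma>"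
    using sec_limit[OF _ lim(1) limyz(1)] sec_limit[OF _ lim(1) limyz(2)] *(6,7) by blast+
  moreover have "\<bar>b - a\<bar> \<le> \<tau>"
    using s3(2) s4(2) kappa by (auto simp: abs_le_iff)
  moreover have "\<phi> b y' = \<phi> (b - a) (\<phi> a y')"
    using s2(2) by (simp add: flow_flow)
  ultimately have "b - a = 0"
    using sec_unique[of w' "\<phi> a y'" "b - a"] by simp
  then have "(\<lambda>n. dist (\<phi> (u (s n)) (y (s n))) (\<phi> (v (s n)) (z (s n)))) \<longlonglongrightarrow> 0"
    using tendsto_dist[OF limyz] by simp
  then have "\<forall>\<^sub>F n in sequentially. dist (\<phi> (u (s n)) (y (s n))) (\<phi> (v (s n)) (z (s n))) < e"
    using assms by (rule order_tendstoD)
  then obtain n where "dist (\<phi> (u (s n)) (y (s n))) (\<phi> (v (s n)) (z (s n))) < e"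
    by (auto simp: eventually_sequentially)
  with *(8)[of "s n"] show False
    by simp
qed

text \<open>Closeness is demanded before stage \<open>n\<close> only, so that stage \<open>n\<close>
  can be the first at which the continuum is large. At every stage from 1 on, all points share one
  section.\<close>

definition evolves :: "nat \<Rightarrow> 'a set \<Rightarrow> ('a \<Rightarrow> nat \<Rightarrow> 'a) \<Rightarrow> bool" where
  "evolves n C \<zeta> \<longleftrightarrow> (\<forall>y\<in>C. \<zeta> y 0 = y \<and> (\<forall>i. \<zeta> y i \<in> X) \<and> (\<forall>i<n. step (\<zeta> y i) (\<zeta> y (Suc i)))) \<and>
     (\<forall>y\<in>C. \<forall>z\<in>C. \<forall>i<n. dist (\<zeta> y i) (\<zeta> z i) \<le> \<epsilon>) \<and>
     (\<forall>i\<in>{1..n}. \<exists>w. \<forall>y\<in>C. (w, \<zeta> y i) \<in> \<Sigma>) \<and> continuous_on C (\<lambda>y. \<zeta> y n)"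

lemma evolvesD:
  assumes "evolves n C \<zeta>"
  shows "y \<in> C \<Longrightarrow> \<zeta> y 0 = y" "y \<in> C \<Longrightarrow> \<zeta> y i \<in> X" "y \<in> C \<Longrightarrow> i < n \<Longrightarrow> step (\<zeta> y i) (\<zeta> y (Suc i))"
    "y \<in> C \<Longrightarrow> z \<in> C \<Longrightarrow> i < n \<Longrightarrow> dist (\<zeta> y i) (\<zeta> z i) \<le> \<epsilon>"
    "1 \<le> i \<Longrightarrow> i \<le> n \<Longrightarrow> \<exists>w. \<forall>y\<in>C. (w, \<zeta> y i) \<in> \<Sigma>" "continuous_on C (\<lambda>y. \<zeta> y n)"
  using assms unfolding evolves_def by auto

lemma evolves_0: "C \<subseteq> X \<Longrightarrow> evolves 0 C (\<lambda>y i. y)"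
  unfolding evolves_def by (auto intro: continuous_intros)

text \<open>An arbitrary point \<open>x\<close> of \<open>C\<close> provides the next section, the
  one through \<open>\<phi> 1 (\<zeta> x n)\<close>. By \<open>step_close\<close> all other points
  come within its reach, and the slack in a step moves them onto it. The map \<open>g\<close> is
  chosen pointwise; \<open>section_step_uniform\<close> makes it continuous.\<close>

lemma evolves_Suc:
  assumes ev: "evolves n C \<zeta>" and close: "\<And>y z. y \<in> C \<Longrightarrow> z \<in> C \<Longrightarrow> dist (\<zeta> y n) (\<zeta> z n) \<le> \<epsilon>"
  obtains \<zeta>' where "evolves (Suc n) C \<zeta>'"
proof (cases "C = {}")
  case True
  then have "evolves (Suc n) C \<zeta>"
    by (simp add: evolves_def)
  then show ?thesis
    by (rule that)
next
  case False
  then obtain x where x: "x \<in> C"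
    by blast
  note D = evolvesD[OF ev]
  define w where "w = \<phi> 1 (\<zeta> x n)"
  have w: "w \<in> X"
    using D(2)[OF x] by (simp add: w_def)
  have "\<exists>y'. step (\<zeta> y n) y' \<and> (w, y') \<in> \<Sigma>" if y: "y \<in> C" for y
  proof -
    have "dist w (\<phi> 1 (\<zeta> y n)) \<le> r"
      using step_close[OF D(2)[OF x] D(2)[OF y] close[OF x y]] by (simp add: w_def)
    then obtain s where s: "\<bar>s\<bar> \<le> \<kappa>" "(w, \<phi> s (\<phi> 1 (\<zeta> y n))) \<in> \<Sigma>"
      using sec_hit[OF w] D(2)[OF y] by (metis flow_in)
    then have "step (\<zeta> y n) (\<phi> s (\<phi> 1 (\<zeta> y n)))"
      unfolding kstep_def using D(2)[OF y] by (intro exI[of _ "1 + s"]) (simp add: flow_flow)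
    with s show ?thesis
      by blast
  qed
  then obtain g where g: "\<And>y. y \<in> C \<Longrightarrow> step (\<zeta> y n) (g y)" "\<And>y. y \<in> C \<Longrightarrow> (w, g y) \<in> \<Sigma>"
    by metis
  have contg: "continuous_on C g"
    unfolding continuous_on_iff
  proof (intro ballI allI impI)
    fix y and e :: real assume y: "y \<in> C" and "e > 0"
    obtain d where d: "d > 0" "\<And>w y z y' z'. y \<in> X \<Longrightarrow> z \<in> X \<Longrightarrow> dist y z \<le> d \<Longrightarrow> step y y' \<Longrightarrow> step z z' \<Longrightarrow>
      (w, y') \<in> \<Sigma> \<Longrightarrow> (w, z') \<in> \<Sigma> \<Longrightarrow> dist y' z' < e"
      using section_step_uniform[OF \<open>e > 0\<close>] by metis
    obtain d' where d': "d' > 0" "\<And>z. z \<in> C \<Longrightarrow> dist z y < d' \<Longrightarrow> dist (\<zeta> z n) (\<zeta> y n) < d"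
      using D(6) y d(1) unfolding continuous_on_iff by metis
    have "dist (g z) (g y) < e" if "z \<in> C" "dist z y < d'" for z
      using d(2)[OF D(2)[OF that(1)] D(2)[OF y] _ g(1)[OF that(1)] g(1)[OF y] g(2)[OF that(1)] g(2)[OF y]] d'(2)[OF that]
      by simp
    with d'(1) show "\<exists>d>0. \<forall>x'\<in>C. dist x' y < d \<longrightarrow> dist (g x') (g y) < e"
      by blast
  qed
  define \<zeta>' where "\<zeta>' = (\<lambda>y i. if i \<le> n then \<zeta> y i else g y)"
  have "evolves (Suc n) C \<zeta>'"
    unfolding evolves_def
  proof (intro conjI ballI allI impI)
    fix y assume y: "y \<in> C"
    show "\<zeta>' y 0 = y"
      using D(1) y by (simp add: \<zeta>'_def)
    show "\<zeta>' y i \<in> X" for i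
      using D(2)[OF y] g(2)[OF y] sec_in by (auto simp: \<zeta>'_def)
    show "step (\<zeta>' y i) (\<zeta>' y (Suc i))" if "i < Suc n" for i
      using that D(3)[OF y] g(1)[OF y] by (cases "i = n") (auto simp: \<zeta>'_def)
    show "dist (\<zeta>' y i) (\<zeta>' z i) \<le> \<epsilon>" if "z \<in> C" "i < Suc n" for z i
      using that D(4)[OF y that(1)] close[OF y that(1)] by (cases "i = n") (auto simp: \<zeta>'_def)
  next
    fix i assume "i \<in> {1..Suc n}"
    then show "\<exists>w. \<forall>y\<in>C. (w, \<zeta>' y i) \<in> \<Sigma>"
      using D(5)[of i] g(2) by (cases "i = Suc n") (auto simp: \<zeta>'_def)
  next
    show "continuous_on C (\<lambda>y. \<zeta>' y (Suc n))"
      using contg by (simp add: \<zeta>'_def)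
  qed
  then show ?thesis
    by (rule that)
qed

lemma evolves_or_grows:
  assumes "C \<subseteq> X" "\<And>y z. y \<in> C \<Longrightarrow> z \<in> C \<Longrightarrow> dist y z \<le> \<epsilon>"
  shows "(\<exists>\<zeta>. evolves n C \<zeta> \<and> (\<forall>y\<in>C. \<forall>z\<in>C. dist (\<zeta> y n) (\<zeta> z n) \<le> \<epsilon>)) \<or>
    (\<exists>k \<zeta>. 1 \<le> k \<and> k \<le> n \<and> evolves k C \<zeta> \<and> (\<exists>y\<in>C. \<exists>z\<in>C. dist (\<zeta> y k) (\<zeta> z k) > \<epsilon>))"
proof (induction n)
  case 0
  show ?case
    using evolves_0[OF assms(1)] assms(2) by (intro disjI1 exI[of _ "\<lambda>y i. y"]) auto
next
  case (Suc n)
  then show ?case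
  proof
    assume "\<exists>\<zeta>. evolves n C \<zeta> \<and> (\<forall>y\<in>C. \<forall>z\<in>C. dist (\<zeta> y n) (\<zeta> z n) \<le> \<epsilon>)"
    then obtain \<zeta> where "evolves n C \<zeta>" "\<And>y z. y \<in> C \<Longrightarrow> z \<in> C \<Longrightarrow> dist (\<zeta> y n) (\<zeta> z n) \<le> \<epsilon>"
      by blast
    then obtain \<zeta>' where ev: "evolves (Suc n) C \<zeta>'"
      using evolves_Suc by metis
    show ?case
    proof (cases "\<forall>y\<in>C. \<forall>z\<in>C. dist (\<zeta>' y (Suc n)) (\<zeta>' z (Suc n)) \<le> \<epsilon>")
      case True
      with ev show ?thesis
        by blast
    next
      case False
      then have "\<exists>y\<in>C. \<exists>z\<in>C. dist (\<zeta>' y (Suc n)) (\<zeta>' z (Suc n)) > \<epsilon>"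
        by (simp add: not_le)
      with ev show ?thesis
        by (intro disjI2 exI[of _ "Suc n"] exI[of _ \<zeta>']) simp
    qed
  next
    assume "\<exists>k \<zeta>. 1 \<le> k \<and> k \<le> n \<and> evolves k C \<zeta> \<and> (\<exists>y\<in>C. \<exists>z\<in>C. dist (\<zeta> y k) (\<zeta> z k) > \<epsilon>)"
    then show ?case
      using le_Suc_eq by metis
  qed
qed

text \<open>Future and past are glued at index 0, where both give the point itself; this is the form
  in which expansivity can be applied to a continuum.\<close>

lemma tracked_join:
  assumes ev: "evolves n C \<zeta>" "\<And>y z. y \<in> C \<Longrightarrow> z \<in> C \<Longrightarrow> dist (\<zeta> y n) (\<zeta> z n) \<le> \<epsilon>"
    and h: "history_map \<xi> n C" and y: "y \<in> C" "z \<in> C" and close: "dist y z \<le> \<epsilon>"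
  shows "tracked n (\<lambda>i. if i \<ge> 0 then \<zeta> y (nat i) else \<xi> y (nat (- i))) (\<lambda>i. if i \<ge> 0 then \<zeta> z (nat i) else \<xi> z (nat (- i)))"
proof -
  note D = evolvesD[OF ev(1)] and H = history_mapD[OF h]
  have stp: "step (if i \<ge> 0 then \<zeta> y (nat i) else \<xi> y (nat (- i))) (if i + 1 \<ge> 0 then \<zeta> y (nat (i + 1)) else \<xi> y (nat (- (i + 1))))"
    if "y \<in> C" "- int n \<le> i \<and> i < int n" for y i
  proof -
    consider "i \<ge> 0" | "i = -1" | "i < -1"
      by linarith
    then show ?thesis
    proof cases
      case 1
      then have "nat (i + 1) = Suc (nat i)" "nat i < n"
        using that by auto
      with 1 show ?thesis
        using D(3)[OF that(1), of "nat i"] by simp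
    next
      case 2
      then have "0 < n"
        using that by simp
      then show ?thesis
        using 2 H(3)[OF that(1), of 0] H(1)[OF that(1)] D(1)[OF that(1)] by simp
    next
      case 3
      then have "nat (- i) = Suc (nat (- (i + 1)))" "nat (- (i + 1)) < n"
        using that by auto
      with 3 show ?thesis
        using H(3)[OF that(1), of "nat (- (i + 1))"] by simp
    qed
  qed
  show ?thesis
    unfolding tracked_def
  proof (intro conjI allI impI)
    fix i :: int assume i: "\<bar>i\<bar> \<le> int n"
    show "dist (if i \<ge> 0 then \<zeta> y (nat i) else \<xi> y (nat (- i))) (if i \<ge> 0 then \<zeta> z (nat i) else \<xi> z (nat (- i))) \<le> \<epsilon>"
    proof (cases "i \<ge> 0")
      case True
      show ?thesis
      proof (cases "nat i = n")
        case True
        then show ?thesis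
          using ev(2)[OF y] \<open>i \<ge> 0\<close> by auto
      next
        case False
        then show ?thesis
          using D(4)[OF y, of "nat i"] \<open>i \<ge> 0\<close> i by auto
      qed
    next
      case False
      then show ?thesis
        using H(4)[OF y(1) y(2), of "nat (- i)"] i by auto
    qed
  qed (use stp y D(2) H(2) in auto)
qed

text \<open>Without growth within \<open>m\<close> steps, past and future would be tracked over the
  whole window, and \<open>section_expansivity\<close> would put any two points closer than
  \<open>\<gamma>\<close>. Thus the waiting time depends on the size \<open>\<gamma>\<close>
  alone.\<close>

lemma growth:
  assumes "\<gamma> > 0"
  obtains m where "\<And>C w. (\<forall>y\<in>C. (w, y) \<in> \<Sigma>) \<Longrightarrow> history m C \<Longrightarrow> \<exists>y\<in>C. \<exists>z\<in>C. dist y z \<ge> \<gamma> \<Longrightarrow>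
    \<exists>k \<zeta>. 1 \<le> k \<and> k \<le> m \<and> evolves k C \<zeta> \<and> (\<exists>y\<in>C. \<exists>z\<in>C. dist (\<zeta> y k) (\<zeta> z k) > \<epsilon>)"
proof -
  obtain m where m: "\<And>\<eta> \<zeta> w. tracked m \<eta> \<zeta> \<Longrightarrow> (w, \<eta> 0) \<in> \<Sigma> \<Longrightarrow> (w, \<zeta> 0) \<in> \<Sigma> \<Longrightarrow> dist (\<eta> 0) (\<zeta> 0) < \<gamma>"
    using section_expansivity[OF assms] by metis
  show thesis
  proof (rule that[of m])
    fix C w
    assume C: "\<forall>y\<in>C. (w, y) \<in> \<Sigma>" "history m C" and ex: "\<exists>y\<in>C. \<exists>z\<in>C. dist y z \<ge> \<gamma>"
    obtain \<xi> where \<xi>: "history_map \<xi> m C"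
      using C(2) unfolding history_def pre_history_def by blast
    have close: "dist y z \<le> \<epsilon>" if "y \<in> C" "z \<in> C" for y z
      using C(2) that unfolding history_def by blast
    have CX: "C \<subseteq> X"
      using C(1) sec_in by blast
    obtain y z where yz: "y \<in> C" "z \<in> C" "dist y z \<ge> \<gamma>"
      using ex by blast
    have "\<not> (evolves m C \<zeta> \<and> (\<forall>y\<in>C. \<forall>z\<in>C. dist (\<zeta> y m) (\<zeta> z m) \<le> \<epsilon>))" for \<zeta>
    proof
      assume ev: "evolves m C \<zeta> \<and> (\<forall>y\<in>C. \<forall>z\<in>C. dist (\<zeta> y m) (\<zeta> z m) \<le> \<epsilon>)"
      then have "tracked m (\<lambda>i. if i \<ge> 0 then \<zeta> y (nat i) else \<xi> y (nat (- i))) (\<lambda>i. if i \<ge> 0 then \<zeta> z (nat i) else \<xi> z (nat (- i)))"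
        using yz close \<xi> by (intro tracked_join[of m C]) auto
      from m[OF this, of w] show False
        using yz C(1) ev by (auto simp: evolvesD(1))
    qed
    with evolves_or_grows[OF CX close, of m]
    show "\<exists>k \<zeta>. 1 \<le> k \<and> k \<le> m \<and> evolves k C \<zeta> \<and> (\<exists>y\<in>C. \<exists>z\<in>C. dist (\<zeta> y k) (\<zeta> z k) > \<epsilon>)"
      by blast
  qed
qed

lemma steps_time:
  assumes "evolves n C \<zeta>" "y \<in> C" "i \<le> n"
  obtains u where "\<zeta> y i = \<phi> u y" "real i / 2 \<le> u" "u \<le> 2 * real i"
proof -
  have "\<exists>u. \<zeta> y i = \<phi> u y \<and> real i / 2 \<le> u \<and> u \<le> 2 * real i"
    using assms(3)
  proof (induction i)
    case 0
    have "\<zeta> y 0 = \<phi> 0 y"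
      using evolvesD(1,2)[OF assms(1,2)] by (metis flow_0)
    then show ?case
      by (intro exI[of _ 0]) simp
  next
    case (Suc i)
    then obtain u where u: "\<zeta> y i = \<phi> u y" "real i / 2 \<le> u" "u \<le> 2 * real i"
      by auto
    obtain v where v: "\<bar>v - 1\<bar> \<le> \<kappa>" "\<zeta> y (Suc i) = \<phi> v (\<zeta> y i)"
      using evolvesD(3)[OF assms(1,2), of i] Suc.prems unfolding kstep_def by auto
    have "y \<in> X"
      using evolvesD(1,2)[OF assms(1,2)] by metis
    then have "\<zeta> y (Suc i) = \<phi> (u + v) y"
      using u v by (simp add: flow_flow)
    then show ?case
      using u v kappa by (intro exI[of _ "u + v"]) (auto simp: abs_le_iff)
  qed
  then show thesis
    using that by blast
qed

text \<open>The stages of the evolution, read backwards, are put in front of the old history. The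
  image itself may be large, so only a \<open>pre_history\<close> results.\<close>

lemma evolves_pre_history:
  assumes ev: "evolves n C \<zeta>" and h: "history T C"
  shows "pre_history (T + n) ((\<lambda>y. \<zeta> y n) ` C)"
proof -
  note D = evolvesD[OF ev]
  obtain \<xi> where \<xi>: "history_map \<xi> T C"
    using h unfolding history_def pre_history_def by blast
  note H = history_mapD[OF \<xi>]
  have "\<forall>y'\<in>(\<lambda>y. \<zeta> y n) ` C. \<exists>y. y \<in> C \<and> y' = \<zeta> y n"
    by blast
  \<comment> \<open>A starting point is chosen for every point of the image; any choice
    works.\<close>
  then obtain p where p: "\<And>y'. y' \<in> (\<lambda>y. \<zeta> y n) ` C \<Longrightarrow> p y' \<in> C" "\<And>y'. y' \<in> (\<lambda>y. \<zeta> y n) ` C \<Longrightarrow> \<zeta> (p y') n = y'"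
    by metis
  define \<xi>' where "\<xi>' = (\<lambda>y' i. if i \<le> n then \<zeta> (p y') (n - i) else \<xi> (p y') (i - n))"
  have "history_map \<xi>' (T + n) ((\<lambda>y. \<zeta> y n) ` C)"
    unfolding history_map_def
  proof (intro ballI conjI allI impI)
    fix y' assume y': "y' \<in> (\<lambda>y. \<zeta> y n) ` C"
    show "\<xi>' y' 0 = y'"
      using p(2)[OF y'] by (simp add: \<xi>'_def)
    show "\<xi>' y' i \<in> X" for i
      using D(2)[OF p(1)[OF y']] H(2)[OF p(1)[OF y']] by (simp add: \<xi>'_def)
    show "step (\<xi>' y' (Suc i)) (\<xi>' y' i)" if i: "i < T + n" for i
    proof -
      consider "i < n" | "i = n" | "i > n"
        by linarith
      then show ?thesis
      proof cases
        case 1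
        then have "n - i = Suc (n - Suc i)"
          by simp
        with 1 show ?thesis
          using D(3)[OF p(1)[OF y'], of "n - Suc i"] by (simp add: \<xi>'_def)
      next
        case 2
        then show ?thesis
          using H(3)[OF p(1)[OF y'], of 0] H(1)[OF p(1)[OF y']] D(1)[OF p(1)[OF y']] i by (simp add: \<xi>'_def)
      next
        case 3
        then have "Suc i - n = Suc (i - n)" "i - n < T"
          using i by auto
        with 3 show ?thesis
          using H(3)[OF p(1)[OF y'], of "i - n"] by (simp add: \<xi>'_def)
      qed
    qed
    show "dist (\<xi>' y' i) (\<xi>' z' i) \<le> \<epsilon>" if z': "z' \<in> (\<lambda>y. \<zeta> y n) ` C" and i: "1 \<le> i \<and> i \<le> T + n" for z' i
    proof (cases "i \<le> n")
      case True
      then show ?thesis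
        using D(4)[OF p(1)[OF y'] p(1)[OF z'], of "n - i"] i by (simp add: \<xi>'_def)
    next
      case False
      then show ?thesis
        using H(4)[OF p(1)[OF y'] p(1)[OF z'], of "i - n"] i by (simp add: \<xi>'_def)
    qed
  qed
  then show ?thesis
    unfolding pre_history_def by blast
qed

text \<open>The state right after growth: large at present but small during the last
  \<open>T\<close> steps, hence \<open>pre_history\<close> instead of
  \<open>history\<close>.\<close>

definition big_plaque :: "nat \<Rightarrow> 'a set \<Rightarrow> bool" where
  "big_plaque T D \<longleftrightarrow> compact D \<and> connected D \<and> (\<exists>w. \<forall>y\<in>D. (w, y) \<in> \<Sigma>) \<and> pre_history T D \<and> (\<exists>y\<in>D. \<exists>z\<in>D. dist y z > \<epsilon>)"

text \<open>The constants come in the order \<open>Q\<close>, \<open>\<delta>\<close>,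
  \<open>m\<close>, \<open>W\<close>, then \<open>\<rho>\<close> and \<open>T0\<close>. The number
  of colours fixes the size left by a cut, the size fixes the time of regrowth, and only then is the
  window known in which visits have to be coloured. The quantifiers in \<open>colourable\<close>
  match this order.\<close>

lemma avoiding_orbit:
  assumes col: "colourable F" and big: "\<And>T. \<exists>D. big_plaque T D"
  obtains x \<rho> where "x \<in> X" "\<rho> > 0" "\<And>t p. p \<in> F \<Longrightarrow> dist p (\<phi> t x) \<ge> \<rho>"
proof -
  obtain Q :: nat where Q: "\<And>W \<eta>. \<eta> > 0 \<Longrightarrow> \<exists>\<rho>>0. \<exists>T. \<forall>w C. (\<forall>y\<in>C. (w, y) \<in> \<Sigma>) \<and> history T C \<longrightarrow>
     (\<exists>c::'a \<Rightarrow> nat. \<forall>y\<in>C \<inter> near F \<rho> W. c y < Q \<and> (\<forall>z\<in>C \<inter> near F \<rho> W. c y = c z \<longrightarrow> dist y z \<le> \<eta>))"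
    using col unfolding colourable_def by blast
  \<comment> \<open>Points within \<open>e\<close> of \<open>x0\<close> are within \<epsilon> of
    each other, so the part of a large plaque near \<open>x0\<close> has a full history
    again.\<close>
  define e where "e = \<epsilon> / 2"
  have e: "e > 0" "2 * e = \<epsilon>"
    using eps by (simp_all add: e_def)
  define \<delta> where "\<delta> = e / (4 * (Q + 1))"
  have \<delta>: "\<delta> > 0"
    using e by (simp add: \<delta>_def)
  obtain m where m: "\<And>C w. (\<forall>y\<in>C. (w, y) \<in> \<Sigma>) \<Longrightarrow> history m C \<Longrightarrow> \<exists>y\<in>C. \<exists>z\<in>C. dist y z \<ge> \<delta> \<Longrightarrow>
    \<exists>k \<zeta>. 1 \<le> k \<and> k \<le> m \<and> evolves k C \<zeta> \<and> (\<exists>y\<in>C. \<exists>z\<in>C. dist (\<zeta> y k) (\<zeta> z k) > \<epsilon>)"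
    using growth[OF \<delta>] by metis
  \<comment> \<open>Between two cuts there are at most \<open>m\<close> steps, each of duration at
    most 2.\<close>
  define W where "W = 2 * real m"
  obtain \<rho> T0 where \<rho>: "\<rho> > 0" and T0: "\<And>w C. (\<forall>y\<in>C. (w, y) \<in> \<Sigma>) \<and> history T0 C \<Longrightarrow>
     \<exists>c::'a \<Rightarrow> nat. \<forall>y\<in>C \<inter> near F \<rho> W. c y < Q \<and> (\<forall>z\<in>C \<inter> near F \<rho> W. c y = c z \<longrightarrow> dist y z \<le> \<delta>)"
    using Q[OF \<delta>, of W] by blast
  define T where "T = max m T0"
  have cut: "\<exists>D' w. compact D' \<and> connected D' \<and> D' \<subseteq> D \<and> (\<forall>y\<in>D'. (w, y) \<in> \<Sigma>) \<and> history T D' \<and> D' \<inter> near F \<rho> W = {} \<and>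
      (\<exists>y\<in>D'. \<exists>z\<in>D'. dist y z \<ge> \<delta>)" if D: "big_plaque T D" for D
  proof -
    obtain w x0 x1 where D': "compact D" "connected D" "\<forall>y\<in>D. (w, y) \<in> \<Sigma>" "pre_history T D" "x0 \<in> D" "x1 \<in> D" "dist x0 x1 > \<epsilon>"
      using D unfolding big_plaque_def by blast
    define D0 where "D0 = {y\<in>D. dist x0 y \<le> e}"
    have close: "dist y z \<le> \<epsilon>" if "y \<in> D0" "z \<in> D0" for y z
      using that dist_triangle3[of y z x0] e(2) by (auto simp: D0_def)
    have "pre_history T D0"
      using pre_history_mono[OF D'(4), of D0 T] by (auto simp: D0_def)
    then have "history T D0"
      using close unfolding history_def by blast
    then have "history T0 D0"
      by (rule history_mono) (auto simp: T_def)
    moreover have "\<forall>y\<in>D0. (w, y) \<in> \<Sigma>"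
      using D'(3) by (simp add: D0_def)
    ultimately obtain c :: "'a \<Rightarrow> nat" where c: "\<forall>y\<in>D0 \<inter> near F \<rho> W. c y < Q \<and> (\<forall>z\<in>D0 \<inter> near F \<rho> W. c y = c z \<longrightarrow> dist y z \<le> \<delta>)"
      using T0 by blast
    have c1: "c y < Q" if "y \<in> near F \<rho> W" "y \<in> D" "dist x0 y \<le> e" for y
      using c that by (simp add: D0_def)
    have c2: "dist y z \<le> e / (4 * (Q + 1))" if "y \<in> near F \<rho> W" "y \<in> D" "dist x0 y \<le> e" "z \<in> near F \<rho> W" "z \<in> D" "dist x0 z \<le> e" "c y = c z" for y z
      using c that by (simp add: D0_def \<delta>_def)
    have "e < dist x0 x1"
      using D'(7) e by linarith
    then obtain D1 y z where D1: "compact D1" "connected D1" "D1 \<subseteq> D" "D1 \<inter> near F \<rho> W = {}" "D1 \<subseteq> cball x0 e"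
      "y \<in> D1" "z \<in> D1" "dist y z \<ge> \<delta>"
      unfolding \<delta>_def by (rule subcontinuum_avoiding[OF D'(1,2,5,6) _ e(1) c1 c2])
    have "D1 \<subseteq> D0"
      using D1(3,5) by (auto simp: D0_def)
    then have "history T D1"
      using history_mono[OF \<open>history T D0\<close>] by blast
    then show ?thesis
      using D1 D'(3) by (intro exI[of _ D1] exI[of _ w]) blast
  qed
  \<comment> \<open>A cycle of growing and cutting takes at least one step, hence a time of at least
    1/2; so \<open>k\<close> cycles secure the past up to time \<open>real k / 2\<close>.\<close>
  define good where "good = (\<lambda>k C. compact C \<and> connected C \<and> (\<exists>w. \<forall>y\<in>C. (w, y) \<in> \<Sigma>) \<and> history T C \<and>
      (\<exists>y\<in>C. \<exists>z\<in>C. dist y z \<ge> \<delta>) \<and> (\<forall>y\<in>C. \<forall>t p. 0 \<le> t \<and> t < real k / 2 \<and> p \<in> F \<longrightarrow> dist p (\<phi> (- t) y) \<ge> \<rho>))"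
  have "\<exists>C. good k C" for k
  proof (induction k)
    case 0
    obtain D where "big_plaque T D"
      using big by blast
    from cut[OF this] show ?case
      unfolding good_def by (auto 4 3)
  next
    case (Suc k)
    then obtain C w where C: "compact C" "connected C" "\<forall>y\<in>C. (w, y) \<in> \<Sigma>" "history T C" "\<exists>y\<in>C. \<exists>z\<in>C. dist y z \<ge> \<delta>"
      "\<And>y t p. y \<in> C \<Longrightarrow> 0 \<le> t \<Longrightarrow> t < real k / 2 \<Longrightarrow> p \<in> F \<Longrightarrow> dist p (\<phi> (- t) y) \<ge> \<rho>"
      unfolding good_def by blast
    have "history m C"
      using history_mono[OF C(4), of C m] by (simp add: T_def)
    from m[OF C(3) this C(5)] obtain n \<zeta> where n: "1 \<le> n" "n \<le> m" "evolves n C \<zeta>" "\<exists>y\<in>C. \<exists>z\<in>C. dist (\<zeta> y n) (\<zeta> z n) > \<epsilon>"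
      by blast
    define D where "D = (\<lambda>y. \<zeta> y n) ` C"
    have "pre_history T D"
      unfolding D_def by (rule pre_history_mono[OF evolves_pre_history[OF n(3) C(4)]]) auto
    moreover have "compact D" "connected D"
      unfolding D_def using evolvesD(6)[OF n(3)] C(1,2) by (auto intro: compact_continuous_image connected_continuous_image)
    moreover have "\<exists>w. \<forall>y\<in>D. (w, y) \<in> \<Sigma>"
      using evolvesD(5)[OF n(3), of n] n(1) by (auto simp: D_def)
    moreover have "\<exists>y\<in>D. \<exists>z\<in>D. dist y z > \<epsilon>"
      using n(4) by (auto simp: D_def)
    ultimately have "big_plaque T D"
      unfolding big_plaque_def by blast
    from cut[OF this] obtain D' w' where D': "compact D'" "connected D'" "D' \<subseteq> D" "\<forall>y\<in>D'. (w', y) \<in> \<Sigma>" "history T D'"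
      "D' \<inter> near F \<rho> W = {}" "\<exists>y\<in>D'. \<exists>z\<in>D'. dist y z \<ge> \<delta>"
      by blast
    have "dist p (\<phi> (- t) y') \<ge> \<rho>" if y': "y' \<in> D'" and t: "0 \<le> t" "t < real (Suc k) / 2" and p: "p \<in> F" for y' t p
    proof -
      obtain y where y: "y \<in> C" "y' = \<zeta> y n"
        using y' D'(3) by (auto simp: D_def)
      obtain u where u: "\<zeta> y n = \<phi> u y" "real n / 2 \<le> u" "u \<le> 2 * real n"
        using steps_time[OF n(3) y(1) order_refl] by metis
      have X: "y \<in> X" "y' \<in> X"
        using C(3) y D'(4) y' sec_in by blast+
      \<comment> \<open>A visit would fall either into the last growth phase, excluded by the cut
        away from \<open>near F \<rho> W\<close>, or before it, excluded by the previous
        stage.\<close>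
      show ?thesis
      proof (cases "t \<le> u")
        case True
        show ?thesis
        proof (rule ccontr)
          assume "\<not> dist p (\<phi> (- t) y') \<ge> \<rho>"
          then have "dist p (\<phi> (- t) y') \<le> \<rho>"
            by simp
          moreover have "t \<le> W"
            using True u(3) n(2) by (simp add: W_def)
          moreover have "y' = \<phi> t (\<phi> (- t) y')"
            using X by simp
          ultimately have "y' \<in> near F \<rho> W"
            unfolding near_def using t(1) p X
            by (intro CollectI exI[of _ t] exI[of _ "\<phi> (- t) y'"] conjI bexI[of _ p]) simp_all
          with D'(6) y' show False
            by blast
        qed
      next
        case False
        have "\<phi> (- t) y' = \<phi> (- (t - u)) y"
          using X y u by (simp add: flow_flow)
        moreover have "t - u < real k / 2"
          using t(2) u(2) n(1) by simp
        ultimately show ?thesis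
          using C(6)[OF y(1), of "t - u" p] False p by simp
      qed
    qed
    then show ?case
      unfolding good_def using D' by blast
  qed
  then obtain C where C: "\<And>k. good k (C k)"
    by metis
  have "\<exists>y. y \<in> C k" for k
    using C[of k] unfolding good_def by blast
  then obtain y where y: "\<And>k. y k \<in> C k"
    by metis
  have yX: "y k \<in> X" for k
    using C[of k] y[of k] sec_in unfolding good_def by blast
  have av: "dist p (\<phi> (- t) (y k)) \<ge> \<rho>" if "p \<in> F" "0 \<le> t" "t < real k / 2" for p t k
    using C[of k] y[of k] that unfolding good_def by blast
  \<comment> \<open>Avoidance is known for the past of \<open>y k\<close> only. The midpoint of the
    secured stretch has it in both time directions, over a time that grows with
    \<open>k\<close>.\<close>
  define x where "x = (\<lambda>k. \<phi> (- (real k / 4)) (y k))"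
  obtain s l where s: "strict_mono (s :: nat \<Rightarrow> nat)" "l \<in> X" "(\<lambda>n. x (s n)) \<longlonglongrightarrow> l"
    using X_subseq[of x] yX by (auto simp: x_def)
  have "dist p (\<phi> t l) \<ge> \<rho>" if p: "p \<in> F" for t p
  proof -
    have "\<forall>\<^sub>F n in sequentially. nat \<lceil>4 * \<bar>t\<bar>\<rceil> + 1 \<le> s n"
      using filterlim_subseq[OF s(1)] by (simp add: filterlim_at_top)
    then have "\<forall>\<^sub>F n in sequentially. \<rho> \<le> dist p (\<phi> t (x (s n)))"
    proof eventually_elim
      case (elim n)
      then have "4 * \<bar>t\<bar> < s n"
        by linarith
      then have "dist p (\<phi> (- (real (s n) / 4 - t)) (y (s n))) \<ge> \<rho>"
        by (intro av[OF p]) (auto simp: abs_if split: if_splits)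
      then show ?case
        using yX by (simp add: x_def flow_flow)
    qed
    moreover have "(\<lambda>n. dist p (\<phi> t (x (s n)))) \<longlonglongrightarrow> dist p (\<phi> t l)"
      using yX s by (intro tendsto_dist tendsto_const tendsto_flow) (auto simp: x_def)
    ultimately show ?thesis
      by (intro tendsto_lowerbound[of _ "dist p (\<phi> t l)"]) auto
  qed
  then show thesis
    by (rule that[OF s(2) \<rho>])
qed

end

section \<open>Minimal sets\<close>

lemma Inter_chain_in:
  assumes "finite \<F>" "\<F> \<noteq> {}" "\<And>S T. S \<in> \<F> \<Longrightarrow> T \<in> \<F> \<Longrightarrow> S \<subseteq> T \<or> T \<subseteq> S"
  shows "\<Inter>\<F> \<in> \<F>"
  using assms
proof (induction \<F> rule: finite_ne_induct)
  case (insert S \<F>)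
  then have "\<Inter>\<F> \<in> \<F>"
    by simp
  then have "S \<subseteq> \<Inter>\<F> \<or> \<Inter>\<F> \<subseteq> S"
    using insert.prems by simp
  then have "\<Inter>(insert S \<F>) = S \<or> \<Inter>(insert S \<F>) = \<Inter>\<F>"
    by auto
  with \<open>\<Inter>\<F> \<in> \<F>\<close> show ?case
    by (metis insertCI)
qed simp

context cflow
begin

lemma invariant_set_iff:
  assumes "L \<subseteq> X"
  shows "invariant_set \<phi> L \<longleftrightarrow> (\<forall>t. \<forall>y\<in>L. \<phi> t y \<in> L)"
proof
  assume "invariant_set \<phi> L"
  then show "\<forall>t. \<forall>y\<in>L. \<phi> t y \<in> L"
    unfolding invariant_set_def by blast
next
  assume *: "\<forall>t. \<forall>y\<in>L. \<phi> t y \<in> L"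
  have "y \<in> \<phi> t ` L" if "y \<in> L" for y t
    using * that assms by (intro image_eqI[of _ _ "\<phi> (- t) y"]) auto
  with * show "invariant_set \<phi> L"
    unfolding invariant_set_def by blast
qed

lemma minimal_set_exists:
  assumes A: "A \<subseteq> X" "A \<noteq> {}" "compact A" "invariant_set \<phi> A"
  obtains K where "minimal_set \<phi> X K" "K \<subseteq> A"
proof -
  define \<A> where "\<A> = {L. L \<subseteq> A \<and> L \<noteq> {} \<and> compact L \<and> invariant_set \<phi> L}"
  \<comment> \<open>Zorn's lemma is used in its form for upper bounds, hence for complements;
    compactness keeps the intersection of a chain nonempty.\<close>
  have "\<exists>M\<in>(\<lambda>L. X - L) ` \<A>. \<forall>B\<in>(\<lambda>L. X - L) ` \<A>. M \<subseteq> B \<longrightarrow> B = M"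
  proof (rule subset_Zorn)
    fix \<C> assume chain: "subset.chain ((\<lambda>L. X - L) ` \<A>) \<C>"
    define \<L> where "\<L> = {L\<in>\<A>. X - L \<in> \<C>}"
    define L where "L = A \<inter> \<Inter>\<L>"
    have comparable: "S \<subseteq> T \<or> T \<subseteq> S" if "S \<in> \<L>" "T \<in> \<L>" for S T
    proof -
      have "X - S \<in> \<C>" "X - T \<in> \<C>"
        using that by (simp_all add: \<L>_def)
      then have "X - S \<subseteq> X - T \<or> X - T \<subseteq> X - S"
        using chain unfolding subset_chain_def by metis
      moreover have "S \<subseteq> X" "T \<subseteq> X"
        using that A(1) by (auto simp: \<L>_def \<A>_def)
      ultimately show ?thesis
        by blast
    qed
    have "L \<noteq> {}"
      unfolding L_def
    proof (rule compact_imp_fip[OF A(3)])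
      show "closed T" if "T \<in> \<L>" for T
        using that by (auto simp: \<L>_def \<A>_def compact_imp_closed)
      show "A \<inter> \<Inter>\<F> \<noteq> {}" if \<F>: "finite \<F>" "\<F> \<subseteq> \<L>" for \<F>
      proof (cases "\<F> = {}")
        case True
        then show ?thesis
          using A(2) by simp
      next
        case False
        have "\<Inter>\<F> \<in> \<F>"
          using comparable \<F>(2) by (intro Inter_chain_in \<F>(1) False) blast
        then have "\<Inter>\<F> \<in> \<A>"
          using \<F>(2) by (auto simp: \<L>_def)
        then show ?thesis
          unfolding \<A>_def by blast
      qed
    qed
    moreover have "closed (\<Inter>\<L>)"
      by (intro closed_Inter) (auto simp: \<L>_def \<A>_def compact_imp_closed)
    then have "compact L"
      unfolding L_def using A(3) by (rule compact_Int_closed[rotated])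
    moreover have "invariant_set \<phi> L"
    proof -
      have "\<phi> t y \<in> L'" if "L' \<in> \<L>" "y \<in> L" for t y L'
        using that invariant_set_iff[of L'] A(1) unfolding \<L>_def \<A>_def L_def by blast
      moreover have "\<phi> t y \<in> A" if "y \<in> L" for t y
        using that A(4) invariant_set_iff[OF A(1)] by (auto simp: L_def)
      moreover have "L \<subseteq> X"
        using A(1) by (auto simp: L_def)
      ultimately show ?thesis
        using invariant_set_iff[of L] by (auto simp: L_def)
    qed
    ultimately have "L \<in> \<A>"
      by (auto simp: \<A>_def L_def)
    moreover have "B \<subseteq> X - L" if B: "B \<in> \<C>" for B
    proof -
      obtain L' where "L' \<in> \<A>" "B = X - L'"
        using chain B unfolding subset.chain_def by blast
      then have "L' \<in> \<L>"
        using B by (simp add: \<L>_def)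
      then show ?thesis
        using \<open>B = X - L'\<close> by (auto simp: L_def)
    qed
    ultimately show "\<exists>U\<in>(\<lambda>L. X - L) ` \<A>. \<forall>B\<in>\<C>. B \<subseteq> U"
      by (intro bexI[of _ "X - L"]) auto
  qed
  then obtain K where K: "K \<in> \<A>" "\<And>L. L \<in> \<A> \<Longrightarrow> X - K \<subseteq> X - L \<Longrightarrow> X - L = X - K"
    by blast
  have "\<not> (\<exists>L. L \<noteq> {} \<and> L \<subset> K \<and> compact L \<and> invariant_set \<phi> L)"
  proof
    assume "\<exists>L. L \<noteq> {} \<and> L \<subset> K \<and> compact L \<and> invariant_set \<phi> L"
    then obtain L where L: "L \<noteq> {}" "L \<subset> K" "compact L" "invariant_set \<phi> L"
      by blast
    then have "L \<in> \<A>"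
      using K(1) by (auto simp: \<A>_def)
    moreover have "X - K \<subseteq> X - L"
      using L(2) by blast
    ultimately have "X - L = X - K"
      by (rule K(2))
    moreover have "K \<subseteq> X"
      using K(1) A(1) by (auto simp: \<A>_def)
    ultimately show False
      using L(2) by blast
  qed
  with K(1) A(1) show thesis
    by (intro that[of K]) (auto simp: minimal_set_def \<A>_def)
qed

end

context exp_flow
begin

text \<open>The orbit of \<open>q\<close> is compact and invariant, so by minimality it is all of
  \<open>K\<close>, and all points of an orbit share its periods.\<close>

lemma periodic_minimal_set:
  assumes K: "minimal_set \<phi> X K" and q: "q \<in> K" and P: "P > 0" "\<phi> P q = q" and p: "p \<in> K"
  shows "\<phi> P p = p"
proof -
  have qX: "q \<in> X" and KX: "K \<subseteq> X"
    using K q unfolding minimal_set_def by auto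
  define L where "L = (\<lambda>t. \<phi> t q) ` {0..P}"
  have all: "\<phi> t q \<in> L" for t
  proof -
    have "P * \<lfloor>t / P\<rfloor> \<le> P * (t / P)" "P * (t / P) \<le> P * (\<lfloor>t / P\<rfloor> + 1)"
      using P(1) by (intro mult_left_mono; linarith)+
    then have "t - P * \<lfloor>t / P\<rfloor> \<in> {0..P}"
      using P(1) by (simp add: algebra_simps)
    then show ?thesis
      unfolding L_def using flow_mod_period[OF qX P(2), of t] by (metis image_eqI)
  qed
  have "compact L"
    unfolding L_def using qX by (intro compact_continuous_image continuous_intros) auto
  have "L \<subseteq> X"
    using qX by (auto simp: L_def)
  have "\<phi> t y \<in> L" if "y \<in> L" for t y
    using that qX all by (auto simp: L_def flow_flow)
  then have "invariant_set \<phi> L"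
    using invariant_set_iff[OF \<open>L \<subseteq> X\<close>] by simp
  have "L \<noteq> {}"
    using all by auto
  have "L \<subseteq> K"
    using K q KX invariant_set_iff[OF KX] unfolding minimal_set_def L_def by auto
  moreover have "\<not> L \<subset> K"
    using K \<open>compact L\<close> \<open>invariant_set \<phi> L\<close> \<open>L \<noteq> {}\<close> unfolding minimal_set_def by metis
  ultimately have "L = K"
    by blast
  then obtain s where "p = \<phi> s q"
    using p by (auto simp: L_def)
  then have "\<phi> P p = \<phi> s (\<phi> P q)"
    using qX by (simp add: flow_flow add.commute)
  then show ?thesis
    using P(2) \<open>p = \<phi> s q\<close> by simp
qed

lemma colourable_minimal:
  assumes K: "minimal_set \<phi> X K" and p: "p \<in> K"
  shows "colourable {p}"
proof (cases "\<exists>q\<in>K. \<exists>t. t \<noteq> 0 \<and> \<phi> t q = q")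
  case True
  then obtain q t where q: "q \<in> K" "t \<noteq> 0" "\<phi> t q = q"
    by blast
  have X: "q \<in> X" "p \<in> X"
    using K q p unfolding minimal_set_def by auto
  have "\<phi> \<bar>t\<bar> q = q"
    using q(3) X(1) flow_inverse(1)[of q t] by (simp add: abs_if)
  then have "\<phi> \<bar>t\<bar> p = p"
    using periodic_minimal_set[OF K q(1) _ _ p, of "\<bar>t\<bar>"] q(2) by simp
  then show ?thesis
    using colourable_periodic[OF X(2), of "\<bar>t\<bar>"] q(2) by simp
next
  case False
  have KX: "K \<subseteq> X"
    using K unfolding minimal_set_def by blast
  interpret aperiodic_set \<phi> X \<tau> \<kappa> \<epsilon> r \<Sigma> K
    by unfold_locales (use K False invariant_set_iff[OF KX] in \<open>auto simp: minimal_set_def\<close>)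
  show ?thesis
    using p by (rule colourable_aperiodic)
qed

lemma infinite_minimal_sets:
  assumes big: "\<And>T. \<exists>D. big_plaque T D"
  shows "infinite {K. minimal_set \<phi> X K}"
proof
  assume fin: "finite {K. minimal_set \<phi> X K}"
  have "\<exists>q. q \<in> K" if "minimal_set \<phi> X K" for K
    using that unfolding minimal_set_def by blast
  then obtain p where p: "\<And>K. minimal_set \<phi> X K \<Longrightarrow> p K \<in> K"
    by metis
  have "colourable (p ` \<K>)" if "finite \<K>" "\<K> \<subseteq> {K. minimal_set \<phi> X K}" for \<K>
    using that
  proof (induction \<K> rule: finite_induct)
    case empty
    then show ?case
      by (simp add: colourable_empty)
  next
    case (insert K \<K>)
    have "colourable {p K}"
      using insert.prems p by (intro colourable_minimal[of K]) auto
    then show ?case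
      using insert by (auto intro: colourable_insert)
  qed
  from this[OF fin subset_refl] obtain x \<rho> where x: "x \<in> X" "\<rho> > 0" "\<And>t q. q \<in> p ` {K. minimal_set \<phi> X K} \<Longrightarrow> dist q (\<phi> t x) \<ge> \<rho>"
    using avoiding_orbit[OF _ big] by metis
  define A where "A = closure (range (\<lambda>t. \<phi> t x))"
  have AX: "A \<subseteq> X"
    unfolding A_def using x(1) cpt by (intro closure_minimal) (auto simp: compact_imp_closed)
  have "\<phi> s ` A \<subseteq> A" for s
  proof -
    have "continuous_on A (\<phi> s)"
      using AX by (intro continuous_on_flow[of A "\<lambda>_. s" "\<lambda>y. y"] continuous_intros) auto
    moreover have "\<phi> s ` range (\<lambda>t. \<phi> t x) \<subseteq> A"
      using x(1) closure_subset unfolding A_def by (fastforce simp: flow_flow)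
    ultimately show ?thesis
      using image_closure_subset[of "range (\<lambda>t. \<phi> t x)" "\<phi> s" A] by (simp add: A_def)
  qed
  then have "invariant_set \<phi> A"
    using invariant_set_iff[OF AX] by blast
  moreover have "compact A"
    using AX cpt by (metis A_def closed_closure compact_Int_closed inf.absorb2)
  moreover have "A \<noteq> {}"
    by (simp add: A_def)
  ultimately obtain K where K: "minimal_set \<phi> X K" "K \<subseteq> A"
    using minimal_set_exists[OF AX] by metis
  then have "p K \<in> closure (range (\<lambda>t. \<phi> t x))"
    using p A_def by blast
  then obtain t where "dist (\<phi> t x) (p K) < \<rho>"
    using x(2) unfolding closure_approachable by blast
  moreover have "dist (p K) (\<phi> t x) \<ge> \<rho>"
    using x(3) K(1) by blast
  ultimately show False
    by (simp add: dist_commute)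
qed

section \<open>Slow growth of small continua and the choice of the time direction\<close>

lemma evolves_small:
  assumes "e > 0"
  shows "\<exists>d>0. \<forall>C \<zeta> K. (\<forall>y\<in>C. \<forall>z\<in>C. dist y z \<le> d) \<and> evolves K C \<zeta> \<and> n \<le> K \<longrightarrow> (\<forall>y\<in>C. \<forall>z\<in>C. dist (\<zeta> y n) (\<zeta> z n) \<le> e)"
  using assms
proof (induction n arbitrary: e)
  case 0
  then show ?case
    by (intro exI[of _ e]) (auto simp: evolvesD(1))
next
  case (Suc n)
  obtain d1 where d1: "d1 > 0" "\<And>w y z y' z'. y \<in> X \<Longrightarrow> z \<in> X \<Longrightarrow> dist y z \<le> d1 \<Longrightarrow> step y y' \<Longrightarrow> step z z' \<Longrightarrow>
    (w, y') \<in> \<Sigma> \<Longrightarrow> (w, z') \<in> \<Sigma> \<Longrightarrow> dist y' z' < e"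
    using section_step_uniform[OF Suc.prems] by metis
  from Suc.IH[OF d1(1)] obtain d where d: "d > 0" "\<forall>C \<zeta> K. (\<forall>y\<in>C. \<forall>z\<in>C. dist y z \<le> d) \<and> evolves K C \<zeta> \<and> n \<le> K \<longrightarrow>
      (\<forall>y\<in>C. \<forall>z\<in>C. dist (\<zeta> y n) (\<zeta> z n) \<le> d1)"
    by - (erule exE, erule conjE, rule that)
  show ?case
  proof (rule exI[of _ d], intro conjI allI impI ballI, rule d(1), elim conjE)
    fix C \<zeta> K y z
    assume C: "\<forall>y\<in>C. \<forall>z\<in>C. dist y z \<le> d" and ev: "evolves K C \<zeta>" and K: "Suc n \<le> K" and yz: "y \<in> C" "z \<in> C"
    note D = evolvesD[OF ev]
    obtain w where w: "\<forall>y\<in>C. (w, \<zeta> y (Suc n)) \<in> \<Sigma>"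
      using D(5)[of "Suc n"] K by auto
    have "\<forall>y\<in>C. \<forall>z\<in>C. dist (\<zeta> y n) (\<zeta> z n) \<le> d1"
      using d(2)[THEN spec, of C, THEN spec, of \<zeta>, THEN spec, of K] C ev K by simp
    then have "dist (\<zeta> y (Suc n)) (\<zeta> z (Suc n)) < e"
      using yz K w by (intro d1(2)[of "\<zeta> y n" "\<zeta> z n" _ _ w] D(2,3)) auto
    then show "dist (\<zeta> y (Suc n)) (\<zeta> z (Suc n)) \<le> e"
      by simp
  qed
qed

text \<open>A continuum of sufficiently small diameter needs more than \<open>T\<close> steps to
  exceed \<epsilon>, so the plaque that finally arises has a long past.\<close>

lemma evolves_small_upto:
  obtains d where "d > 0" "\<And>C \<zeta> k y z. (\<And>y z. y \<in> C \<Longrightarrow> z \<in> C \<Longrightarrow> dist y z \<le> d) \<Longrightarrow> evolves k C \<zeta> \<Longrightarrow> k \<le> T \<Longrightarrow>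
    y \<in> C \<Longrightarrow> z \<in> C \<Longrightarrow> dist (\<zeta> y k) (\<zeta> z k) \<le> \<epsilon>"
proof -
  have "\<forall>n. \<exists>d>0. \<forall>C \<zeta> K. (\<forall>y\<in>C. \<forall>z\<in>C. dist y z \<le> d) \<and> evolves K C \<zeta> \<and> n \<le> K \<longrightarrow>
      (\<forall>y\<in>C. \<forall>z\<in>C. dist (\<zeta> y n) (\<zeta> z n) \<le> \<epsilon>)"
    using evolves_small[OF eps] by (rule allI)
  from choice[OF this] obtain d where d0: "\<forall>n. d n > 0 \<and> (\<forall>C \<zeta> K. (\<forall>y\<in>C. \<forall>z\<in>C. dist y z \<le> d n) \<and> evolves K C \<zeta> \<and> n \<le> K \<longrightarrow>
      (\<forall>y\<in>C. \<forall>z\<in>C. dist (\<zeta> y n) (\<zeta> z n) \<le> \<epsilon>))"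
    by - (erule exE, rule that)
  have d: "d n > 0" for n
    using d0 by simp
  show thesis
  proof (rule that[of "Min (d ` {..T})"])
    show "Min (d ` {..T}) > 0"
      using d by simp
    fix C \<zeta> k y z
    assume *: "\<And>y z. y \<in> C \<Longrightarrow> z \<in> C \<Longrightarrow> dist y z \<le> Min (d ` {..T})" "evolves k C \<zeta>" "k \<le> T" "y \<in> C" "z \<in> C"
    have "Min (d ` {..T}) \<le> d k"
      using *(3) by simp
    then have "\<forall>y\<in>C. \<forall>z\<in>C. dist y z \<le> d k"
      using *(1) order_trans by blast
    then show "dist (\<zeta> y k) (\<zeta> z k) \<le> \<epsilon>"
      using d0[THEN spec, of k, THEN conjunct2, THEN spec, of C, THEN spec, of \<zeta>, THEN spec, of k] *(2,4,5) by simp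
  qed
qed

text \<open>Lets the two time directions exchange roles: a future of the inverse flow becomes a past
  of the flow.\<close>

lemma history_map_of_reverse:
  assumes "\<And>y. y \<in> C \<Longrightarrow> \<zeta> y 0 = y" "\<And>y i. y \<in> C \<Longrightarrow> \<zeta> y i \<in> X"
    "\<And>y i. y \<in> C \<Longrightarrow> i < n \<Longrightarrow> kstep (\<lambda>t. \<phi> (- t)) \<kappa> (\<zeta> y i) (\<zeta> y (Suc i))"
    "\<And>y z i. y \<in> C \<Longrightarrow> z \<in> C \<Longrightarrow> i < n \<Longrightarrow> dist (\<zeta> y i) (\<zeta> z i) \<le> \<epsilon>"
    "\<And>y z. y \<in> C \<Longrightarrow> z \<in> C \<Longrightarrow> dist (\<zeta> y n) (\<zeta> z n) \<le> \<epsilon>"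
  shows "history_map \<zeta> n C"
  unfolding history_map_def
proof (intro ballI conjI allI impI)
  fix y z i assume yz: "y \<in> C" "z \<in> C" and i: "1 \<le> i \<and> i \<le> n"
  then show "dist (\<zeta> y i) (\<zeta> z i) \<le> \<epsilon>"
    using assms(4,5)[OF yz] by (cases "i = n") auto
qed (use assms kstep_reverse in auto)

lemma big_plaque_of_growth:
  assumes C: "compact C" "connected C" and h: "history (k - 1) C" and k: "T < k"
    and ev: "evolves k C \<zeta>" "\<exists>y\<in>C. \<exists>z\<in>C. dist (\<zeta> y k) (\<zeta> z k) > \<epsilon>"
  shows "\<exists>D. big_plaque T D"
proof -
  define D where "D = (\<lambda>y. \<zeta> y k) ` C"
  have "pre_history T D"
    unfolding D_def by (rule pre_history_mono[OF evolves_pre_history[OF ev(1) h]]) (use k in auto)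
  moreover have "compact D" "connected D"
    unfolding D_def using evolvesD(6)[OF ev(1)] C by (auto intro: compact_continuous_image connected_continuous_image)
  moreover have "\<exists>w. \<forall>y\<in>D. (w, y) \<in> \<Sigma>"
    using evolvesD(5)[OF ev(1), of k] k by (auto simp: D_def)
  moreover have "\<exists>y\<in>D. \<exists>z\<in>D. dist y z > \<epsilon>"
    using ev(2) by (auto simp: D_def)
  ultimately show ?thesis
    unfolding big_plaque_def by blast
qed

lemma small_section_continua:
  assumes dim: "\<not> covering_dim_le X 1" and "d > 0"
  obtains w C where "compact C" "connected C" "\<And>y. y \<in> C \<Longrightarrow> (w, y) \<in> \<Sigma>" "\<And>y z. y \<in> C \<Longrightarrow> z \<in> C \<Longrightarrow> dist y z \<le> d"
    "\<exists>y\<in>C. \<exists>z\<in>C. y \<noteq> z"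
proof (rule ccontr)
  note found = that
  assume neg: "\<not> thesis"
  \<comment> \<open>Inside a ball of radius \<open>d / 2\<close> every subset of the section has
    diameter at most \<open>d\<close>, so a nondegenerate continuum there would be of the kind
    sought.\<close>
  define S where "S = (\<lambda>w. {y. (w, y) \<in> \<Sigma>} \<inter> cball w (d / 2))"
  have SX: "S w \<subseteq> X" for w
    using sec_in by (auto simp: S_def)
  have cS: "compact (S w)" for w
  proof -
    have "closed ((\<lambda>y. (w, y)) -` \<Sigma>)"
      by (intro closed_vimage sec_closed continuous_intros)
    moreover have "(\<lambda>y. (w, y)) -` \<Sigma> = {y. (w, y) \<in> \<Sigma>}"
      by auto
    ultimately have "closed (S w)"
      unfolding S_def by (intro closed_Int closed_cball) simp
    then show ?thesis
      using SX cpt by (metis compact_Int_closed inf.absorb2)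
  qed
  have td: "\<exists>a. C \<subseteq> {a}" if C: "C \<subseteq> S w" "connected C" for C w
  proof (rule ccontr)
    assume no: "\<nexists>a. C \<subseteq> {a}"
    have clS: "closure C \<subseteq> S w"
      using C(1) cS[of w] by (intro closure_minimal) (auto simp: compact_imp_closed)
    show False
    proof (rule neg[THEN notE], rule found[of "closure C" w])
      show "compact (closure C)"
        using clS cS[of w] by (metis closed_closure compact_Int_closed inf.absorb2)
      show "connected (closure C)"
        using C(2) by (rule connected_imp_connected_closure)
      show "(w, y) \<in> \<Sigma>" if "y \<in> closure C" for y
        using clS that by (auto simp: S_def)
      show "dist y z \<le> d" if "y \<in> closure C" "z \<in> closure C" for y z
      proof -
        have "dist w y \<le> d / 2" "dist w z \<le> d / 2"
          using clS that by (auto simp: S_def)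
        then show ?thesis
          using dist_triangle3[of y z w] by linarith
      qed
      show "\<exists>y\<in>closure C. \<exists>z\<in>closure C. y \<noteq> z"
        using no closure_subset[of C] by blast
    qed
  qed
  have "d / 2 > 0"
    using assms by simp
  then obtain d1 where d1: "d1 > 0" "\<And>w y z y' z'. y \<in> X \<Longrightarrow> z \<in> X \<Longrightarrow> dist y z \<le> d1 \<Longrightarrow> step y y' \<Longrightarrow> step z z' \<Longrightarrow>
    (w, y') \<in> \<Sigma> \<Longrightarrow> (w, z') \<in> \<Sigma> \<Longrightarrow> dist y' z' < d / 2"
    using section_step_uniform by metis
  obtain d2 where d2: "d2 > 0" "\<And>x y u v. x \<in> X \<Longrightarrow> y \<in> X \<Longrightarrow> \<bar>u\<bar> \<le> 1 \<Longrightarrow> \<bar>v\<bar> \<le> 1 \<Longrightarrow> \<bar>u - v\<bar> \<le> d2 \<Longrightarrow> dist x y \<le> d2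
    \<Longrightarrow> dist (\<phi> u x) (\<phi> v y) \<le> d1"
    using flow_uniform[OF d1(1)] by metis
  define r' where "r' = min r d2"
  have r': "r' > 0" "r' \<le> r" "r' \<le> d2"
    using r_pos d2(1) by (auto simp: r'_def)
  define \<psi> where "\<psi> = (\<lambda>(y, t). \<phi> t y)"
  define B where "B = (\<lambda>w. \<psi> ` (S w \<times> {-\<kappa>..\<kappa>}))"
  have contB: "continuous_on (S w \<times> {-\<kappa>..\<kappa>}) \<psi>" for w
    unfolding \<psi>_def case_prod_beta using SX by (intro continuous_intros) auto
  have hit: "y \<in> B w" if y: "w \<in> X" "y \<in> X" "dist w y \<le> r'" for w y
  proof -
    obtain s where s: "\<bar>s\<bar> \<le> \<kappa>" "(w, \<phi> s y) \<in> \<Sigma>"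
      using sec_hit[OF y(1,2)] y(3) r' by auto
    \<comment> \<open>\<open>section_step_uniform\<close> concerns steps of duration about 1.
      Starting one time unit earlier turns the projection of \<open>y\<close> to the section through
      \<open>w\<close> into such a step, which shows that it lands within \<open>d / 2\<close> of
      \<open>w\<close>.\<close>
    have "step (\<phi> (-1) w) w"
      unfolding kstep_def using y kappa by (intro exI[of _ 1]) simp
    moreover have "step (\<phi> (-1) y) (\<phi> s y)"
      unfolding kstep_def using y s by (intro exI[of _ "1 + s"]) (simp add: flow_flow)
    moreover have "dist (\<phi> (-1) w) (\<phi> (-1) y) \<le> d1"
      using y r' d2(1) by (intro d2(2)) auto
    ultimately have "dist w (\<phi> s y) < d / 2"
      using y s sec_refl by (intro d1(2)[of "\<phi> (-1) w" "\<phi> (-1) y" w "\<phi> s y" w]) auto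
    then have "\<phi> s y \<in> S w"
      using s by (simp add: S_def)
    moreover have "y = \<psi> (\<phi> s y, - s)"
      using y by (simp add: \<psi>_def)
    ultimately show ?thesis
      unfolding B_def using s(1) by (intro image_eqI[of _ _ "(\<phi> s y, - s)"]) (auto simp: abs_le_iff)
  qed
  have "X \<subseteq> (\<Union>w\<in>X. ball w r')"
    using r'(1) by auto
  then obtain I where I: "I \<subseteq> X" "finite I" "X \<subseteq> (\<Union>w\<in>I. ball w r')"
    using compactE_image[OF cpt, of X "\<lambda>w. ball w r'"] by (metis open_ball)
  have "X = (\<Union>w\<in>I. B w)"
  proof
    show "X \<subseteq> (\<Union>w\<in>I. B w)"
    proof
      fix y assume y: "y \<in> X"
      then obtain w where "w \<in> I" "dist w y < r'"
        using I(3) by auto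
      then show "y \<in> (\<Union>w\<in>I. B w)"
        using hit[of w y] y I(1) by auto
    qed
    show "(\<Union>w\<in>I. B w) \<subseteq> X"
      unfolding B_def \<psi>_def using SX by (auto intro!: flow_in)
  qed
  moreover have "covering_dim_le (\<Union>w\<in>I. B w) 1"
  proof (rule covering_dim_le_UN[OF I(2)])
    fix w
    show "compact (B w)"
      unfolding B_def using cS contB by (intro compact_continuous_image compact_Times) auto
    show "small_covers 1 (B w)"
      unfolding B_def
    proof (rule small_covers_box[OF cS td contB])
      show "inj_on \<psi> (S w \<times> {-\<kappa>..\<kappa>})"
      proof (rule inj_onI)
        fix a b assume "a \<in> S w \<times> {-\<kappa>..\<kappa>}" "b \<in> S w \<times> {-\<kappa>..\<kappa>}" "\<psi> a = \<psi> b"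
        moreover obtain y t z u where "a = (y, t)" "b = (z, u)"
          by (metis surj_pair)
        ultimately have *: "y \<in> S w" "z \<in> S w" "\<bar>t\<bar> \<le> \<kappa>" "\<bar>u\<bar> \<le> \<kappa>" "\<phi> t y = \<phi> u z" "a = (y, t)" "b = (z, u)"
          by (auto simp: \<psi>_def abs_le_iff)
        have X: "y \<in> X" "z \<in> X"
          using SX * by auto
        have "z = \<phi> (- u) (\<phi> t y)"
          using *(5) X by simp
        then have z: "z = \<phi> (t - u) y"
          using X by (simp add: flow_flow)
        then have "t - u = 0"
          using *(1-4) kappa sec_unique[of w y "t - u"] by (auto simp: S_def)
        then show "a = b"
          using z X * by simp
      qed
    qed
  qed
  ultimately show False
    using dim by simp
qed

lemma infinite_minimal_sets_of_dim:
  assumes dim: "\<not> covering_dim_le X 1"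
  shows "infinite {K. minimal_set \<phi> X K}"
proof -
  interpret R: exp_flow "\<lambda>t. \<phi> (- t)" X \<tau> \<kappa> \<epsilon> r \<Sigma>
    by (rule exp_flow_reverse)
  have either: "(\<exists>D. big_plaque T D) \<or> (\<exists>D. R.big_plaque T D)" for T
  proof -
    obtain d1 where d1: "d1 > 0" "\<And>C \<zeta> k y z. (\<And>y z. y \<in> C \<Longrightarrow> z \<in> C \<Longrightarrow> dist y z \<le> d1) \<Longrightarrow> evolves k C \<zeta> \<Longrightarrow> k \<le> T \<Longrightarrow>
      y \<in> C \<Longrightarrow> z \<in> C \<Longrightarrow> dist (\<zeta> y k) (\<zeta> z k) \<le> \<epsilon>"
      using evolves_small_upto[of T] by blast
    obtain d2 where d2: "d2 > 0" "\<And>C \<zeta> k y z. (\<And>y z. y \<in> C \<Longrightarrow> z \<in> C \<Longrightarrow> dist y z \<le> d2) \<Longrightarrow> R.evolves k C \<zeta> \<Longrightarrow> k \<le> T \<Longrightarrow>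
      y \<in> C \<Longrightarrow> z \<in> C \<Longrightarrow> dist (\<zeta> y k) (\<zeta> z k) \<le> \<epsilon>"
      using R.evolves_small_upto[of T] by blast
    define d where "d = min \<epsilon> (min d1 d2)"
    have "d > 0"
      using eps d1(1) d2(1) by (simp add: d_def)
    obtain w C where C: "compact C" "connected C" "\<And>y. y \<in> C \<Longrightarrow> (w, y) \<in> \<Sigma>" "\<And>y z. y \<in> C \<Longrightarrow> z \<in> C \<Longrightarrow> dist y z \<le> d"
      "\<exists>y\<in>C. \<exists>z\<in>C. y \<noteq> z"
      using small_section_continua[OF dim \<open>d > 0\<close>] by metis
    have close: "dist y z \<le> \<epsilon>" "dist y z \<le> d1" "dist y z \<le> d2" if "y \<in> C" "z \<in> C" for y z
      using C(4)[OF that] by (auto simp: d_def)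
    have CX: "C \<subseteq> X"
      using C(3) sec_in by blast
    obtain y z where yz: "y \<in> C" "z \<in> C" "y \<noteq> z"
      using C(5) by blast
    then have "dist y z > 0"
      by simp
    then obtain m where m: "\<And>\<eta> \<zeta> w. tracked m \<eta> \<zeta> \<Longrightarrow> (w, \<eta> 0) \<in> \<Sigma> \<Longrightarrow> (w, \<zeta> 0) \<in> \<Sigma> \<Longrightarrow> dist (\<eta> 0) (\<zeta> 0) < dist y z"
      using section_expansivity by metis
    define E where "E = (\<lambda>k. \<exists>\<zeta>. evolves k C \<zeta> \<and> (\<exists>y\<in>C. \<exists>z\<in>C. dist (\<zeta> y k) (\<zeta> z k) > \<epsilon>))"
    define E' where "E' = (\<lambda>k. \<exists>\<zeta>. R.evolves k C \<zeta> \<and> (\<exists>y\<in>C. \<exists>z\<in>C. dist (\<zeta> y k) (\<zeta> z k) > \<epsilon>))"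
    have alt: "(\<exists>\<zeta>. evolves n C \<zeta> \<and> (\<forall>y\<in>C. \<forall>z\<in>C. dist (\<zeta> y n) (\<zeta> z n) \<le> \<epsilon>)) \<or> (\<exists>k. 1 \<le> k \<and> k \<le> n \<and> E k)" for n
      using evolves_or_grows[OF CX close(1), of n] unfolding E_def by blast
    have alt': "(\<exists>\<zeta>. R.evolves n C \<zeta> \<and> (\<forall>y\<in>C. \<forall>z\<in>C. dist (\<zeta> y n) (\<zeta> z n) \<le> \<epsilon>)) \<or> (\<exists>k. 1 \<le> k \<and> k \<le> n \<and> E' k)" for n
      using R.evolves_or_grows[OF CX close(1), of n] unfolding E'_def by blast
    have hist: "history n C" if "R.evolves n C \<zeta>" "\<forall>y\<in>C. \<forall>z\<in>C. dist (\<zeta> y n) (\<zeta> z n) \<le> \<epsilon>" for n \<zeta>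
      unfolding history_def pre_history_def using history_map_of_reverse[of C \<zeta> n] R.evolvesD[OF that(1)] that(2) close(1) by blast
    \<comment> \<open>Otherwise \<open>y\<close> and \<open>z\<close> would track each other in both
      directions, and \<open>section_expansivity\<close> would make their distance smaller than
      itself.\<close>
    have "\<exists>k. E k \<or> E' k"
    proof (rule ccontr)
      assume no: "\<nexists>k. E k \<or> E' k"
      then obtain \<zeta> where ev: "evolves m C \<zeta>" "\<forall>y\<in>C. \<forall>z\<in>C. dist (\<zeta> y m) (\<zeta> z m) \<le> \<epsilon>"
        using alt[of m] by blast
      obtain \<zeta>' where ev': "R.evolves m C \<zeta>'" "\<forall>y\<in>C. \<forall>z\<in>C. dist (\<zeta>' y m) (\<zeta>' z m) \<le> \<epsilon>"
        using alt'[of m] no by blast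
      obtain \<xi> where "history_map \<xi> m C"
        using hist[OF ev'] unfolding history_def pre_history_def by blast
      then have "tracked m (\<lambda>i. if i \<ge> 0 then \<zeta> y (nat i) else \<xi> y (nat (- i))) (\<lambda>i. if i \<ge> 0 then \<zeta> z (nat i) else \<xi> z (nat (- i)))"
        using yz close(1) ev by (intro tracked_join[of m C]) auto
      from m[OF this, of w] show False
        using yz C(3) evolvesD(1)[OF ev(1)] by simp
    qed
    \<comment> \<open>The first stage at which \<open>C\<close> becomes large under the flow or its
      inverse. At stage \<open>k - 1\<close> both are still small, so the evolution in the opposite
      direction serves as a history for the growing one.\<close>
    define k where "k = (LEAST k. E k \<or> E' k)"
    have k: "E k \<or> E' k"
      unfolding k_def using \<open>\<exists>k. E k \<or> E' k\<close> by (rule LeastI_ex)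
    have below: "\<not> E j" "\<not> E' j" if "j < k" for j
      using not_less_Least[of j "\<lambda>k. E k \<or> E' k"] that unfolding k_def by auto
    have Tk: "T < k"
    proof (rule ccontr)
      assume "\<not> T < k"
      then have kT: "k \<le> T"
        by simp
      from k show False
      proof
        assume "E k"
        then obtain \<zeta> u v where *: "evolves k C \<zeta>" "u \<in> C" "v \<in> C" "dist (\<zeta> u k) (\<zeta> v k) > \<epsilon>"
          unfolding E_def by blast
        then show False
          using d1(2)[OF close(2) *(1) kT *(2,3)] by simp
      next
        assume "E' k"
        then obtain \<zeta> u v where *: "R.evolves k C \<zeta>" "u \<in> C" "v \<in> C" "dist (\<zeta> u k) (\<zeta> v k) > \<epsilon>"
          unfolding E'_def by blast
        then show False
          using d2(2)[OF close(3) *(1) kT *(2,3)] by simp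
      qed
    qed
    have "\<not> (\<exists>j. 1 \<le> j \<and> j \<le> k - 1 \<and> E j)" "\<not> (\<exists>j. 1 \<le> j \<and> j \<le> k - 1 \<and> E' j)"
    proof -
      have "j < k" if "j \<le> k - 1" for j
        using that Tk by linarith
      then show "\<not> (\<exists>j. 1 \<le> j \<and> j \<le> k - 1 \<and> E j)" "\<not> (\<exists>j. 1 \<le> j \<and> j \<le> k - 1 \<and> E' j)"
        using below by blast+
    qed
    then obtain \<zeta>1 \<zeta>2 where z1: "evolves (k - 1) C \<zeta>1" "\<forall>y\<in>C. \<forall>z\<in>C. dist (\<zeta>1 y (k - 1)) (\<zeta>1 z (k - 1)) \<le> \<epsilon>"
      and z2: "R.evolves (k - 1) C \<zeta>2" "\<forall>y\<in>C. \<forall>z\<in>C. dist (\<zeta>2 y (k - 1)) (\<zeta>2 z (k - 1)) \<le> \<epsilon>"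
      using alt[of "k - 1"] alt'[of "k - 1"] by blast
    from k show ?thesis
    proof
      assume "E k"
      then obtain \<zeta> where "evolves k C \<zeta>" "\<exists>y\<in>C. \<exists>z\<in>C. dist (\<zeta> y k) (\<zeta> z k) > \<epsilon>"
        unfolding E_def by blast
      then show ?thesis
        using big_plaque_of_growth[OF C(1,2) hist[OF z2] Tk] by blast
    next
      assume "E' k"
      then obtain \<zeta> where \<zeta>: "R.evolves k C \<zeta>" "\<exists>y\<in>C. \<exists>z\<in>C. dist (\<zeta> y k) (\<zeta> z k) > \<epsilon>"
        unfolding E'_def by blast
      have "R.history_map \<zeta>1 (k - 1) C"
        using evolvesD[OF z1(1)] z1(2) by (intro R.history_map_of_reverse) simp_all
      then have "R.history (k - 1) C"
        unfolding R.history_def R.pre_history_def using close(1) by blast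
      from R.big_plaque_of_growth[OF C(1,2) this Tk \<zeta>] show ?thesis
        by blast
    qed
  qed
  \<comment> \<open>The direction found in \<open>either\<close> may depend on \<open>T\<close>. If
    the forward one fails for some \<open>T0\<close>, it fails for every larger \<open>T\<close> by
    monotonicity, so the backward direction works for every \<open>T\<close>.\<close>
  have mono: "big_plaque T D" if "big_plaque T' D" "T \<le> T'" for T T' D
    using that pre_history_mono[OF _ subset_refl] unfolding big_plaque_def by blast
  show ?thesis
  proof (cases "\<forall>T. \<exists>D. big_plaque T D")
    case True
    then show ?thesis
      using infinite_minimal_sets by blast
  next
    case False
    then obtain T0 where T0: "\<nexists>D. big_plaque T0 D"
      by blast
    have "\<exists>D. R.big_plaque T D" for T
    proof -
      obtain D where "R.big_plaque (max T0 T) D"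
        using either[of "max T0 T"] T0 mono by (metis max.cobounded1)
      then have "R.big_plaque T D"
        using R.pre_history_mono[OF _ subset_refl, of "max T0 T" D T] unfolding R.big_plaque_def by auto
      then show ?thesis
        by blast
    qed
    from R.infinite_minimal_sets[OF this] have "infinite {K. minimal_set (\<lambda>t. \<phi> (- t)) X K}" .
    moreover have "invariant_set (\<lambda>t. \<phi> (- t)) L \<longleftrightarrow> invariant_set \<phi> L" for L
      unfolding invariant_set_def by (metis minus_minus)
    ultimately show ?thesis
      unfolding minimal_set_def by simp
  qed
qed

end

theorem theoremB:
  fixes X :: "'a::metric_space set" and \<phi> :: "real \<Rightarrow> 'a \<Rightarrow> 'a"
  assumes "compact X"
    and "\<not> covering_dim_le X 1"
    and "continuous_flow \<phi> X"
    and "regular_flow \<phi> X"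
    and "expansive_flow \<phi> X"
  shows "infinite {K. minimal_set \<phi> X K}"
proof -
  interpret cflow \<phi> X
    using assms by unfold_locales
  obtain \<tau> \<kappa> \<epsilon> r \<Sigma> where "exp_flow \<phi> X \<tau> \<kappa> \<epsilon> r \<Sigma>"
    using exp_flow_exists[OF assms(4,5)] by metis
  then interpret exp_flow \<phi> X \<tau> \<kappa> \<epsilon> r \<Sigma> .
  show ?thesis
    using assms(2) by (rule infinite_minimal_sets_of_dim)
qed

end
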